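(* Let $B$ be a real separable Banach space equipped with a centered Gaussian measure $\mu$, and let $H$ (with its isometry $I:H\to L^2(B,\mu)$) be a Cameron-Martin Hilbert space associated with $(B,\mu)$. Let $L$ be a closed affine subspace of $H$, let $h_L$ be the point on $L$ closest to the origin, and let $L_0$ be the closed subspace of $H$ given by $L_0=L-h_L$. Let $\mu_L$ be the Borel probability measure on $B$ determined by $$\int_B e^{iI(h)}\,d\mu_L=e^{i\langle h_L,h\rangle-\frac12\|P_{L_0}h\|^2}\qquad\text{for all }h\in H_{B^*},$$ and let $I_L:H\to L^2(B,\mu_L)$ be the continuous linear map that extends $H_{B^*}\to L^2(B,\mu_L):h\mapsto I(h)$. Then there is a unique unitary isomorphism $$U_L:\mathcal{F}_s(L_0)_c\to L^2(B,\mu_L)$$ for which $$U_L\bigl(\mathrm{Exp}(v)\bigr)=e^{I_L(v)-\frac12\|v\|^2}\qquad\text{for all }v\in L_0.$$ Here $L^2(B,\mu_L)$ in the target of $U_L$ is the space of complex-valued square-integrable functions.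
   Context: Centered Gaussian measure: $\mu$ is a Borel probability measure on the real separable Banach space $B$ such that every continuous linear functional $x^*\in B^*$ has, under $\mu$, a Gaussian distribution with mean $0$, with positive variance if $x^*\neq 0$. Cameron-Martin space: a real Hilbert space $H$ together with a linear isometry $I:H\to L^2(B,\mu)$ whose image contains $B^*$ (viewed in $L^2(B,\mu)$) as a dense subspace. Put $H_{B^*}=\{h\in H: I(h)\in B^*\}$; this is a dense subspace of $H$. For $h\in H_{B^*}$, $I(h)$ denotes the continuous linear functional itself, hence a function defined at every point of $B$. Closed affine subspace of $H$: a set $L=p+L_0$ with $p\in H$ and $L_0$ a closed linear subspace. $P_{L_0}:H\to H$ is the orthogonal projection onto $L_0$. Known facts used in the statement: for every closed affine subspace $L$ of $H$ there is a Borel probability measure $\mu_L$ on $B$ satisfying the displayed characteristic-function identity. The map $H_{B^*}\to L^2(B,\mu_L)$, $h\mapsto I(h)$, is linear and continuous for the norm of $H$, so it extends uniquely to a continuous linear map $I_L:H\to L^2(B,\mu_L)$. Symmetric Fock space: for a real Hilbert space $K$, $K^{\hat\otimes n}$ is the closed subspace of the Hilbert-space tensor power $K^{\otimes n}$ (with inner product determined by $\langle v_1\otimes\cdots\otimes v_n,w_1\otimes\cdots\otimes w_n\rangle_n=\prod_j\langle v_j,w_j\rangle$) consisting of the vectors invariant under all permutations of the tensor factors; $K^{\hat\otimes 0}=\mathbb{R}$. $\mathcal{F}_s(K)$ is the Hilbert space completion of the algebraic direct sum of the spaces $K^{\hat\otimes n}$, $n\ge 0$, with respect to the inner product $$\Bigl\langle\sum_n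 x_n,\sum_m y_m\Bigr\rangle=\sum_{n\ge0}n!\,\langle x_n,y_n\rangle_n\qquad(x_n,y_n\in K^{\hat\otimes n}).$$ $\mathcal{F}_s(K)_c$ is its complexification, a complex Hilbert space. For $v\in K$, the exponential vector is $\mathrm{Exp}(v)=\sum_{n=0}^\infty\frac{1}{n!}v^{\otimes n}\in\mathcal{F}_s(K)$. *)

theory Defs
  imports "HOL-Probability.Probability" "HOL-Combinatorics.Permutations"
begin

section \<open>Hilbert space completion\<close>

lemma Cauchy_add_vec:
  fixes X Y :: "nat \<Rightarrow> 'a::real_normed_vector"
  assumes "Cauchy X" "Cauchy Y"
  shows "Cauchy (\<lambda>n. X n + Y n)"
proof (rule CauchyI)
  fix e :: real assume "0 < e"
  then have "0 < e / 2" by simp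
  obtain M where M: "\<forall>m\<ge>M. \<forall>n\<ge>M. norm (X m - X n) < e / 2"
    using CauchyD[OF assms(1) \<open>0 < e / 2\<close>] by blast
  obtain N where N: "\<forall>m\<ge>N. \<forall>n\<ge>N. norm (Y m - Y n) < e / 2"
    using CauchyD[OF assms(2) \<open>0 < e / 2\<close>] by blast
  have "norm (X m + Y m - (X n + Y n)) < e" if "m \<ge> max M N" "n \<ge> max M N" for m n
  proof -
    have "norm (X m - X n) < e / 2" "norm (Y m - Y n) < e / 2"
      using M N that by auto
    then show ?thesis
      using norm_diff_triangle_ineq[of "X m" "Y m" "X n" "Y n"] by linarith
  qed
  then show "\<exists>M. \<forall>m\<ge>M. \<forall>n\<ge>M. norm (X m + Y m - (X n + Y n)) < e" by blast
qed

lemma Cauchy_scaleR_vec: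
  fixes X :: "nat \<Rightarrow> 'a::real_normed_vector"
  shows "Cauchy X \<Longrightarrow> Cauchy (\<lambda>n. r *\<^sub>R X n)"
  by (rule bounded_linear.Cauchy[OF bounded_linear_scaleR_right])

lemma Cauchy_minus_vec:
  fixes X :: "nat \<Rightarrow> 'a::real_normed_vector"
  shows "Cauchy X \<Longrightarrow> Cauchy (\<lambda>n. - X n)"
  by (rule bounded_linear.Cauchy[OF bounded_linear_minus[OF bounded_linear_ident]])

lemma Cauchy_diff_vec:
  fixes X Y :: "nat \<Rightarrow> 'a::real_normed_vector"
  shows "Cauchy X \<Longrightarrow> Cauchy Y \<Longrightarrow> Cauchy (\<lambda>n. X n - Y n)"
  using Cauchy_add_vec[of X "\<lambda>n. - Y n"] Cauchy_minus_vec[of Y] by simp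

lemma Cauchy_norm_convergent:
  fixes X :: "nat \<Rightarrow> 'a::real_normed_vector"
  assumes "Cauchy X"
  shows "convergent (\<lambda>n. norm (X n))"
proof -
  have "Cauchy (\<lambda>n. norm (X n))"
  proof (rule CauchyI)
    fix e :: real assume "0 < e"
    obtain M where "\<forall>m\<ge>M. \<forall>n\<ge>M. norm (X m - X n) < e"
      using CauchyD[OF assms \<open>0 < e\<close>] by blast
    then show "\<exists>M. \<forall>m\<ge>M. \<forall>n\<ge>M. norm (norm (X m) - norm (X n)) < e"
      by (metis real_norm_def norm_triangle_ineq3 le_less_trans)
  qed
  then show ?thesis by (simp add: Cauchy_convergent)
qed

lemma Cauchy_inner_convergent:
  fixes X Y :: "nat \<Rightarrow> 'a::real_inner"
  assumes "Cauchy X" "Cauchy Y"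
  shows "convergent (\<lambda>n. inner (X n) (Y n))"
proof -
  obtain a b c where "(\<lambda>n. norm (X n + Y n)) \<longlonglongrightarrow> a"
    "(\<lambda>n. norm (X n)) \<longlonglongrightarrow> b" "(\<lambda>n. norm (Y n)) \<longlonglongrightarrow> c"
    using Cauchy_norm_convergent[OF Cauchy_add_vec[OF assms]]
      Cauchy_norm_convergent[OF assms(1)] Cauchy_norm_convergent[OF assms(2)]
    unfolding convergent_def by blast
  then have "(\<lambda>n. ((norm (X n + Y n))\<^sup>2 - (norm (X n))\<^sup>2 - (norm (Y n))\<^sup>2) / 2)
      \<longlonglongrightarrow> (a\<^sup>2 - b\<^sup>2 - c\<^sup>2) / 2"
    by (intro tendsto_intros) auto
  then show ?thesis
    unfolding convergent_def dot_norm by blast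
qed

lemma tendsto_inner_null:
  fixes X Y :: "nat \<Rightarrow> 'a::real_inner"
  assumes "Cauchy X" "Y \<longlonglongrightarrow> 0"
  shows "(\<lambda>n. inner (X n) (Y n)) \<longlonglongrightarrow> 0"
proof -
  obtain a where a: "(\<lambda>n. norm (X n)) \<longlonglongrightarrow> a"
    using Cauchy_norm_convergent[OF assms(1)] by (auto simp: convergent_def)
  have "(\<lambda>n. norm (X n) * norm (Y n)) \<longlonglongrightarrow> a * 0"
    using assms(2) a by (intro tendsto_mult) (simp_all add: tendsto_norm_zero)
  then have "(\<lambda>n. norm (X n) * norm (Y n)) \<longlonglongrightarrow> 0" by simp
  then show ?thesis
    by (rule Lim_null_comparison[rotated]) (simp add: Cauchy_Schwarz_ineq2)
qed

text \<open>Elements of the completion are Cauchy sequences modulo null sequences.\<close>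

quotient_type (overloaded) 'a completion =
  "nat \<Rightarrow> 'a::real_inner" / partial: "\<lambda>X Y. Cauchy X \<and> Cauchy Y \<and> (\<lambda>n. X n - Y n) \<longlonglongrightarrow> 0"
proof (rule part_equivpI)
  show "\<exists>x::nat \<Rightarrow> 'a. Cauchy x \<and> Cauchy x \<and> (\<lambda>n. x n - x n) \<longlonglongrightarrow> 0"
    by (rule exI[of _ "\<lambda>_. 0"]) (simp add: convergent_Cauchy convergent_const)
  show "symp (\<lambda>X Y :: nat \<Rightarrow> 'a. Cauchy X \<and> Cauchy Y \<and> (\<lambda>n. X n - Y n) \<longlonglongrightarrow> 0)"
  proof (rule sympI)
    fix X Y :: "nat \<Rightarrow> 'a"
    assume "Cauchy X \<and> Cauchy Y \<and> (\<lambda>n. X n - Y n) \<longlonglongrightarrow> 0"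
    then show "Cauchy Y \<and> Cauchy X \<and> (\<lambda>n. Y n - X n) \<longlonglongrightarrow> 0"
      using tendsto_minus[of "\<lambda>n. X n - Y n" 0 sequentially] by simp
  qed
  show "transp (\<lambda>X Y :: nat \<Rightarrow> 'a. Cauchy X \<and> Cauchy Y \<and> (\<lambda>n. X n - Y n) \<longlonglongrightarrow> 0)"
  proof (rule transpI)
    fix X Y Z :: "nat \<Rightarrow> 'a"
    assume "Cauchy X \<and> Cauchy Y \<and> (\<lambda>n. X n - Y n) \<longlonglongrightarrow> 0"
      "Cauchy Y \<and> Cauchy Z \<and> (\<lambda>n. Y n - Z n) \<longlonglongrightarrow> 0"
    then show "Cauchy X \<and> Cauchy Z \<and> (\<lambda>n. X n - Z n) \<longlonglongrightarrow> 0"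
      using tendsto_add[of "\<lambda>n. X n - Y n" 0 sequentially "\<lambda>n. Y n - Z n" 0] by simp
  qed
qed

lift_definition to_completion :: "'a::real_inner \<Rightarrow> 'a completion" is "\<lambda>x n. x"
  by (simp add: convergent_Cauchy convergent_const)

instantiation completion :: (real_inner) real_inner
begin

lift_definition zero_completion :: "'a completion" is "\<lambda>n. 0"
  by (simp add: convergent_Cauchy convergent_const)

lift_definition plus_completion :: "'a completion \<Rightarrow> 'a completion \<Rightarrow> 'a completion"
  is "\<lambda>X Y n. X n + Y n"
proof (intro conjI; (elim conjE)?)
  fix X X' Y Y' :: "nat \<Rightarrow> 'a"
  assume *: "Cauchy X" "Cauchy X'" "(\<lambda>n. X n - X' n) \<longlonglongrightarrow> 0"
    "Cauchy Y" "Cauchy Y'" "(\<lambda>n. Y n - Y' n) \<longlonglongrightarrow> 0"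
  show "Cauchy (\<lambda>n. X n + Y n)" "Cauchy (\<lambda>n. X' n + Y' n)"
    using * by (simp_all add: Cauchy_add_vec)
  show "(\<lambda>n. X n + Y n - (X' n + Y' n)) \<longlonglongrightarrow> 0"
    using tendsto_add[OF *(3) *(6)] by (simp add: algebra_simps)
qed

lift_definition uminus_completion :: "'a completion \<Rightarrow> 'a completion" is "\<lambda>X n. - X n"
proof (intro conjI; (elim conjE)?)
  fix X X' :: "nat \<Rightarrow> 'a"
  assume *: "Cauchy X" "Cauchy X'" "(\<lambda>n. X n - X' n) \<longlonglongrightarrow> 0"
  show "Cauchy (\<lambda>n. - X n)" "Cauchy (\<lambda>n. - X' n)"
    using * by (simp_all add: Cauchy_minus_vec)
  show "(\<lambda>n. - X n - - X' n) \<longlonglongrightarrow> 0"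
    using tendsto_minus[OF *(3)] by simp
qed

definition minus_completion :: "'a completion \<Rightarrow> 'a completion \<Rightarrow> 'a completion" where
  "minus_completion x y = x + (- y)"

lift_definition scaleR_completion :: "real \<Rightarrow> 'a completion \<Rightarrow> 'a completion"
  is "\<lambda>r X n. r *\<^sub>R X n"
proof (intro conjI; (elim conjE)?)
  fix r and X X' :: "nat \<Rightarrow> 'a"
  assume *: "Cauchy X" "Cauchy X'" "(\<lambda>n. X n - X' n) \<longlonglongrightarrow> 0"
  show "Cauchy (\<lambda>n. r *\<^sub>R X n)" "Cauchy (\<lambda>n. r *\<^sub>R X' n)"
    using * by (simp_all add: Cauchy_scaleR_vec)
  show "(\<lambda>n. r *\<^sub>R X n - r *\<^sub>R X' n) \<longlonglongrightarrow> 0"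
    using tendsto_scaleR[OF tendsto_const *(3), of r] by (simp add: algebra_simps)
qed

lift_definition inner_completion :: "'a completion \<Rightarrow> 'a completion \<Rightarrow> real"
  is "\<lambda>X Y. lim (\<lambda>n. inner (X n) (Y n))"
proof (elim conjE)
  fix X X' Y Y' :: "nat \<Rightarrow> 'a"
  assume *: "Cauchy X" "Cauchy X'" "(\<lambda>n. X n - X' n) \<longlonglongrightarrow> 0"
    "Cauchy Y" "Cauchy Y'" "(\<lambda>n. Y n - Y' n) \<longlonglongrightarrow> 0"
  have 1: "(\<lambda>n. inner (X' n) (Y' n)) \<longlonglongrightarrow> lim (\<lambda>n. inner (X' n) (Y' n))"
    using Cauchy_inner_convergent[OF *(2,5)] by (simp add: convergent_LIMSEQ_iff)
  have "(\<lambda>n. inner (X' n) (Y' n) + (inner (Y n) (X n - X' n) + inner (X' n) (Y n - Y' n)))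
      \<longlonglongrightarrow> lim (\<lambda>n. inner (X' n) (Y' n)) + (0 + 0)"
    using * 1 by (intro tendsto_add tendsto_inner_null) auto
  then have "(\<lambda>n. inner (X n) (Y n)) \<longlonglongrightarrow> lim (\<lambda>n. inner (X' n) (Y' n))"
    by (simp add: inner_diff_right inner_commute algebra_simps)
  then show "lim (\<lambda>n. inner (X n) (Y n)) = lim (\<lambda>n. inner (X' n) (Y' n))"
    by (rule limI)
qed

definition norm_completion :: "'a completion \<Rightarrow> real" where
  "norm_completion x = sqrt (inner x x)"

definition dist_completion :: "'a completion \<Rightarrow> 'a completion \<Rightarrow> real" where
  "dist_completion x y = norm (x - y)"

definition sgn_completion :: "'a completion \<Rightarrow> 'a completion" where
  "sgn_completion x = inverse (norm x) *\<^sub>R x"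

definition uniformity_completion :: "('a completion \<times> 'a completion) filter" where
  "uniformity_completion = (INF e\<in>{0<..}. principal {(x, y). dist x y < e})"

definition open_completion :: "'a completion set \<Rightarrow> bool" where
  "open_completion U \<longleftrightarrow>
    (\<forall>x\<in>U. eventually (\<lambda>(x', y). x' = x \<longrightarrow> y \<in> U) uniformity)"

instance
proof
  fix a b c :: "'a completion" and r s :: real
  show "a + b + c = a + (b + c)"
    by transfer (auto simp: algebra_simps intro: Cauchy_add_vec)
  show "a + b = b + a"
    by transfer (auto simp: algebra_simps intro: Cauchy_add_vec)
  show "0 + a = a" by transfer simp
  show "- a + a = 0" by transfer (simp add: convergent_Cauchy convergent_const)
  show "a - b = a + - b" by (simp add: minus_completion_def)
  show "r *\<^sub>R (a + b) = r *\<^sub>R a + r *\<^sub>R b"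
    by transfer (auto simp: algebra_simps intro!: Cauchy_add_vec Cauchy_scaleR_vec)
  show "(r + s) *\<^sub>R a = r *\<^sub>R a + s *\<^sub>R a"
    by transfer (auto simp: algebra_simps intro!: Cauchy_add_vec Cauchy_scaleR_vec)
  show "r *\<^sub>R s *\<^sub>R a = (r * s) *\<^sub>R a"
    by transfer (auto simp: algebra_simps intro!: Cauchy_scaleR_vec)
  show "1 *\<^sub>R a = a" by transfer simp
  show "sgn a = inverse (norm a) *\<^sub>R a" by (simp add: sgn_completion_def)
  show "dist a b = norm (a - b)" by (simp add: dist_completion_def)
  show "(uniformity :: ('a completion \<times> 'a completion) filter) =
      (INF e\<in>{0<..}. principal {(x, y). dist x y < e})"
    by (simp add: uniformity_completion_def)
  show "open U \<longleftrightarrow> (\<forall>x\<in>U. eventually (\<lambda>(x', y). x' = x \<longrightarrow> y \<in> U) uniformity)"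
    for U :: "'a completion set"
    by (simp add: open_completion_def)
  show "inner a b = inner b a" by transfer (simp add: inner_commute)
  show "inner (a + b) c = inner a c + inner b c"
  proof transfer
    fix X Y Z :: "nat \<Rightarrow> 'a"
    assume *: "Cauchy X \<and> Cauchy X \<and> (\<lambda>n. X n - X n) \<longlonglongrightarrow> 0"
      "Cauchy Y \<and> Cauchy Y \<and> (\<lambda>n. Y n - Y n) \<longlonglongrightarrow> 0"
      "Cauchy Z \<and> Cauchy Z \<and> (\<lambda>n. Z n - Z n) \<longlonglongrightarrow> 0"
    have "(\<lambda>n. inner (X n) (Z n) + inner (Y n) (Z n))
        \<longlonglongrightarrow> lim (\<lambda>n. inner (X n) (Z n)) + lim (\<lambda>n. inner (Y n) (Z n))"
      using * Cauchy_inner_convergent[of X Z] Cauchy_inner_convergent[of Y Z]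
      by (intro tendsto_add) (simp_all add: convergent_LIMSEQ_iff)
    then show "lim (\<lambda>n. inner (X n + Y n) (Z n))
        = lim (\<lambda>n. inner (X n) (Z n)) + lim (\<lambda>n. inner (Y n) (Z n))"
      by (simp add: inner_add_left limI)
  qed
  show "inner (r *\<^sub>R a) b = r * inner a b"
  proof (transfer fixing: r)
    fix X Y :: "nat \<Rightarrow> 'a"
    assume *: "Cauchy X \<and> Cauchy X \<and> (\<lambda>n. X n - X n) \<longlonglongrightarrow> 0"
      "Cauchy Y \<and> Cauchy Y \<and> (\<lambda>n. Y n - Y n) \<longlonglongrightarrow> 0"
    have "(\<lambda>n. r * inner (X n) (Y n)) \<longlonglongrightarrow> r * lim (\<lambda>n. inner (X n) (Y n))"
      using * Cauchy_inner_convergent[of X Y]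
      by (intro tendsto_mult tendsto_const) (simp_all add: convergent_LIMSEQ_iff)
    then show "lim (\<lambda>n. inner (r *\<^sub>R X n) (Y n)) = r * lim (\<lambda>n. inner (X n) (Y n))"
      by (simp add: limI)
  qed
  show "0 \<le> inner a a"
  proof transfer
    fix X :: "nat \<Rightarrow> 'a"
    assume "Cauchy X \<and> Cauchy X \<and> (\<lambda>n. X n - X n) \<longlonglongrightarrow> 0"
    then have "(\<lambda>n. inner (X n) (X n)) \<longlonglongrightarrow> lim (\<lambda>n. inner (X n) (X n))"
      using Cauchy_inner_convergent[of X X] by (simp add: convergent_LIMSEQ_iff)
    then show "0 \<le> lim (\<lambda>n. inner (X n) (X n))"
      by (rule LIMSEQ_le_const) simp
  qed
  show "inner a a = 0 \<longleftrightarrow> a = 0"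
  proof transfer
    fix X :: "nat \<Rightarrow> 'a"
    assume *: "Cauchy X \<and> Cauchy X \<and> (\<lambda>n. X n - X n) \<longlonglongrightarrow> 0"
    then have conv: "(\<lambda>n. inner (X n) (X n)) \<longlonglongrightarrow> lim (\<lambda>n. inner (X n) (X n))"
      using Cauchy_inner_convergent[of X X] by (simp add: convergent_LIMSEQ_iff)
    have "X \<longlonglongrightarrow> 0" if "lim (\<lambda>n. inner (X n) (X n)) = 0"
    proof -
      have "(\<lambda>n. sqrt (inner (X n) (X n))) \<longlonglongrightarrow> sqrt 0"
        using conv that by (intro tendsto_real_sqrt) simp
      then show ?thesis
        by (simp add: norm_eq_sqrt_inner[symmetric] tendsto_norm_zero_iff)
    qed
    moreover have "lim (\<lambda>n. inner (X n) (X n)) = 0" if "X \<longlonglongrightarrow> 0"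
      using tendsto_inner_null[of X X] that * by (simp add: limI)
    ultimately show "lim (\<lambda>n. inner (X n) (X n)) = 0 \<longleftrightarrow>
        Cauchy X \<and> Cauchy (\<lambda>n. 0::'a) \<and> (\<lambda>n. X n - 0) \<longlonglongrightarrow> 0"
      using * by (auto simp: convergent_Cauchy convergent_const)
  qed
  show "norm a = sqrt (inner a a)" by (simp add: norm_completion_def)
qed

end

lemma inner_to_completion [simp]: "inner (to_completion x) (to_completion y) = inner x y"
  by transfer (simp add: limI)

lemma norm_to_completion [simp]: "norm (to_completion x) = norm x"
  by (simp add: norm_eq_sqrt_inner)

lemma to_completion_add: "to_completion (x + y) = to_completion x + to_completion y"
  by transfer (simp add: convergent_Cauchy convergent_const)

lemma to_completion_scaleR: "to_completion (r *\<^sub>R x) = r *\<^sub>R to_completion x"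
  by transfer (simp add: convergent_Cauchy convergent_const)

lemma bounded_linear_to_completion: "bounded_linear to_completion"
  by (rule bounded_linear_intro[of _ 1]) (simp_all add: to_completion_add to_completion_scaleR)

lemma to_completion_diff: "to_completion (x - y) = to_completion x - to_completion y"
  by (rule linear_diff[OF bounded_linear.linear[OF bounded_linear_to_completion]])

lemma to_completion_tendsto:
  fixes X :: "nat \<Rightarrow> 'a::real_inner"
  assumes X: "Cauchy X"
  shows "(\<lambda>k. to_completion (X k)) \<longlonglongrightarrow> abs_completion X"
proof (rule LIMSEQ_I)
  fix e :: real assume "0 < e"
  then have "0 < e / 2" by simp
  obtain M where M: "\<forall>m\<ge>M. \<forall>n\<ge>M. norm (X m - X n) < e / 2"
    using CauchyD[OF X \<open>0 < e / 2\<close>] by blast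
  have "norm (to_completion (X k) - abs_completion X) < e" if k: "k \<ge> M" for k
  proof -
    have eq: "to_completion (X k) - abs_completion X = abs_completion (\<lambda>n. X k - X n)"
      using X by (simp add: minus_completion_def uminus_completion.abs_eq
          to_completion.abs_eq plus_completion.abs_eq convergent_Cauchy convergent_const
          Cauchy_minus_vec)
    have C: "Cauchy (\<lambda>n. X k - X n)"
      using X by (intro Cauchy_diff_vec) (simp_all add: convergent_Cauchy convergent_const)
    have "inner (abs_completion (\<lambda>n. X k - X n)) (abs_completion (\<lambda>n. X k - X n))
        = lim (\<lambda>n. inner (X k - X n) (X k - X n))"
      using C by (simp add: inner_completion.abs_eq)
    moreover have "lim (\<lambda>n. inner (X k - X n) (X k - X n)) \<le> (e / 2)\<^sup>2"
    proof (rule LIMSEQ_le_const2)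
      show "(\<lambda>n. inner (X k - X n) (X k - X n)) \<longlonglongrightarrow> lim (\<lambda>n. inner (X k - X n) (X k - X n))"
        using Cauchy_inner_convergent[OF C C] by (simp add: convergent_LIMSEQ_iff)
      have "inner (X k - X n) (X k - X n) \<le> (e / 2)\<^sup>2" if "n \<ge> M" for n
      proof -
        have "norm (X k - X n) \<le> e / 2" using M k that by (simp add: less_imp_le)
        then have "(norm (X k - X n))\<^sup>2 \<le> (e / 2)\<^sup>2" by (intro power_mono) auto
        then show ?thesis by (simp add: power2_norm_eq_inner)
      qed
      then show "\<exists>N. \<forall>n\<ge>N. inner (X k - X n) (X k - X n) \<le> (e / 2)\<^sup>2" by blast
    qed
    ultimately have "(norm (to_completion (X k) - abs_completion X))\<^sup>2 \<le> (e / 2)\<^sup>2"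
      by (simp add: eq power2_norm_eq_inner)
    then have "norm (to_completion (X k) - abs_completion X) \<le> e / 2"
      by (rule power2_le_imp_le) (use \<open>0 < e\<close> in simp)
    then show ?thesis using \<open>0 < e\<close> by linarith
  qed
  then show "\<exists>M. \<forall>k\<ge>M. norm (to_completion (X k) - abs_completion X) < e" by blast
qed

lemma to_completion_dense: "closure (range to_completion) = UNIV"
proof -
  have "x \<in> closure (range to_completion)" for x :: "'a completion"
  proof -
    have "\<exists>X. Cauchy X \<and> x = abs_completion X"
    proof (induct x)
      case (1 y)
      then show ?case by blast
    qed
    then obtain X where X: "Cauchy X" "x = abs_completion X"
      by (elim exE conjE) (rule that)
    have "(\<forall>k. to_completion (X k) \<in> range to_completion) \<and> (\<lambda>k. to_completion (X k)) \<longlonglongrightarrow> x"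
      using to_completion_tendsto[OF X(1)] by (simp add: X(2))
    then show ?thesis
      unfolding closure_sequential by (rule exI[of _ "\<lambda>k. to_completion (X k)"])
  qed
  then show ?thesis by blast
qed

instance completion :: (real_inner) complete_space
proof
  fix X :: "nat \<Rightarrow> 'a completion"
  assume X: "Cauchy X"
  have "\<exists>y. dist (to_completion y) (X n) < 1 / real (Suc n)" for n
    proof -
    have "X n \<in> closure (range to_completion)" by (simp add: to_completion_dense)
    then have "\<exists>z\<in>range to_completion. dist z (X n) < 1 / real (Suc n)"
      unfolding closure_approachable by simp
    then show ?thesis by blast
  qed
  then obtain y where y: "\<And>n. dist (to_completion (y n)) (X n) < 1 / real (Suc n)"
    by metis
  have lim0: "(\<lambda>n. to_completion (y n) - X n) \<longlonglongrightarrow> 0"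
    by (rule Lim_null_comparison[OF _ LIMSEQ_Suc[OF lim_1_over_n]])
      (use y in \<open>auto simp: dist_norm intro!: always_eventually less_imp_le\<close>)
  have "Cauchy (\<lambda>n. X n + (to_completion (y n) - X n))"
    using X lim0 by (intro Cauchy_add_vec) (auto simp: LIMSEQ_imp_Cauchy)
  then have "Cauchy (\<lambda>n. to_completion (y n))" by simp
  then have "Cauchy y"
    by (simp add: Cauchy_def dist_norm flip: to_completion_diff)
  then have "(\<lambda>n. to_completion (y n) - (to_completion (y n) - X n))
      \<longlonglongrightarrow> abs_completion y - 0"
    by (intro tendsto_diff to_completion_tendsto lim0)
  then show "convergent X" by (auto simp: convergent_def)
qed

lift_definition completion_map ::
  "('a::real_inner \<Rightarrow>\<^sub>L 'b::real_inner) \<Rightarrow> 'a completion \<Rightarrow> 'b completion"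
  is "\<lambda>f X n. blinfun_apply f (X n)"
proof (intro conjI; elim conjE)
  fix f :: "'a \<Rightarrow>\<^sub>L 'b" and X Y :: "nat \<Rightarrow> 'a"
  assume *: "Cauchy X" "Cauchy Y" "(\<lambda>n. X n - Y n) \<longlonglongrightarrow> 0"
  show "Cauchy (\<lambda>n. blinfun_apply f (X n))" "Cauchy (\<lambda>n. blinfun_apply f (Y n))"
    using * by (auto intro: bounded_linear.Cauchy[OF blinfun.bounded_linear_right])
  show "(\<lambda>n. blinfun_apply f (X n) - blinfun_apply f (Y n)) \<longlonglongrightarrow> 0"
    using bounded_linear.tendsto[OF blinfun.bounded_linear_right[of f] *(3)]
    by (simp add: blinfun.diff_right)
qed

lemma completion_map_to_completion [simp]:
  "completion_map f (to_completion x) = to_completion (blinfun_apply f x)"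
  by transfer (simp add: convergent_Cauchy convergent_const)

lemma bounded_linear_completion_map:
  assumes iso: "\<And>x y. inner (blinfun_apply f x) (blinfun_apply f y) = inner x y"
  shows "bounded_linear (completion_map f)"
proof (rule bounded_linear_intro[of _ 1])
  show "completion_map f (x + y) = completion_map f x + completion_map f y" for x y
    by transfer (auto simp: blinfun.add_right
        intro!: Cauchy_add_vec bounded_linear.Cauchy[OF blinfun.bounded_linear_right])
  show "completion_map f (r *\<^sub>R x) = r *\<^sub>R completion_map f x" for r x
    by transfer (auto simp: blinfun.scaleR_right
        intro!: Cauchy_scaleR_vec bounded_linear.Cauchy[OF blinfun.bounded_linear_right])
  have "inner (completion_map f x) (completion_map f x) = inner x x" for x
    using iso by (transfer fixing: f) simp
  then show "norm (completion_map f x) \<le> norm x * 1" for x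
    by (simp add: norm_eq_sqrt_inner)
qed

section \<open>Tensor powers\<close>

definition list_inner :: "'a::real_inner list \<Rightarrow> 'a list \<Rightarrow> real" where
  "list_inner vs ws =
    (if length vs = length ws then \<Prod>i<length vs. inner (vs ! i) (ws ! i) else 0)"

lemma list_inner_commute: "list_inner vs ws = list_inner ws vs"
proof (cases "length vs = length ws")
  case True
  then show ?thesis by (simp only: list_inner_def inner_commute[of "vs ! _"] if_True simp_thms)
next
  case False
  then show ?thesis by (simp add: list_inner_def)
qed

lemma finite_parseval:
  fixes S :: "'a::real_inner set"
  assumes "finite S"
  shows "\<exists>E. finite E \<and> (\<forall>e\<in>E. \<forall>f\<in>E. inner e f = (if e = f then 1 else 0)) \<and>
    (\<forall>u\<in>S. u = (\<Sum>e\<in>E. inner u e *\<^sub>R e))"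
  using assms
proof (induction S rule: finite_induct)
  case empty
  show ?case by (rule exI[of _ "{}"]) simp
next
  case (insert x S)
  then obtain E where E: "finite E" and on: "\<forall>e\<in>E. \<forall>f\<in>E. inner e f = (if e = f then 1 else 0)"
    and S: "\<forall>u\<in>S. u = (\<Sum>e\<in>E. inner u e *\<^sub>R e)"
    by blast
  define y where "y = x - (\<Sum>e\<in>E. inner x e *\<^sub>R e)"
  have yE: "inner y f = 0" if "f \<in> E" for f
  proof -
    have "inner (\<Sum>e\<in>E. inner x e *\<^sub>R e) f = (\<Sum>e\<in>E. if e = f then inner x e else 0)"
      unfolding inner_sum_left using on that by (intro sum.cong) auto
    also have "\<dots> = inner x f" using E that by simp
    finally show ?thesis by (simp add: y_def inner_diff_left)
  qed
  show ?case
  proof (cases "y = 0")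
    case True
    then show ?thesis using E on S by (intro exI[of _ E]) (auto simp: y_def)
  next
    case False
    define e0 where "e0 = y /\<^sub>R norm y"
    have e0E: "inner e0 f = 0" if "f \<in> E" for f
      using yE[OF that] by (simp add: e0_def)
    have e00: "inner e0 e0 = 1"
      using False by (simp add: e0_def norm_eq_sqrt_inner[symmetric] power2_norm_eq_inner[symmetric] power2_eq_square)
    have e0E': "inner f e0 = 0" if "f \<in> E" for f
      using e0E[OF that] by (simp add: inner_commute)
    have nE: "e0 \<notin> E" using e0E e00 by force
    have Se0: "inner u e0 = 0" if "u \<in> S" for u
    proof -
      have "inner (\<Sum>e\<in>E. inner u e *\<^sub>R e) e0 = 0"
        unfolding inner_sum_left using e0E by (intro sum.neutral) (simp add: inner_commute)
      then show ?thesis using S that by metis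
    qed
    have "inner (\<Sum>e\<in>E. inner x e *\<^sub>R e) e0 = 0"
      unfolding inner_sum_left using e0E by (intro sum.neutral) (simp add: inner_commute)
    then have "inner x e0 = inner y e0" by (simp add: y_def inner_diff_left)
    also have "\<dots> = norm y"
      using False by (simp add: e0_def power2_norm_eq_inner[symmetric] power2_eq_square)
    finally have "inner x e0 *\<^sub>R e0 = y" using False by (simp add: e0_def)
    then have x: "x = inner x e0 *\<^sub>R e0 + (\<Sum>e\<in>E. inner x e *\<^sub>R e)"
      by (simp add: y_def)
    show ?thesis
    proof (intro exI[of _ "insert e0 E"] conjI ballI)
      show "finite (insert e0 E)" using E by simp
      show "inner e f = (if e = f then 1 else 0)" if "e \<in> insert e0 E" "f \<in> insert e0 E" for e f
        using that on e0E e0E' e00 nE by auto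
      show "u = (\<Sum>e\<in>insert e0 E. inner u e *\<^sub>R e)" if "u \<in> insert x S" for u
        using that S Se0 x E nE by auto
    qed
  qed
qed

lemma psd_mult_inner:
  fixes K :: "'i \<Rightarrow> 'i \<Rightarrow> real" and p :: "'i \<Rightarrow> 'a::real_inner"
  assumes A: "finite A" and K: "\<And>c. 0 \<le> (\<Sum>v\<in>A. \<Sum>w\<in>A. c v * c w * K v w)"
  shows "0 \<le> (\<Sum>v\<in>A. \<Sum>w\<in>A. c v * c w * (K v w * inner (p v) (p w)))"
proof -
  obtain E where E: "finite E" and on: "\<forall>e\<in>E. \<forall>f\<in>E. inner e f = (if e = f then 1 else 0)"
    and S: "\<forall>u\<in>p ` A. u = (\<Sum>e\<in>E. inner u e *\<^sub>R e)"
    using finite_parseval[of "p ` A"] A by auto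
  have P: "inner (p v) (p w) = (\<Sum>e\<in>E. inner (p v) e * inner (p w) e)" if "v \<in> A" "w \<in> A" for v w
  proof -
    have "inner (p v) (p w) = inner (\<Sum>e\<in>E. inner (p v) e *\<^sub>R e) (p w)"
      using S that by (metis imageI)
    also have "\<dots> = (\<Sum>e\<in>E. inner (p v) e * inner e (p w))"
      by (simp only: inner_sum_left inner_scaleR_left)
    finally show ?thesis by (simp only: inner_commute[of _ "p w"])
  qed
  have "(\<Sum>v\<in>A. \<Sum>w\<in>A. c v * c w * (K v w * inner (p v) (p w)))
      = (\<Sum>v\<in>A. \<Sum>w\<in>A. \<Sum>e\<in>E. (c v * inner (p v) e) * (c w * inner (p w) e) * K v w)"
    by (intro sum.cong) (auto simp: P sum_distrib_left sum_distrib_right intro!: sum.cong)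
  also have "\<dots> = (\<Sum>e\<in>E. \<Sum>v\<in>A. \<Sum>w\<in>A. (c v * inner (p v) e) * (c w * inner (p w) e) * K v w)"
    by (subst sum.swap[of _ A E], intro sum.cong refl, rule sum.swap)
  also have "\<dots> \<ge> 0" by (intro sum_nonneg K[of "\<lambda>v. c v * inner (p v) e" for e])
  finally show ?thesis .
qed

lemma list_inner_psd:
  fixes A :: "'a::real_inner list set"
  assumes A: "finite A"
  shows "0 \<le> (\<Sum>v\<in>A. \<Sum>w\<in>A. c v * c w * list_inner v w)"
proof -
  have prod: "0 \<le> (\<Sum>v\<in>A. \<Sum>w\<in>A. c v * c w * (\<Prod>i<n. inner (v ! i) (w ! i)))" for c and n :: nat
  proof (induction n arbitrary: c)
    case 0
    have "(\<Sum>v\<in>A. \<Sum>w\<in>A. c v * c w) = (\<Sum>v\<in>A. c v)\<^sup>2"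
      by (simp add: power2_eq_square sum_product)
    then show ?case by simp
  next
    case (Suc n)
    show ?case
      using psd_mult_inner[OF A, of "\<lambda>v w. \<Prod>i<n. inner (v ! i) (w ! i)" c "\<lambda>v. v ! n"] Suc.IH
      by simp
  qed
  define c' where "c' n v = (if length v = n then c v else 0)" for n v
  have "(\<Sum>v\<in>A. \<Sum>w\<in>A. c v * c w * list_inner v w)
     = (\<Sum>v\<in>A. \<Sum>w\<in>A. \<Sum>n\<in>length ` A. c' n v * c' n w * (\<Prod>i<n. inner (v ! i) (w ! i)))"
  proof (intro sum.cong refl)
    fix v w assume "v \<in> A" "w \<in> A"
    have "(\<Sum>n\<in>length ` A. c' n v * c' n w * (\<Prod>i<n. inner (v ! i) (w ! i)))
      = (\<Sum>n\<in>length ` A. if n = length v then c v * c w * list_inner v w else 0)"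
      by (intro sum.cong) (auto simp: c'_def list_inner_def)
    also have "\<dots> = c v * c w * list_inner v w" using A \<open>v \<in> A\<close> by simp
    finally show "c v * c w * list_inner v w =
      (\<Sum>n\<in>length ` A. c' n v * c' n w * (\<Prod>i<n. inner (v ! i) (w ! i)))" by simp
  qed
  also have "\<dots> = (\<Sum>n\<in>length ` A. \<Sum>v\<in>A. \<Sum>w\<in>A. c' n v * c' n w * (\<Prod>i<n. inner (v ! i) (w ! i)))"
    by (subst sum.swap[of _ A "length ` A"], intro sum.cong refl, rule sum.swap)
  also have "\<dots> \<ge> 0" by (intro sum_nonneg prod)
  finally show ?thesis .
qed

text \<open>
  The algebraic tensor algebra (all degrees together), realized as a space of multilinear forms:
  \<open>v\<^sub>1 \<otimes> \<dots> \<otimes> v\<^sub>n\<close> is the form \<open>(w\<^sub>1, \<dots>, w\<^sub>n) \<mapsto> \<Prod>j. \<langle>v\<^sub>j, w\<^sub>j\<rangle>\<close> on lists of length \<open>n\<close>,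
  extended by \<open>0\<close> to lists of other lengths.  Different degrees are orthogonal.
\<close>

definition tensor_comb :: "'a::real_inner list set \<Rightarrow> ('a list \<Rightarrow> real) \<Rightarrow> 'a list \<Rightarrow> real" where
  "tensor_comb A c ws = (\<Sum>vs\<in>A. c vs * list_inner vs ws)"

typedef (overloaded) 'a tensor_alg =
  "{f :: 'a::real_inner list \<Rightarrow> real. \<exists>A c. finite A \<and> f = tensor_comb A c}"
  morphisms tensor_form Abs_tensor_alg
  by (rule exI[of _ "tensor_comb {} (\<lambda>_. 0)"]) blast

setup_lifting type_definition_tensor_alg

lemma tensor_form_repr:
  obtains A c where "finite A" "tensor_form x = tensor_comb A c"
  using tensor_form[of x] by auto

lemma tensor_comb_extend:
  assumes "finite B" "A \<subseteq> B"
  shows "tensor_comb A c = tensor_comb B (\<lambda>v. if v \<in> A then c v else 0)"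
proof
  fix ws
  have "(\<Sum>v\<in>B. (if v \<in> A then c v else 0) * list_inner v ws) =
      (\<Sum>v\<in>B. if v \<in> A then c v * list_inner v ws else 0)"
    by (intro sum.cong) auto
  also have "\<dots> = (\<Sum>v\<in>A. c v * list_inner v ws)"
    using assms by (simp add: sum.If_cases Int_absorb1)
  finally show "tensor_comb A c ws = tensor_comb B (\<lambda>v. if v \<in> A then c v else 0) ws"
    by (simp add: tensor_comb_def)
qed

lift_definition alg_tensor :: "'a::real_inner list \<Rightarrow> 'a tensor_alg" is list_inner
proof -
  fix vs :: "'a list"
  show "\<exists>A c. finite A \<and> list_inner vs = tensor_comb A c"
    by (intro exI[of _ "{vs}"] exI[of _ "\<lambda>_. 1"]) (simp add: tensor_comb_def fun_eq_iff)
qed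

instantiation tensor_alg :: (real_inner) real_inner
begin

lift_definition zero_tensor_alg :: "'a tensor_alg" is "\<lambda>_. 0"
proof -
  have "(\<lambda>_. 0) = tensor_comb {} (\<lambda>_. 0 :: real)"
    by (rule ext) (simp add: tensor_comb_def)
  then show "\<exists>A c. finite A \<and> (\<lambda>_::'a list. 0) = tensor_comb A c" by blast
qed

lift_definition plus_tensor_alg :: "'a tensor_alg \<Rightarrow> 'a tensor_alg \<Rightarrow> 'a tensor_alg"
  is "\<lambda>f g ws. f ws + g ws"
proof (elim exE conjE)
  fix f g :: "'a list \<Rightarrow> real" and A c B d
  assume *: "finite A" "f = tensor_comb A c" "finite B" "g = tensor_comb B d"
  have "f = tensor_comb (A \<union> B) (\<lambda>v. if v \<in> A then c v else 0)"
    unfolding *(2) by (rule tensor_comb_extend) (use * in auto)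
  moreover have "g = tensor_comb (A \<union> B) (\<lambda>v. if v \<in> B then d v else 0)"
    unfolding *(4) by (rule tensor_comb_extend) (use * in auto)
  ultimately have "(\<lambda>ws. f ws + g ws) = tensor_comb (A \<union> B)
      (\<lambda>v. (if v \<in> A then c v else 0) + (if v \<in> B then d v else 0))"
    unfolding fun_eq_iff tensor_comb_def by (simp only: distrib_right sum.distrib simp_thms)
  then show "\<exists>A c. finite A \<and> (\<lambda>ws. f ws + g ws) = tensor_comb A c"
    using * by blast
qed

lift_definition scaleR_tensor_alg :: "real \<Rightarrow> 'a tensor_alg \<Rightarrow> 'a tensor_alg"
  is "\<lambda>r f ws. r * f ws"
proof (elim exE conjE)
  fix r and f :: "'a list \<Rightarrow> real" and A c
  assume *: "finite A" "f = tensor_comb A c"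
  then have "(\<lambda>ws. r * f ws) = tensor_comb A (\<lambda>v. r * c v)"
    by (simp add: tensor_comb_def fun_eq_iff sum_distrib_left mult.assoc)
  then show "\<exists>A c. finite A \<and> (\<lambda>ws. r * f ws) = tensor_comb A c"
    using * by blast
qed

definition uminus_tensor_alg :: "'a tensor_alg \<Rightarrow> 'a tensor_alg" where
  "uminus_tensor_alg x = (- 1) *\<^sub>R x"

definition minus_tensor_alg :: "'a tensor_alg \<Rightarrow> 'a tensor_alg \<Rightarrow> 'a tensor_alg" where
  "minus_tensor_alg x y = x + (- y)"

text \<open>
  The value does not depend on the chosen representation, and
  \<open>\<langle>v\<^sub>1 \<otimes> \<dots> \<otimes> v\<^sub>n, w\<^sub>1 \<otimes> \<dots> \<otimes> w\<^sub>n\<rangle> = \<Prod>j. \<langle>v\<^sub>j, w\<^sub>j\<rangle>\<close>; see \<open>inner_alg_tensor\<close>.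
\<close>

definition inner_tensor_alg :: "'a tensor_alg \<Rightarrow> 'a tensor_alg \<Rightarrow> real" where
  "inner_tensor_alg x y =
    (let (A, c) = (SOME (A, c). finite A \<and> tensor_form x = tensor_comb A c)
     in \<Sum>vs\<in>A. c vs * tensor_form y vs)"

definition norm_tensor_alg :: "'a tensor_alg \<Rightarrow> real" where
  "norm_tensor_alg x = sqrt (inner x x)"

definition dist_tensor_alg :: "'a tensor_alg \<Rightarrow> 'a tensor_alg \<Rightarrow> real" where
  "dist_tensor_alg x y = norm (x - y)"

definition sgn_tensor_alg :: "'a tensor_alg \<Rightarrow> 'a tensor_alg" where
  "sgn_tensor_alg x = inverse (norm x) *\<^sub>R x"

definition uniformity_tensor_alg :: "('a tensor_alg \<times> 'a tensor_alg) filter" where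
  "uniformity_tensor_alg = (INF e\<in>{0<..}. principal {(x, y). dist x y < e})"

definition open_tensor_alg :: "'a tensor_alg set \<Rightarrow> bool" where
  "open_tensor_alg U \<longleftrightarrow>
    (\<forall>x\<in>U. eventually (\<lambda>(x', y). x' = x \<longrightarrow> y \<in> U) uniformity)"

lemma tensor_comb_swap:
  assumes "finite A" "finite B"
  shows "(\<Sum>vs\<in>A. c vs * tensor_comb B d vs) = (\<Sum>ws\<in>B. d ws * tensor_comb A c ws)"
proof -
  have "(\<Sum>vs\<in>A. c vs * tensor_comb B d vs)
      = (\<Sum>vs\<in>A. \<Sum>ws\<in>B. c vs * (d ws * list_inner ws vs))"
    by (simp add: tensor_comb_def sum_distrib_left)
  also have "\<dots> = (\<Sum>ws\<in>B. \<Sum>vs\<in>A. c vs * (d ws * list_inner ws vs))"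
    by (rule sum.swap)
  also have "\<dots> = (\<Sum>ws\<in>B. d ws * tensor_comb A c ws)"
    unfolding tensor_comb_def sum_distrib_left
    by (intro sum.cong refl) (simp add: list_inner_commute mult.left_commute)
  finally show ?thesis .
qed

lemma inner_tensor_alg_eq:
  assumes A: "finite A" "tensor_form x = tensor_comb A c"
  shows "inner x y = (\<Sum>vs\<in>A. c vs * tensor_form y vs)"
proof -
  obtain A' c' where A': "(SOME (A, c). finite A \<and> tensor_form x = tensor_comb A c) = (A', c')"
    by (cases "SOME (A, c). finite A \<and> tensor_form x = tensor_comb A c") blast
  have "case (A', c') of (A, c) \<Rightarrow> finite A \<and> tensor_form x = tensor_comb A c"
    unfolding A'[symmetric] by (rule someI[of _ "(A, c)"]) (use A in simp)
  then have *: "finite A'" "tensor_form x = tensor_comb A' c'" by auto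
  obtain B d where B: "finite B" "tensor_form y = tensor_comb B d"
    by (rule tensor_form_repr)
  have "inner x y = (\<Sum>vs\<in>A'. c' vs * tensor_form y vs)"
    by (simp add: inner_tensor_alg_def A')
  also have "\<dots> = (\<Sum>ws\<in>B. d ws * tensor_form x ws)"
    using tensor_comb_swap[OF *(1) B(1)] * B by simp
  also have "\<dots> = (\<Sum>vs\<in>A. c vs * tensor_form y vs)"
    using tensor_comb_swap[OF A(1) B(1)] A B by simp
  finally show ?thesis .
qed

instance
proof
  fix a b c :: "'a tensor_alg" and r s :: real
  show "a + b + c = a + (b + c)" by transfer (simp add: algebra_simps)
  show "a + b = b + a" by transfer (simp add: algebra_simps)
  show "0 + a = a" by transfer simp
  show "- a + a = 0" unfolding uminus_tensor_alg_def by transfer simp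
  show "a - b = a + - b" by (simp add: minus_tensor_alg_def)
  show "r *\<^sub>R (a + b) = r *\<^sub>R a + r *\<^sub>R b" by transfer (simp add: algebra_simps)
  show "(r + s) *\<^sub>R a = r *\<^sub>R a + s *\<^sub>R a" by transfer (simp add: algebra_simps)
  show "r *\<^sub>R s *\<^sub>R a = (r * s) *\<^sub>R a" by transfer (simp add: algebra_simps)
  show "1 *\<^sub>R a = a" by transfer simp
  show "sgn a = inverse (norm a) *\<^sub>R a" by (simp add: sgn_tensor_alg_def)
  show "dist a b = norm (a - b)" by (simp add: dist_tensor_alg_def)
  show "(uniformity :: ('a tensor_alg \<times> 'a tensor_alg) filter) =
      (INF e\<in>{0<..}. principal {(x, y). dist x y < e})"
    by (simp add: uniformity_tensor_alg_def)
  show "open U \<longleftrightarrow> (\<forall>x\<in>U. eventually (\<lambda>(x', y). x' = x \<longrightarrow> y \<in> U) uniformity)"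
    for U :: "'a tensor_alg set"
    by (simp add: open_tensor_alg_def)
  have comm: "inner x y = inner y x" for x y :: "'a tensor_alg"
  proof -
    obtain A c where A: "finite A" "tensor_form x = tensor_comb A c" by (rule tensor_form_repr)
    obtain B d where B: "finite B" "tensor_form y = tensor_comb B d" by (rule tensor_form_repr)
    show ?thesis
      using tensor_comb_swap[OF A(1) B(1), of c d]
      by (simp add: inner_tensor_alg_eq[OF A] inner_tensor_alg_eq[OF B] A B)
  qed
  show "inner a b = inner b a" by (rule comm)
  obtain C e where C: "finite C" "tensor_form c = tensor_comb C e" by (rule tensor_form_repr)
  have "inner c (a + b) = inner c a + inner c b"
    by (simp add: inner_tensor_alg_eq[OF C] plus_tensor_alg.rep_eq distrib_left sum.distrib)
  then show "inner (a + b) c = inner a c + inner b c" by (simp add: comm)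
  obtain B d where B: "finite B" "tensor_form b = tensor_comb B d" by (rule tensor_form_repr)
  have "inner b (r *\<^sub>R a) = r * inner b a"
    by (simp add: inner_tensor_alg_eq[OF B] scaleR_tensor_alg.rep_eq sum_distrib_left
        mult.left_commute)
  then show "inner (r *\<^sub>R a) b = r * inner a b" by (simp add: comm)
  have nonneg: "0 \<le> inner x x" for x :: "'a tensor_alg"
  proof -
    obtain A c where A: "finite A" "tensor_form x = tensor_comb A c" by (rule tensor_form_repr)
    have "inner x x = (\<Sum>v\<in>A. \<Sum>w\<in>A. c v * c w * list_inner w v)"
      by (simp add: inner_tensor_alg_eq[OF A] A tensor_comb_def sum_distrib_left mult.assoc)
    also have "\<dots> = (\<Sum>v\<in>A. \<Sum>w\<in>A. c v * c w * list_inner v w)"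
      by (simp only: list_inner_commute)
    also have "\<dots> \<ge> 0" by (rule list_inner_psd[OF A(1)])
    finally show ?thesis .
  qed
  show "0 \<le> inner a a" by (rule nonneg)
  show "inner a a = 0 \<longleftrightarrow> a = 0"
  proof
    assume "a = 0"
    then show "inner a a = 0"
      using inner_tensor_alg_eq[of "{}" a "\<lambda>_. 0"]
      by (simp add: zero_tensor_alg.rep_eq tensor_comb_def fun_eq_iff)
  next
    assume aa: "inner a a = 0"
    have "tensor_form a vs = 0" for vs
    proof -
      define t where "t = alg_tensor vs"
      have t: "tensor_form t = tensor_comb {vs} (\<lambda>_. 1)"
        by (simp add: t_def alg_tensor.rep_eq tensor_comb_def fun_eq_iff)
      have ta: "inner t x = tensor_form x vs" for x
        using inner_tensor_alg_eq[OF _ t, of x] by simp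
      have lin: "inner (r *\<^sub>R a + t) (r *\<^sub>R a + t) = 2 * r * tensor_form a vs + inner t t" for r
      proof -
        have add: "inner x (y + z) = inner x y + inner x z" for x y z :: "'a tensor_alg"
        proof -
          obtain A c where A: "finite A" "tensor_form x = tensor_comb A c" by (rule tensor_form_repr)
          show ?thesis
            by (simp add: inner_tensor_alg_eq[OF A] plus_tensor_alg.rep_eq distrib_left sum.distrib)
        qed
        have scale: "inner x (r *\<^sub>R y) = r * inner x y" for x y :: "'a tensor_alg"
        proof -
          obtain A c where A: "finite A" "tensor_form x = tensor_comb A c" by (rule tensor_form_repr)
          show ?thesis
            by (simp add: inner_tensor_alg_eq[OF A] scaleR_tensor_alg.rep_eq sum_distrib_left
                mult.left_commute)
        qed
        have "inner (r *\<^sub>R a + t) (r *\<^sub>R a + t) =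
            inner (r *\<^sub>R a + t) (r *\<^sub>R a) + inner (r *\<^sub>R a + t) t" by (rule add)
        also have "\<dots> = inner (r *\<^sub>R a) (r *\<^sub>R a + t) + inner t (r *\<^sub>R a + t)"
          by (simp only: comm)
        also have "\<dots> = r * (r * inner a a) + r * inner t a + (r * inner t a + inner t t)"
          by (simp only: add scale comm[of "r *\<^sub>R a" a] comm[of "r *\<^sub>R a" t])
        finally show ?thesis by (simp add: aa ta)
      qed
      show ?thesis
      proof (rule ccontr)
        assume nz: "tensor_form a vs \<noteq> 0"
        define r where "r = - (inner t t + 1) / (2 * tensor_form a vs)"
        have "inner (r *\<^sub>R a + t) (r *\<^sub>R a + t) = -1"
          unfolding lin using nz by (simp add: r_def field_simps)
        then show False using nonneg[of "r *\<^sub>R a + t"] by simp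
      qed
    qed
    then show "a = 0" by (simp add: tensor_form_inject[symmetric] zero_tensor_alg.rep_eq fun_eq_iff)
  qed
  show "norm a = sqrt (inner a a)" by (simp add: norm_tensor_alg_def)
qed

end

lemma inner_alg_tensor_left: "inner (alg_tensor vs) x = tensor_form x vs"
proof -
  have t: "tensor_form (alg_tensor vs) = tensor_comb {vs} (\<lambda>_. 1)"
    by (simp add: alg_tensor.rep_eq tensor_comb_def fun_eq_iff)
  show ?thesis using inner_tensor_alg_eq[OF _ t, of x] by simp
qed

lemma inner_alg_tensor: "inner (alg_tensor vs) (alg_tensor ws) = list_inner vs ws"
  unfolding inner_alg_tensor_left alg_tensor.rep_eq by (rule list_inner_commute)

lemma span_alg_tensor: "span (range alg_tensor) = UNIV"
proof -
  have "x \<in> span (range alg_tensor)" for x :: "'a tensor_alg"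
  proof -
    obtain A c where A: "finite A" "tensor_form x = tensor_comb A c" by (rule tensor_form_repr)
    have "tensor_form (\<Sum>vs\<in>B. c vs *\<^sub>R alg_tensor vs) = tensor_comb B c" if "finite B" for B
      using that
      by (induction B rule: finite_induct)
        (simp_all add: zero_tensor_alg.rep_eq plus_tensor_alg.rep_eq scaleR_tensor_alg.rep_eq
          alg_tensor.rep_eq tensor_comb_def fun_eq_iff)
    then have "x = (\<Sum>vs\<in>A. c vs *\<^sub>R alg_tensor vs)"
      using A by (simp add: tensor_form_inject[symmetric])
    then show ?thesis by (simp add: span_sum span_scale span_base)
  qed
  then show ?thesis by blast
qed

type_synonym 'a tensor = "'a tensor_alg completion"

definition tensor :: "'a::real_inner list \<Rightarrow> 'a tensor" where
  "tensor vs = to_completion (alg_tensor vs)"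

lemma inner_tensor:
  "inner (tensor vs) (tensor ws) =
    (if length vs = length ws then \<Prod>i<length vs. inner (vs ! i) (ws ! i) else 0)"
  by (simp add: tensor_def inner_alg_tensor list_inner_def)

lemma tensor_total: "closure (span (range tensor)) = (UNIV :: 'a::real_inner tensor set)"
proof -
  have "range to_completion = to_completion ` span (range (alg_tensor :: 'a list \<Rightarrow> _))"
    by (simp add: span_alg_tensor)
  also have "\<dots> = span (to_completion ` range alg_tensor)"
    by (rule linear_span_image[symmetric])
      (rule bounded_linear.linear[OF bounded_linear_to_completion])
  also have "to_completion ` range alg_tensor = range (tensor :: 'a list \<Rightarrow> _)"
    by (auto simp: tensor_def)
  finally show ?thesis using to_completion_dense[where 'a = "'a tensor_alg"] by simp
qed

text \<open>
  The powers of a closed subspace \<open>K\<close> live inside those of the ambient space: a closed span in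
  the complete space is a completion of the algebraic tensor power of \<open>K\<close>.
\<close>

definition tensor_power :: "'a::real_inner set \<Rightarrow> nat \<Rightarrow> 'a tensor set" where
  "tensor_power K n = closure (span {tensor vs | vs. set vs \<subseteq> K \<and> length vs = n})"

text \<open>
  The operator permuting the factors of tensors of degree \<open>n\<close>; for definiteness it is the
  identity in the other degrees.  See \<open>tensor_perm_ex1\<close> for existence and uniqueness.
\<close>

definition list_perm :: "nat \<Rightarrow> (nat \<Rightarrow> nat) \<Rightarrow> 'a list \<Rightarrow> 'a list" where
  "list_perm n \<pi> vs = (if length vs = n then permute_list \<pi> vs else vs)"

definition tensor_perm :: "nat \<Rightarrow> (nat \<Rightarrow> nat) \<Rightarrow> 'a::real_inner tensor \<Rightarrow> 'a tensor" where
  "tensor_perm n \<pi> = (THE S. bounded_linear S \<and> (\<forall>vs. S (tensor vs) = tensor (list_perm n \<pi> vs)))"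

definition sym_tensor_power :: "'a::real_inner set \<Rightarrow> nat \<Rightarrow> 'a tensor set" where
  "sym_tensor_power K n =
    {x \<in> tensor_power K n. \<forall>\<pi>. \<pi> permutes {..<n} \<longrightarrow> tensor_perm n \<pi> x = x}"

lemma list_inner_perm:
  assumes "\<pi> permutes {..<n}"
  shows "list_inner (list_perm n \<pi> vs) (list_perm n \<pi> ws) = list_inner vs ws"
proof (cases "length vs = n \<and> length ws = n")
  case True
  then have v: "length vs = n" and w: "length ws = n" by auto
  have "(\<Prod>i<n. inner (permute_list \<pi> vs ! i) (permute_list \<pi> ws ! i))
      = (\<Prod>i<n. inner (vs ! \<pi> i) (ws ! \<pi> i))"
    using assms v w by (intro prod.cong) (simp_all add: permute_list_nth)
  also have "\<dots> = (\<Prod>i<n. inner (vs ! i) (ws ! i))"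
    by (rule prod.permute[OF assms, of "\<lambda>i. inner (vs ! i) (ws ! i)", unfolded comp_def, symmetric])
  finally show ?thesis using v w by (simp add: list_perm_def list_inner_def)
next
  case False
  then show ?thesis by (auto simp: list_perm_def list_inner_def)
qed

lemma list_perm_inv:
  assumes "\<pi> permutes {..<n}"
  shows "list_perm n \<pi> (list_perm n (inv \<pi>) vs) = vs"
proof (cases "length vs = n")
  case True
  have "permute_list \<pi> (permute_list (inv \<pi>) vs) = permute_list (inv \<pi> \<circ> \<pi>) vs"
    using assms True by (intro permute_list_compose[symmetric]) simp
  also have "inv \<pi> \<circ> \<pi> = id" by (rule permutes_inv_o(2)[OF assms])
  finally show ?thesis using True by (simp add: list_perm_def)
qed (simp add: list_perm_def)

lemma tensor_perm_ex1:
  assumes \<pi>: "\<pi> permutes {..<n}"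
  shows "\<exists>!S :: 'a::real_inner tensor \<Rightarrow> 'a tensor.
    bounded_linear S \<and> (\<forall>vs. S (tensor vs) = tensor (list_perm n \<pi> vs))"
proof (rule ex_ex1I)
  define p where "p = (list_perm n \<pi> :: 'a list \<Rightarrow> 'a list)"
  define q where "q = (list_perm n (inv \<pi>) :: 'a list \<Rightarrow> 'a list)"
  have pq: "list_inner vs (q ws) = list_inner (p vs) ws" for vs ws
    using list_inner_perm[OF \<pi>, of vs "q ws"] list_perm_inv[OF \<pi>, of ws]
    by (simp add: p_def q_def)
  define T where "T x = Abs_tensor_alg (\<lambda>ws. tensor_form x (q ws))" for x :: "'a tensor_alg"
  have T: "tensor_form (T x) = (\<lambda>ws. tensor_form x (q ws))" for x
  proof -
    obtain A c where A: "finite A" "tensor_form x = tensor_comb A c" by (rule tensor_form_repr)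
    have inj: "inj_on p A"
    proof (rule inj_onI)
      fix u v assume "p u = p v"
      then have eq: "length u = length v" "list_perm n (inv \<pi>) (p u) = list_perm n (inv \<pi>) (p v)"
        by (auto simp: p_def list_perm_def split: if_splits)
      have "list_perm n (inv \<pi>) (list_perm n (inv (inv \<pi>)) w) = w" for w :: "'a list"
        by (rule list_perm_inv[OF permutes_inv[OF \<pi>]])
      then have "list_perm n (inv \<pi>) (p w) = w" for w
        by (simp add: p_def permutes_inv_inv[OF \<pi>])
      then show "u = v" using eq by simp
    qed
    have "tensor_comb (p ` A) (\<lambda>vs. c (the_inv_into A p vs)) ws = tensor_comb A c (q ws)" for ws
      using inj by (simp add: tensor_comb_def sum.reindex pq the_inv_into_f_f)
    then have "(\<lambda>ws. tensor_form x (q ws)) = tensor_comb (p ` A) (\<lambda>vs. c (the_inv_into A p vs))"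
      by (simp add: A(2) fun_eq_iff)
    then show ?thesis
      unfolding T_def using A(1) by (intro Abs_tensor_alg_inverse) blast
  qed
  have T_tensor: "T (alg_tensor vs) = alg_tensor (p vs)" for vs
    by (simp add: tensor_form_inject[symmetric] T alg_tensor.rep_eq pq fun_eq_iff)
  have lin: "linear T"
    by (rule linearI) (simp_all add: tensor_form_inject[symmetric] T plus_tensor_alg.rep_eq
        scaleR_tensor_alg.rep_eq)
  have iso: "inner (T x) (T y) = inner x y" for x y
  proof -
    have gen: "inner (T (alg_tensor vs)) (T y) = inner (alg_tensor vs) y" for vs
      using list_perm_inv[OF permutes_inv[OF \<pi>], of vs] permutes_inv_inv[OF \<pi>]
      by (simp add: T_tensor inner_alg_tensor_left T p_def q_def)
    have "x \<in> span (range alg_tensor)" by (simp add: span_alg_tensor)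
    then show ?thesis
    proof (induction x rule: span_induct_alt)
      case base
      then show ?case by (simp add: linear_0[OF lin])
    next
      case (step r z x)
      then show ?case
        using gen by (auto simp: linear_add[OF lin] linear_scale[OF lin] inner_add_left)
    qed
  qed
  have "bounded_linear T"
    by (rule bounded_linear_intro[of _ 1])
      (simp_all add: linear_add[OF lin] linear_scale[OF lin] norm_eq_sqrt_inner iso)
  then have B: "blinfun_apply (Blinfun T) = T" by (rule bounded_linear_Blinfun_apply)
  show "\<exists>S :: 'a tensor \<Rightarrow> 'a tensor.
      bounded_linear S \<and> (\<forall>vs. S (tensor vs) = tensor (list_perm n \<pi> vs))"
    by (rule exI[of _ "completion_map (Blinfun T)"])
      (simp add: bounded_linear_completion_map B iso tensor_def T_tensor p_def)
next
  fix S S' :: "'a tensor \<Rightarrow> 'a tensor"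
  assume S: "bounded_linear S \<and> (\<forall>vs. S (tensor vs) = tensor (list_perm n \<pi> vs))"
    and S': "bounded_linear S' \<and> (\<forall>vs. S' (tensor vs) = tensor (list_perm n \<pi> vs))"
  have "S x = S' x" if "x \<in> span (range tensor)" for x
    by (rule linear_eq_on_span[OF _ _ _ that, of S S'])
      (use S S' in \<open>auto simp: bounded_linear.linear\<close>)
  moreover have "closed {x. S x = S' x}"
    using S S' by (intro closed_Collect_eq) (auto intro: bounded_linear.continuous_on continuous_on_id)
  ultimately have "closure (span (range tensor)) \<subseteq> {x. S x = S' x}"
    by (intro closure_minimal) auto
  then show "S = S'" by (auto simp: tensor_total)
qed

section \<open>Symmetric Fock space\<close>

text \<open>
  Algebraic direct sum of countably many copies of an inner product space, with weight \<open>n!\<close>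
  on the \<open>n\<close>-th summand.
\<close>

typedef (overloaded) 'a fock_alg = "{x :: nat \<Rightarrow> 'a::real_inner. finite {n. x n \<noteq> 0}}"
  morphisms fock_component Abs_fock_alg
  by (rule exI[of _ "\<lambda>_. 0"]) simp

setup_lifting type_definition_fock_alg

lift_definition fock_single :: "nat \<Rightarrow> 'a::real_inner \<Rightarrow> 'a fock_alg" is
  "\<lambda>n x m. if m = n then x else 0"
  by simp

instantiation fock_alg :: (real_inner) real_inner
begin

lift_definition zero_fock_alg :: "'a fock_alg" is "\<lambda>_. 0"
  by simp

lift_definition plus_fock_alg :: "'a fock_alg \<Rightarrow> 'a fock_alg \<Rightarrow> 'a fock_alg"
  is "\<lambda>x y n. x n + y n"
proof -
  fix x y :: "nat \<Rightarrow> 'a"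
  assume "finite {n. x n \<noteq> 0}" "finite {n. y n \<noteq> 0}"
  then have "finite ({n. x n \<noteq> 0} \<union> {n. y n \<noteq> 0})" by simp
  then show "finite {n. x n + y n \<noteq> 0}" by (rule rev_finite_subset) auto
qed

lift_definition uminus_fock_alg :: "'a fock_alg \<Rightarrow> 'a fock_alg" is "\<lambda>x n. - x n"
  by simp

definition minus_fock_alg :: "'a fock_alg \<Rightarrow> 'a fock_alg \<Rightarrow> 'a fock_alg" where
  "minus_fock_alg x y = x + (- y)"

lift_definition scaleR_fock_alg :: "real \<Rightarrow> 'a fock_alg \<Rightarrow> 'a fock_alg"
  is "\<lambda>r x n. r *\<^sub>R x n"
  by (erule rev_finite_subset) auto

definition inner_fock_alg :: "'a fock_alg \<Rightarrow> 'a fock_alg \<Rightarrow> real" where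
  "inner_fock_alg x y =
    (\<Sum>n | fock_component x n \<noteq> 0. fact n * inner (fock_component x n) (fock_component y n))"

definition norm_fock_alg :: "'a fock_alg \<Rightarrow> real" where
  "norm_fock_alg x = sqrt (inner x x)"

definition dist_fock_alg :: "'a fock_alg \<Rightarrow> 'a fock_alg \<Rightarrow> real" where
  "dist_fock_alg x y = norm (x - y)"

definition sgn_fock_alg :: "'a fock_alg \<Rightarrow> 'a fock_alg" where
  "sgn_fock_alg x = inverse (norm x) *\<^sub>R x"

definition uniformity_fock_alg :: "('a fock_alg \<times> 'a fock_alg) filter" where
  "uniformity_fock_alg = (INF e\<in>{0<..}. principal {(x, y). dist x y < e})"

definition open_fock_alg :: "'a fock_alg set \<Rightarrow> bool" where
  "open_fock_alg U \<longleftrightarrow>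
    (\<forall>x\<in>U. eventually (\<lambda>(x', y). x' = x \<longrightarrow> y \<in> U) uniformity)"

lemma inner_fock_alg_eq:
  assumes "finite N" "\<And>n. n \<notin> N \<Longrightarrow> fock_component x n = 0"
  shows "inner x y = (\<Sum>n\<in>N. fact n * inner (fock_component x n) (fock_component y n))"
  unfolding inner_fock_alg_def
  by (rule sum.mono_neutral_left) (use assms in auto)

instance
proof
  fix a b c :: "'a fock_alg" and r s :: real
  show "a + b + c = a + (b + c)" by transfer (simp add: algebra_simps)
  show "a + b = b + a" by transfer (simp add: algebra_simps)
  show "0 + a = a" by transfer simp
  show "- a + a = 0" by transfer simp
  show "a - b = a + - b" by (simp add: minus_fock_alg_def)
  show "r *\<^sub>R (a + b) = r *\<^sub>R a + r *\<^sub>R b" by transfer (simp add: algebra_simps)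
  show "(r + s) *\<^sub>R a = r *\<^sub>R a + s *\<^sub>R a" by transfer (simp add: algebra_simps)
  show "r *\<^sub>R s *\<^sub>R a = (r * s) *\<^sub>R a" by transfer simp
  show "1 *\<^sub>R a = a" by transfer simp
  show "sgn a = inverse (norm a) *\<^sub>R a" by (simp add: sgn_fock_alg_def)
  show "dist a b = norm (a - b)" by (simp add: dist_fock_alg_def)
  show "(uniformity :: ('a fock_alg \<times> 'a fock_alg) filter) =
      (INF e\<in>{0<..}. principal {(x, y). dist x y < e})"
    by (simp add: uniformity_fock_alg_def)
  show "open U \<longleftrightarrow> (\<forall>x\<in>U. eventually (\<lambda>(x', y). x' = x \<longrightarrow> y \<in> U) uniformity)"
    for U :: "'a fock_alg set"
    by (simp add: open_fock_alg_def)
  define N where "N = {n. fock_component a n \<noteq> 0} \<union> {n. fock_component b n \<noteq> 0}"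
  have N: "finite N" using fock_component[of a] fock_component[of b] by (simp add: N_def)
  note eq = inner_fock_alg_eq[OF N]
  show "inner a b = inner b a"
    by (subst (1 2) eq) (auto simp: N_def inner_commute)
  show "inner (a + b) c = inner a c + inner b c"
    by (subst (1 2 3) eq)
      (auto simp: N_def plus_fock_alg.rep_eq inner_add_left algebra_simps sum.distrib)
  show "inner (r *\<^sub>R a) b = r * inner a b"
    by (subst (1 2) eq)
      (auto simp: N_def scaleR_fock_alg.rep_eq sum_distrib_left algebra_simps)
  show "0 \<le> inner a a"
    unfolding inner_fock_alg_def by (intro sum_nonneg) simp
  show "inner a a = 0 \<longleftrightarrow> a = 0"
  proof
    assume "inner a a = 0"
    then have "\<forall>n\<in>{n. fock_component a n \<noteq> 0}. fact n * inner (fock_component a n) (fock_component a n) = 0"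
      unfolding inner_fock_alg_def
      by (subst (asm) sum_nonneg_eq_0_iff) (use fock_component[of a] in auto)
    then have "fock_component a n = 0" for n by auto
    then show "a = 0" by (simp add: fock_component_inject[symmetric] zero_fock_alg.rep_eq fun_eq_iff)
  next
    assume "a = 0"
    then show "inner a a = 0" by (simp add: inner_fock_alg_def zero_fock_alg.rep_eq)
  qed
  show "norm a = sqrt (inner a a)" by (simp add: norm_fock_alg_def)
qed

end

type_synonym 'a fock = "'a tensor fock_alg completion"

text \<open>
  The closure, in a complete space, of the algebraic direct sum of the symmetric powers of \<open>K\<close>
  is its completion.
\<close>

definition fock_space :: "'a::real_inner set \<Rightarrow> 'a fock set" where
  "fock_space K =
    closure {to_completion x | x. \<forall>n. fock_component x n \<in> sym_tensor_power K n}"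

definition exp_vector :: "'a::real_inner \<Rightarrow> 'a fock" where
  "exp_vector v =
    (\<Sum>n. (1 / fact n) *\<^sub>R to_completion (fock_single n (tensor (replicate n v))))"

text \<open>
  The complexification of a real Hilbert space \<open>V\<close>: a pair \<open>(x, y)\<close> stands for \<open>x + \<i> y\<close>,
  and \<open>V\<close> is embedded as \<open>x \<mapsto> (x, 0)\<close>.  Inner products are linear in the first argument.
\<close>

definition complexification :: "'v::real_inner set \<Rightarrow> ('v \<times> 'v) set" where
  "complexification V = V \<times> V"

definition cscale :: "complex \<Rightarrow> 'v::real_inner \<times> 'v \<Rightarrow> 'v \<times> 'v" where
  "cscale c z = (Re c *\<^sub>R fst z - Im c *\<^sub>R snd z, Re c *\<^sub>R snd z + Im c *\<^sub>R fst z)"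

definition cinner :: "'v::real_inner \<times> 'v \<Rightarrow> 'v \<times> 'v \<Rightarrow> complex" where
  "cinner z w = Complex (inner (fst z) (fst w) + inner (snd z) (snd w))
                        (inner (snd z) (fst w) - inner (fst z) (snd w))"

section \<open>Square-integrable functions modulo equality almost everywhere\<close>

definition ae_class :: "'b measure \<Rightarrow> ('b \<Rightarrow> 'k) \<Rightarrow> ('b \<Rightarrow> 'k::topological_space) set" where
  "ae_class M f = {g \<in> borel_measurable M. AE x in M. g x = f x}"

definition L2 :: "'b measure \<Rightarrow> ('b \<Rightarrow> 'k::{real_normed_field, second_countable_topology}) set set"
  where "L2 M = {ae_class M f | f. f \<in> borel_measurable M \<and> integrable M (\<lambda>x. (norm (f x))\<^sup>2)}"

definition L2_rep :: "('b \<Rightarrow> 'k) set \<Rightarrow> 'b \<Rightarrow> 'k" where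
  "L2_rep A = (SOME f. f \<in> A)"

definition L2_add ::
  "'b measure \<Rightarrow> ('b \<Rightarrow> 'k) set \<Rightarrow> ('b \<Rightarrow> 'k) set \<Rightarrow> ('b \<Rightarrow> 'k::real_normed_field) set" where
  "L2_add M A B = ae_class M (\<lambda>x. L2_rep A x + L2_rep B x)"

definition L2_scale ::
  "'b measure \<Rightarrow> 'k \<Rightarrow> ('b \<Rightarrow> 'k) set \<Rightarrow> ('b \<Rightarrow> 'k::real_normed_field) set" where
  "L2_scale M c A = ae_class M (\<lambda>x. c * L2_rep A x)"

definition L2_norm :: "'b measure \<Rightarrow> ('b \<Rightarrow> 'k::real_normed_field) set \<Rightarrow> real" where
  "L2_norm M A = sqrt (\<integral>x. (norm (L2_rep A x))\<^sup>2 \<partial>M)"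

definition L2_dist ::
  "'b measure \<Rightarrow> ('b \<Rightarrow> 'k) set \<Rightarrow> ('b \<Rightarrow> 'k::real_normed_field) set \<Rightarrow> real" where
  "L2_dist M A B = L2_norm M (L2_add M A (L2_scale M (- 1) B))"

definition L2_cinner ::
  "'b measure \<Rightarrow> ('b \<Rightarrow> complex) set \<Rightarrow> ('b \<Rightarrow> complex) set \<Rightarrow> complex" where
  "L2_cinner M A B = (\<integral>x. L2_rep A x * cnj (L2_rep B x) \<partial>M)"

definition linear_L2 :: "'b measure \<Rightarrow> ('h::real_vector \<Rightarrow> ('b \<Rightarrow> real) set) \<Rightarrow> bool" where
  "linear_L2 M T \<longleftrightarrow>
    (\<forall>h. T h \<in> L2 M) \<and>
    (\<forall>g h. T (g + h) = L2_add M (T g) (T h)) \<and>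
    (\<forall>r h. T (r *\<^sub>R h) = L2_scale M r (T h))"

definition unitary_to_L2 ::
  "('v::real_inner) set \<Rightarrow> 'b measure \<Rightarrow> ('v \<times> 'v \<Rightarrow> ('b \<Rightarrow> complex) set) \<Rightarrow> bool" where
  "unitary_to_L2 V M U \<longleftrightarrow>
    bij_betw U (complexification V) (L2 M) \<and>
    (\<forall>z\<in>complexification V. \<forall>w\<in>complexification V. U (z + w) = L2_add M (U z) (U w)) \<and>
    (\<forall>c. \<forall>z\<in>complexification V. U (cscale c z) = L2_scale M c (U z)) \<and>
    (\<forall>z\<in>complexification V. \<forall>w\<in>complexification V. L2_cinner M (U z) (U w) = cinner z w)"

section \<open>Gaussian measures and Cameron-Martin spaces\<close>

text \<open>
  The zero functional, whose distribution is the point mass at \<open>0\<close>, needs no condition.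
\<close>

definition centered_gaussian ::
  "'b::{banach, second_countable_topology} measure \<Rightarrow> bool" where
  "centered_gaussian \<mu> \<longleftrightarrow>
    prob_space \<mu> \<and> sets \<mu> = sets borel \<and>
    (\<forall>f :: 'b \<Rightarrow>\<^sub>L real. f \<noteq> 0 \<longrightarrow>
      (\<exists>\<sigma>>0. distributed \<mu> lborel (blinfun_apply f) (\<lambda>t. ennreal (normal_density 0 \<sigma> t))))"

definition cameron_martin ::
  "'b::{banach, second_countable_topology} measure \<Rightarrow>
   ('h::{real_inner, complete_space} \<Rightarrow> ('b \<Rightarrow> real) set) \<Rightarrow> bool" where
  "cameron_martin \<mu> I \<longleftrightarrow>
    linear_L2 \<mu> I \<and>
    (\<forall>h. L2_norm \<mu> (I h) = norm h) \<and>
    (\<forall>f :: 'b \<Rightarrow>\<^sub>L real. ae_class \<mu> (blinfun_apply f) \<in> range I) \<and>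
    (\<forall>h. \<forall>e>0. \<exists>f :: 'b \<Rightarrow>\<^sub>L real. L2_dist \<mu> (I h) (ae_class \<mu> (blinfun_apply f)) < e)"

definition H_dual ::
  "('h \<Rightarrow> ('b::real_normed_vector \<Rightarrow> real) set) \<Rightarrow> 'h set" where
  "H_dual I = {h. \<exists>f :: 'b \<Rightarrow>\<^sub>L real. blinfun_apply f \<in> I h}"

text \<open>
  The continuous linear functional representing \<open>I h\<close>, for \<open>h \<in> H_dual I\<close>.  It is unique: a nonzero
  functional has positive variance, so it does not vanish almost everywhere.
\<close>

definition functional_of ::
  "('h \<Rightarrow> ('b::real_normed_vector \<Rightarrow> real) set) \<Rightarrow> 'h \<Rightarrow> 'b \<Rightarrow>\<^sub>L real" where
  "functional_of I h = (THE f. blinfun_apply f \<in> I h)"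

definition closed_affine_subspace :: "'h::real_inner set \<Rightarrow> bool" where
  "closed_affine_subspace L \<longleftrightarrow> (\<exists>p V. closed V \<and> subspace V \<and> L = (+) p ` V)"

definition orth_proj :: "'h::real_inner set \<Rightarrow> 'h \<Rightarrow> 'h" where
  "orth_proj V h = (THE y. y \<in> V \<and> (\<forall>z\<in>V. inner (h - y) z = 0))"

end

theory Submission
  imports Defs
begin

text \<open>
  For \<open>v \<in> L\<^sub>0\<close> the random variables \<open>E v = e\<^bsup>I\<^sub>L(v) - \<parallel>v\<parallel>\<^sup>2/2\<^esup>\<close> satisfy \<open>\<integral> E v E w d\<mu>\<^sub>L = e\<^bsup>\<langle>v, w\<rangle>\<^esup>\<close>, which is
  also the inner product of \<open>Exp(v)\<close> and \<open>Exp(w)\<close>.  Hence \<open>Exp(v) \<mapsto> E v\<close> extends to an isometry, and it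
  remains to see that both families are total.  In the Fock space, extracting Taylor coefficients in
  \<open>t\<close> from \<open>Exp(t v)\<close> gives the powers \<open>v\<^bsup>\<otimes>n\<^esup>\<close>, and polarization gives all symmetric tensors.  In
  \<open>L\<^sup>2(\<mu>\<^sub>L)\<close>, a function \<open>g\<close> orthogonal to all \<open>E v\<close> is, by analyticity in \<open>t\<close>, orthogonal to all
  \<open>e\<^bsup>i I\<^sub>L(v)\<^esup>\<close>.  Since \<open>I\<^sub>L(k)\<close> is almost surely constant for \<open>k \<bottom> L\<^sub>0\<close>, \<open>g\<close> is then orthogonal to all
  \<open>e\<^bsup>i f\<^esup>\<close> with \<open>f\<close> in the dual of \<open>B\<close>, and it vanishes because, by the Hahn-Banach theorem and
  separability, the dual generates the Borel sets.  The same totality gives uniqueness: \<open>U z\<close> is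
  determined by its inner products with the \<open>E v\<close>.
\<close>

text \<open>\<open>H_dual I\<close> is dense in \<open>H\<close> but may meet
  \<open>L\<^sub>0\<close> only in 0, so it is not enough to work with actual functionals: the
  characteristic function has to be known on all of \<open>H\<close>, and is extended there by
  continuity. Minimality of \<open>h\<^sub>L\<close> enters through its orthogonality to
  \<open>L\<^sub>0\<close>, which makes \<open>I\<^sub>L v\<close> centered for
  \<open>v \<in> L\<^sub>0\<close>; hence the normalizing constant does not involve
  \<open>h\<^sub>L\<close>.

  The kernel exp(<v, w>) is real, so the isometry is built between real Hilbert spaces, and real and
  imaginary parts are joined only at the end. On the probability side the isometry is a choice of
  one function for each vector. Its linearity holds only almost everywhere and comes from totality:
  a square-integrable function is determined up to null sets by its integrals against the
  \<open>E v\<close>. In the Fock space, the weight n! cancels one of the two factors 1/n! in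
  <Exp(v), Exp(w)> and leaves the exponential series.\<close>

section \<open>Orthogonal projection in Hilbert spaces\<close>

text \<open>The representing vector minimizes <z, z> - 2 \<phi>(z) over \<open>V\<close>. Linearity
  of \<phi> is asked on \<open>V\<close> only, because the functional used for surjectivity in
  \<open>gram_isometry\<close> is controlled only there; with \<phi> = <h, .> the result is the
  orthogonal projection.\<close>

lemma riesz_on_closed_subspace:
  fixes V :: "'v::{real_inner, complete_space} set" and \<phi> :: "'v \<Rightarrow> real"
  assumes V: "closed V" "subspace V"
    and add: "\<And>x y. x \<in> V \<Longrightarrow> y \<in> V \<Longrightarrow> \<phi> (x + y) = \<phi> x + \<phi> y"
    and scale: "\<And>r x. x \<in> V \<Longrightarrow> \<phi> (r *\<^sub>R x) = r * \<phi> x"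
    and bound: "\<And>x. x \<in> V \<Longrightarrow> \<bar>\<phi> x\<bar> \<le> C * norm x"
  shows "\<exists>w\<in>V. \<forall>x\<in>V. \<phi> x = inner w x"
proof -
  define q where "q z = inner z z - 2 * \<phi> z" for z
  have lower: "- C\<^sup>2 \<le> q z" if "z \<in> V" for z
  proof -
    have "0 \<le> (norm z - C)\<^sup>2" by simp
    then have "- C\<^sup>2 \<le> (norm z)\<^sup>2 - 2 * (C * norm z)"
      by (simp add: power2_eq_square algebra_simps)
    then show ?thesis
      using bound[OF that] by (simp add: q_def power2_norm_eq_inner)
  qed
  have ne: "q ` V \<noteq> {}" using subspace_0[OF V(2)] by blast
  have bdd: "bdd_below (q ` V)" using lower by (intro bdd_belowI2) auto
  define m where "m = Inf (q ` V)"
  have m_le: "m \<le> q z" if "z \<in> V" for z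
    unfolding m_def using bdd that by (intro cInf_lower) auto
  define d :: "nat \<Rightarrow> real" where "d n = 1 / real (Suc n)" for n
  have "\<exists>z\<in>V. q z < m + d n" for n
    using cInf_lessD[OF ne, of "m + d n"] by (auto simp: m_def d_def)
  then obtain z where z: "\<And>n. z n \<in> V" "\<And>n. q (z n) < m + d n" by metis
  \<comment> \<open>Parallelogram law for \<open>q\<close>, whose linear part cancels. The midpoint
    has value at least \<open>m\<close>, so near-minimizers are close to each other.\<close>
  have par: "(norm (a - b))\<^sup>2 / 2 = q a + q b - 2 * q ((1/2) *\<^sub>R (a + b))" if "a \<in> V" "b \<in> V" for a b
  proof -
    have "\<phi> ((1/2) *\<^sub>R (a + b)) = (1/2) * (\<phi> a + \<phi> b)"
      using that subspace_add[OF V(2) that] by (simp only: add scale)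
    then show ?thesis
      by (simp add: q_def power2_norm_eq_inner inner_add_left inner_add_right
          inner_diff_left inner_diff_right inner_commute field_simps)
  qed
  have dist_z: "(norm (z n - z k))\<^sup>2 \<le> 2 * (d n + d k)" for n k
  proof -
    have "(1/2) *\<^sub>R (z n + z k) \<in> V" using V(2) z(1) by (simp add: subspace_add subspace_scale)
    from m_le[OF this] have "(norm (z n - z k))\<^sup>2 / 2 \<le> d n + d k"
      unfolding par[OF z(1) z(1)] using z(2)[of n] z(2)[of k] by linarith
    then show ?thesis by (simp add: field_simps)
  qed
  have "Cauchy z"
  proof (rule CauchyI)
    fix e :: real assume "0 < e"
    then obtain N where N: "d N < e\<^sup>2 / 4"
      using nat_approx_posE[of "e\<^sup>2 / 4"] by (auto simp: d_def)
    have "norm (z n - z k) < e" if "n \<ge> N" "k \<ge> N" for n k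
    proof -
      have "d n \<le> d N" "d k \<le> d N"
        using that by (auto simp: d_def frac_le)
      then have "2 * (d n + d k) \<le> 4 * d N" by simp
      also have "\<dots> < e\<^sup>2" using N by simp
      finally have "(norm (z n - z k))\<^sup>2 < e\<^sup>2" using dist_z[of n k] by simp
      then show ?thesis using \<open>0 < e\<close> by (simp add: power2_less_imp_less)
    qed
    then show "\<exists>M. \<forall>m\<ge>M. \<forall>n\<ge>M. norm (z m - z n) < e" by blast
  qed
  then obtain w where w: "z \<longlonglongrightarrow> w" using Cauchy_convergent convergent_def by blast
  have wV: "w \<in> V" by (rule closed_sequentially[OF V(1) _ w]) (use z in auto)
  have "(\<lambda>n. \<phi> (z n - w)) \<longlonglongrightarrow> 0"
  proof (rule Lim_null_comparison)
    show "\<forall>\<^sub>F n in sequentially. norm (\<phi> (z n - w)) \<le> C * norm (z n - w)"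
      using bound subspace_diff[OF V(2) z(1) wV] by (intro always_eventually) auto
    show "(\<lambda>n. C * norm (z n - w)) \<longlonglongrightarrow> 0"
      using tendsto_mult_right_zero[OF tendsto_norm_zero[OF LIM_zero[OF w]]] by simp
  qed
  moreover have "\<phi> (z n) = \<phi> (z n - w) + \<phi> w" for n
    using add[OF subspace_diff[OF V(2) z(1) wV] wV, of n] by simp
  ultimately have "(\<lambda>n. \<phi> (z n)) \<longlonglongrightarrow> \<phi> w" by (auto intro: tendsto_eq_intros)
  then have qw: "(\<lambda>n. q (z n)) \<longlonglongrightarrow> q w"
    unfolding q_def by (intro tendsto_intros w)
  have "(\<lambda>n. m + d n) \<longlonglongrightarrow> m + 0"
    unfolding d_def by (intro tendsto_intros LIMSEQ_Suc[OF lim_1_over_n])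
  then have "q w \<le> m"
    using LIMSEQ_le[OF qw, of "\<lambda>n. m + d n" m] z(2) by (force intro: less_imp_le)
  have "\<phi> x = inner w x" if x: "x \<in> V" for x
  proof (rule ccontr)
    assume neq: "\<phi> x \<noteq> inner w x"
    define \<delta> where "\<delta> = \<phi> x - inner w x"
    have q: "0 \<le> t\<^sup>2 * inner x x - 2 * t * \<delta>" for t
    proof -
      have "q w \<le> q (w + t *\<^sub>R x)"
        using \<open>q w \<le> m\<close> m_le[of "w + t *\<^sub>R x"] wV x V(2)
        by (meson order_trans subspace_add subspace_scale)
      then show ?thesis
        using add[OF wV subspace_scale[OF V(2) x, of t]] x
        by (simp add: q_def scale \<delta>_def inner_add_left inner_add_right inner_commute
            power2_eq_square algebra_simps)
    qed
    have "\<phi> 0 = 0" using scale[OF wV, of 0] by simp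
    then have xx: "inner x x > 0" using neq by (cases "x = 0") auto
    \<comment> \<open>Value of the quadratic polynomial at its minimizer in t.\<close>
    have "(\<delta> / inner x x)\<^sup>2 * inner x x - 2 * (\<delta> / inner x x) * \<delta> = - (\<delta>\<^sup>2 / inner x x)"
      using xx by (simp add: field_simps power2_eq_square)
    then have "0 \<le> - (\<delta>\<^sup>2 / inner x x)" using q[of "\<delta> / inner x x"] by simp
    moreover have "\<delta>\<^sup>2 / inner x x > 0" using xx neq by (simp add: \<delta>_def)
    ultimately show False by simp
  qed
  with wV show ?thesis by blast
qed

lemma orthogonal_projection_exists:
  fixes V :: "'v::{real_inner, complete_space} set"
  assumes "closed V" "subspace V"
  shows "\<exists>y\<in>V. \<forall>z\<in>V. inner (h - y) z = 0"
proof -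
  have "\<exists>w\<in>V. \<forall>x\<in>V. inner h x = inner w x"
    by (rule riesz_on_closed_subspace[OF assms, of "inner h" "norm h"])
      (simp_all add: inner_add_right Cauchy_Schwarz_ineq2)
  then show ?thesis by (auto simp: inner_diff_left)
qed

text \<open>A closed subspace is its own double orthogonal complement. Membership in a closed span
  thus becomes a statement about one vector orthogonal to the generators.\<close>

lemma mem_closed_subspace_if_orthogonal:
  fixes V :: "'v::{real_inner, complete_space} set"
  assumes V: "closed V" "subspace V"
    and orth: "\<And>y. (\<And>v. v \<in> V \<Longrightarrow> inner y v = 0) \<Longrightarrow> inner y x = 0"
  shows "x \<in> V"
proof -
  obtain y where y: "y \<in> V" "\<And>z. z \<in> V \<Longrightarrow> inner (x - y) z = 0"
    using orthogonal_projection_exists[OF V, of x] by auto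
  then have "inner (x - y) (x - y) = 0"
    unfolding inner_diff_right[of "x - y"] using orth[OF y(2)] by simp
  then show ?thesis using y(1) by simp
qed

lemma subspace_closure:
  fixes S :: "'v::real_normed_vector set"
  assumes S: "subspace S"
  shows "subspace (closure S)"
proof (rule subspaceI)
  show "0 \<in> closure S" using S closure_subset by (auto simp: subspace_def)
next
  fix x y assume "x \<in> closure S" "y \<in> closure S"
  then obtain X Y where "\<And>n. X n \<in> S" "X \<longlonglongrightarrow> x" "\<And>n. Y n \<in> S" "Y \<longlonglongrightarrow> y"
    unfolding closure_sequential by metis
  then have "\<forall>n. X n + Y n \<in> S" "(\<lambda>n. X n + Y n) \<longlonglongrightarrow> x + y"
    using S by (auto intro: subspace_add tendsto_add)
  then show "x + y \<in> closure S"
    unfolding closure_sequential by (intro exI[of _ "\<lambda>n. X n + Y n"] conjI)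
next
  fix x and r :: real assume "x \<in> closure S"
  then obtain X where "\<And>n. X n \<in> S" "X \<longlonglongrightarrow> x"
    unfolding closure_sequential by metis
  then have "\<forall>n. r *\<^sub>R X n \<in> S" "(\<lambda>n. r *\<^sub>R X n) \<longlonglongrightarrow> r *\<^sub>R x"
    using S by (auto intro: subspace_scale tendsto_scaleR)
  then show "r *\<^sub>R x \<in> closure S"
    unfolding closure_sequential by (intro exI[of _ "\<lambda>n. r *\<^sub>R X n"] conjI)
qed

section \<open>Norming functionals and the Borel sets of a separable normed space\<close>

text \<open>Homogeneity is required as an inequality for t > 0, which is what constructions by
  infima deliver; \<open>sublinear_scale\<close> recovers equality by applying it to 1/t.\<close>

definition sublinear :: "('a::real_vector \<Rightarrow> real) \<Rightarrow> bool" where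
  "sublinear q \<longleftrightarrow>
    (\<forall>x y. q (x + y) \<le> q x + q y) \<and> (\<forall>t>0. \<forall>x. q (t *\<^sub>R x) \<le> t * q x)"

lemma sublinear_add: "sublinear q \<Longrightarrow> q (x + y) \<le> q x + q y"
  by (simp add: sublinear_def)

lemma sublinear_0:
  assumes "sublinear q"
  shows "q 0 = 0"
proof -
  have "q ((1/2) *\<^sub>R 0) \<le> (1/2) * q 0" "q (2 *\<^sub>R 0) \<le> 2 * q 0"
    using assms unfolding sublinear_def
    by (meson half_gt_zero zero_less_one, meson zero_less_numeral)
  then show ?thesis by simp
qed

lemma sublinear_scale:
  assumes "sublinear q" "t \<ge> 0"
  shows "q (t *\<^sub>R x) = t * q x"
proof (cases "t = 0")
  case True
  then show ?thesis using sublinear_0[OF assms(1)] by simp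
next
  case False
  with assms have t: "t > 0" by simp
  have "q (inverse t *\<^sub>R (t *\<^sub>R x)) \<le> inverse t * q (t *\<^sub>R x)"
    using assms(1) t unfolding sublinear_def by (meson positive_imp_inverse_positive)
  then have "t * q x \<le> q (t *\<^sub>R x)" using t by (simp add: field_simps)
  moreover have "q (t *\<^sub>R x) \<le> t * q x" using assms t by (simp add: sublinear_def)
  ultimately show ?thesis by simp
qed

lemma sublinear_ge: "sublinear q \<Longrightarrow> - q (- x) \<le> q x"
  using sublinear_add[of q x "- x"] sublinear_0[of q] by simp

text \<open>Lower \<open>q\<close> along the ray through \<open>y\<close> as far as subadditivity
  permits. The bound at t = 1 gives r (- y) \<le> - q y, so every linear functional below
  \<open>r\<close> takes the value \<open>q y\<close> at \<open>y\<close>.\<close>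

lemma sublinear_improve:
  assumes q: "sublinear q"
  obtains r where "sublinear r" "\<And>x. r x \<le> q x" "\<And>x. r x \<le> q (x + y) - q y"
proof -
  define g where "g x t = q (x + t *\<^sub>R y) - t * q y" for x t
  define r where "r x = (INF t\<in>{0..}. g x t)" for x
  have bdd: "bdd_below (g x ` {0..})" for x
  proof (rule bdd_belowI2[of _ "- q (- x)"])
    fix t :: real assume t: "t \<in> {0..}"
    have "t * q y = q ((x + t *\<^sub>R y) + (- x))" using sublinear_scale[OF q, of t y] t by simp
    also have "\<dots> \<le> q (x + t *\<^sub>R y) + q (- x)" by (rule sublinear_add[OF q])
    finally show "- q (- x) \<le> g x t" by (simp add: g_def)
  qed
  have le: "r x \<le> g x t" if "t \<ge> 0" for x t
    unfolding r_def by (rule cINF_lower[OF bdd]) (use that in auto)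
  have ge: "a \<le> r x" if "\<And>t. t \<ge> 0 \<Longrightarrow> a \<le> g x t" for a x
    unfolding r_def by (rule cINF_greatest) (use that in auto)
  have "r (x + x') \<le> r x + r x'" for x x'
  proof -
    have *: "r (x + x') - g x t \<le> g x' t'" if "t \<ge> 0" "t' \<ge> 0" for t t'
    proof -
      have "r (x + x') \<le> g (x + x') (t + t')" using that by (intro le) simp
      also have "\<dots> = q ((x + t *\<^sub>R y) + (x' + t' *\<^sub>R y)) - (t + t') * q y"
        by (simp add: g_def algebra_simps)
      also have "\<dots> \<le> g x t + g x' t'"
        using sublinear_add[OF q, of "x + t *\<^sub>R y" "x' + t' *\<^sub>R y"] by (simp add: g_def algebra_simps)
      finally show ?thesis by simp
    qed
    have "r (x + x') - r x' \<le> g x t" if "t \<ge> 0" for t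
      using ge[of "r (x + x') - g x t" x'] *[OF that] by simp
    then show ?thesis using ge[of "r (x + x') - r x'" x] by simp
  qed
  moreover have "r (s *\<^sub>R x) \<le> s * r x" if s: "s > 0" for s x
  proof -
    have "r (s *\<^sub>R x) / s \<le> g x t" if t: "t \<ge> 0" for t
    proof -
      have "r (s *\<^sub>R x) \<le> g (s *\<^sub>R x) (s * t)" using s t by (intro le) simp
      also have "\<dots> = q (s *\<^sub>R (x + t *\<^sub>R y)) - s * t * q y" by (simp add: g_def algebra_simps)
      also have "\<dots> = s * g x t"
        using s by (subst sublinear_scale[OF q]) (simp_all add: g_def algebra_simps)
      finally show ?thesis using s by (simp add: field_simps)
    qed
    then show ?thesis using ge[of "r (s *\<^sub>R x) / s" x] s by (simp add: field_simps)
  qed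
  ultimately have "sublinear r" by (simp add: sublinear_def)
  moreover have "r x \<le> q x" for x using le[of 0 x] by (simp add: g_def)
  moreover have "r x \<le> q (x + y) - q y" for x using le[of 1 x] by (simp add: g_def)
  ultimately show ?thesis by (rule that)
qed

text \<open>
  A minimal sublinear functional is linear, because otherwise \<open>sublinear_improve\<close> would lower it.
\<close>

lemma hahn_banach_sublinear:
  assumes p: "sublinear p"
  shows "\<exists>f. linear f \<and> (\<forall>x. f x \<le> p x)"
proof -
  define A where "A = {q. sublinear q \<and> (\<forall>x. q x \<le> p x)}"
  have "\<exists>m\<in>A. \<forall>a\<in>A. (\<forall>x. a x \<le> m x) \<longrightarrow> a = m"
  \<comment> \<open>Zorn's lemma yields a maximal element, so the order is reversed: a chain is
    bounded by its pointwise infimum, and the result is a minimal functional.\<close>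
  proof (rule predicate_Zorn[where P = "\<lambda>q r. \<forall>x. r x \<le> q x"])
    show "partial_order_on A (relation_of (\<lambda>q r. \<forall>x. r x \<le> q x) A)"
      by (rule partial_order_on_relation_ofI) (auto intro: order_trans order_antisym simp: fun_eq_iff)
    fix C assume "C \<in> Chains (relation_of (\<lambda>q r. \<forall>x. r x \<le> q x) A)"
    then have C: "C \<subseteq> A" "\<And>a b. a \<in> C \<Longrightarrow> b \<in> C \<Longrightarrow> (\<forall>x. a x \<le> b x) \<or> (\<forall>x. b x \<le> a x)"
      by (auto simp: Chains_def relation_of_def)
    show "\<exists>u\<in>A. \<forall>a\<in>C. \<forall>x. u x \<le> a x"
    proof (cases "C = {}")
      case True
      then show ?thesis using p by (auto simp: A_def)
    next
      case False
      define u where "u x = (INF q\<in>C. q x)" for x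
      have bdd: "bdd_below ((\<lambda>q. q x) ` C)" for x
      proof (rule bdd_belowI2[of _ "- p (- x)"])
        fix q assume "q \<in> C"
        then have "sublinear q" "q (- x) \<le> p (- x)" using C by (auto simp: A_def)
        then show "- p (- x) \<le> q x" using sublinear_ge[of q x] by simp
      qed
      have le: "u x \<le> q x" if "q \<in> C" for q x
        unfolding u_def by (rule cINF_lower[OF bdd that])
      have ge: "a \<le> u x" if "\<And>q. q \<in> C \<Longrightarrow> a \<le> q x" for a x
        unfolding u_def by (rule cINF_greatest[OF False]) (use that in auto)
      have sub: "sublinear q" if "q \<in> C" for q using C that by (auto simp: A_def)
      \<comment> \<open>The smaller of two members of the chain serves both terms; this makes the
        infimum subadditive.\<close>
      have *: "u (x + y) \<le> a x + b y" if ab: "a \<in> C" "b \<in> C" for a b x y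
      proof -
        obtain c where c: "c \<in> C" "\<And>x. c x \<le> a x" "\<And>x. c x \<le> b x"
          using C(2)[OF ab] ab by blast
        have "u (x + y) \<le> c x + c y" using le[OF c(1)] sublinear_add[OF sub[OF c(1)]] order_trans by blast
        also have "\<dots> \<le> a x + b y" using c by (intro add_mono) auto
        finally show ?thesis .
      qed
      have "u (x + y) \<le> u x + u y" for x y
      proof -
        have "u (x + y) - a x \<le> u y" if "a \<in> C" for a
          by (rule ge) (use *[OF that] in \<open>simp add: algebra_simps\<close>)
        then have "u (x + y) - u y \<le> u x" by (intro ge) (simp add: algebra_simps)
        then show ?thesis by simp
      qed
      moreover have "u (t *\<^sub>R x) \<le> t * u x" if t: "t > 0" for t x
      proof -
        have "u (t *\<^sub>R x) / t \<le> u x"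
        proof (rule ge)
          fix q assume q: "q \<in> C"
          have "u (t *\<^sub>R x) \<le> t * q x" using le[OF q, of "t *\<^sub>R x"] sublinear_scale[OF sub[OF q], of t x] t by simp
          then show "u (t *\<^sub>R x) / t \<le> q x" using t by (simp add: field_simps)
        qed
        then show ?thesis using t by (simp add: field_simps)
      qed
      ultimately have "sublinear u" by (simp add: sublinear_def)
      moreover have "u x \<le> p x" for x
      proof -
        obtain q where q: "q \<in> C" using False by blast
        then have "q x \<le> p x" using C(1) by (auto simp: A_def)
        then show ?thesis using le[OF q, of x] by simp
      qed
      ultimately show ?thesis using le by (auto simp: A_def)
    qed
  qed
  then obtain f where f: "f \<in> A" and minimal: "\<And>a. a \<in> A \<Longrightarrow> (\<And>x. a x \<le> f x) \<Longrightarrow> a = f" by blast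
  have sf: "sublinear f" and fp: "\<And>x. f x \<le> p x" using f by (auto simp: A_def)
  have add: "f (x + y) = f x + f y" for x y
  proof -
    obtain r where r: "sublinear r" "\<And>x. r x \<le> f x" "\<And>x. r x \<le> f (x + y) - f y"
      using sublinear_improve[OF sf, of y] by blast
    \<comment> \<open>By minimality. The third property of \<open>r\<close> then reads f x + f y
      \<le> f (x + y).\<close>
    have "r = f" by (rule minimal) (use r fp in \<open>auto simp: A_def intro: order_trans\<close>)
    then show ?thesis using r(3)[of x] sublinear_add[OF sf, of x y] by simp
  qed
  have neg: "f (- x) = - f x" for x using add[of x "- x"] sublinear_0[OF sf] by simp
  have "f (t *\<^sub>R x) = t * f x" for t x
  proof (cases "t \<ge> 0")
    case False
    then show ?thesis using sublinear_scale[OF sf, of "- t" x] neg[of "t *\<^sub>R x"] by simp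
  qed (simp add: sublinear_scale[OF sf])
  then have "linear f" by (intro linearI) (simp_all add: add)
  with fp show ?thesis by blast
qed

text \<open>Hahn-Banach is applied not to the norm but to its improvement along \<open>d\<close>,
  which already forces the value \<open>norm d\<close> at \<open>d\<close>; no functional on the
  line through \<open>d\<close> has to be extended.\<close>

lemma norming_functional:
  fixes d :: "'b::real_normed_vector"
  shows "\<exists>f :: 'b \<Rightarrow>\<^sub>L real. (\<forall>x. blinfun_apply f x \<le> norm x) \<and> blinfun_apply f d = norm d"
proof -
  have "sublinear (norm :: 'b \<Rightarrow> real)" by (simp add: sublinear_def norm_triangle_ineq)
  then obtain r where r: "sublinear r" "\<And>x::'b. r x \<le> norm x" "\<And>x. r x \<le> norm (x + d) - norm d"
    using sublinear_improve[of norm d] by blast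
  obtain f where f: "linear f" "\<And>x. f x \<le> r x" using hahn_banach_sublinear[OF r(1)] by blast
  have fn: "f x \<le> norm x" for x using f(2)[of x] r(2)[of x] by simp
  have "bounded_linear f"
    by (rule bounded_linear_intro[of _ 1])
      (use fn fn[of "- x" for x] in \<open>auto simp: linear_add[OF f(1)] linear_scale[OF f(1)] linear_neg[OF f(1)] abs_le_iff\<close>)
  then have B: "blinfun_apply (Blinfun f) = f" by (rule bounded_linear_Blinfun_apply)
  have "f (- d) \<le> - norm d" using f(2)[of "- d"] r(3)[of "- d"] by simp
  then have "f d = norm d" using fn[of d] by (simp add: linear_neg[OF f(1)])
  then show ?thesis using fn by (intro exI[of _ "Blinfun f"]) (simp add: B)
qed

section \<open>Generation of the Borel sets by continuous functionals\<close>

lemma borel_measurable_blinfun_apply: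
  fixes f :: "'b::real_normed_vector \<Rightarrow>\<^sub>L 'c::real_normed_vector"
  assumes "sets M = sets borel"
  shows "blinfun_apply f \<in> borel_measurable M"
  unfolding measurable_cong_sets[OF assms refl]
  by (intro borel_measurable_continuous_onI linear_continuous_on blinfun.bounded_linear_right)

text \<open>
  In a separable space, countably many norming functionals cut out every closed ball.
\<close>

lemma sets_borel_eq_sigma_functionals:
  "sets (borel :: 'b::{real_normed_vector, second_countable_topology} measure) =
    sigma_sets UNIV {blinfun_apply f -` S | (f :: 'b \<Rightarrow>\<^sub>L real) S. S \<in> sets borel}"
    (is "_ = sigma_sets UNIV ?G")
proof
  have "blinfun_apply f -` S \<in> sets borel" if "S \<in> sets borel" for f :: "'b \<Rightarrow>\<^sub>L real" and S
  proof -
    have "blinfun_apply f \<in> borel_measurable borel"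
      by (rule borel_measurable_blinfun_apply) simp
    from measurable_sets[OF this that] show ?thesis by simp
  qed
  then show "sigma_sets UNIV ?G \<subseteq> sets borel"
    using sets.sigma_sets_subset[of ?G borel] by auto
next
  interpret G: sigma_algebra UNIV "sigma_sets UNIV ?G" by (rule sigma_algebra_sigma_sets) simp
  obtain D :: "'b set" where D: "countable D" "\<And>X. open X \<Longrightarrow> X \<noteq> {} \<Longrightarrow> \<exists>d\<in>D. d \<in> X"
    using countable_dense_setE by blast
  obtain F :: "'b \<Rightarrow> 'b \<Rightarrow>\<^sub>L real" where
    F: "\<And>d x. blinfun_apply (F d) x \<le> norm x" "\<And>d. blinfun_apply (F d) d = norm d"
    using norming_functional by metis
  have near: "\<exists>d\<in>D. dist d c < e" if "e > 0" for c and e :: real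
    using D(2)[of "ball c e"] that by (auto simp: dist_commute)
  \<comment> \<open>The functional of a point \<open>d\<close> of \<open>D\<close> close to x - c
    almost attains norm (x - c), so the countably many \<open>F d\<close> suffice.\<close>
  have cball: "cball c r = (\<Inter>d\<in>D. blinfun_apply (F d) -` {.. r + blinfun_apply (F d) c})" for c r
  proof (intro set_eqI iffI)
    fix x assume "x \<in> cball c r"
    then have "norm (x - c) \<le> r" by (simp add: dist_norm norm_minus_commute)
    then have "blinfun_apply (F d) (x - c) \<le> r" for d using F(1)[of d "x - c"] by linarith
    then show "x \<in> (\<Inter>d\<in>D. blinfun_apply (F d) -` {.. r + blinfun_apply (F d) c})"
      by (simp add: blinfun.diff_right algebra_simps)
  next
    fix x assume x: "x \<in> (\<Inter>d\<in>D. blinfun_apply (F d) -` {.. r + blinfun_apply (F d) c})"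
    have "norm (x - c) \<le> r + e" if "e > 0" for e
    proof -
      obtain d where d: "d \<in> D" "dist d (x - c) < e / 2" using near[of "e / 2"] \<open>e > 0\<close> by auto
      have "norm d = blinfun_apply (F d) (x - c) + blinfun_apply (F d) (d - (x - c))"
        by (simp add: F(2) blinfun.diff_right)
      also have "\<dots> \<le> r + norm (d - (x - c))"
        using x d(1) F(1)[of d "d - (x - c)"] by (auto simp: blinfun.diff_right algebra_simps)
      finally show ?thesis
        using d(2) norm_triangle_ineq2[of "x - c" d] by (simp add: dist_norm norm_minus_commute)
    qed
    then have "norm (x - c) \<le> r" by (rule field_le_epsilon)
    then show "x \<in> cball c r" by (simp add: dist_norm norm_minus_commute)
  qed
  have "D \<noteq> {}" using near[of 1] by auto
  then have cball_G: "cball c r \<in> sigma_sets UNIV ?G" for c r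
    unfolding cball using D(1)
    by (intro G.countable_INT'') (blast intro: sigma_sets.Basic borel_closed closed_atMost)+
  have "U \<in> sigma_sets UNIV ?G" if U: "open U" for U :: "'b set"
  proof -
    define P where "P = {(d, n). d \<in> D \<and> cball d (1 / real (Suc n)) \<subseteq> U}"
    have "countable P"
      by (rule countable_subset[of _ "D \<times> UNIV"]) (use D(1) in \<open>auto simp: P_def\<close>)
    have "U = (\<Union>(d, n)\<in>P. cball d (1 / real (Suc n)))"
    proof (intro equalityI subsetI)
      fix x assume "x \<in> U"
      then obtain e where e: "e > 0" "cball x e \<subseteq> U" using U open_contains_cball by blast
      \<comment> \<open>Half of \<open>e\<close> is for the distance from \<open>x\<close> to the
        center, half for the radius.\<close>
      obtain n where n: "1 / real (Suc n) < e / 2" using e(1) nat_approx_posE[of "e / 2"] by auto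
      obtain d where d: "d \<in> D" "dist d x < 1 / real (Suc n)" using near[of "1 / real (Suc n)" x] by auto
      have "cball d (1 / real (Suc n)) \<subseteq> cball x e"
      proof
        fix y assume "y \<in> cball d (1 / real (Suc n))"
        then have "dist d y \<le> 1 / real (Suc n)" by simp
        then show "y \<in> cball x e"
          using dist_triangle[of x y d] d(2) n by (simp add: dist_commute)
      qed
      then show "x \<in> (\<Union>(d, n)\<in>P. cball d (1 / real (Suc n)))"
        using e(2) d by (force simp: P_def)
    qed (auto simp: P_def)
    then show ?thesis
      using \<open>countable P\<close> cball_G by (metis (no_types, lifting) G.countable_UN'' case_prod_beta)
  qed
  then have "sigma_sets UNIV {U :: 'b set. open U} \<subseteq> sigma_sets UNIV ?G"
    by (intro G.sigma_sets_subset) auto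
  then show "sets borel \<subseteq> sigma_sets UNIV ?G" by (simp add: borel_def)
qed

section \<open>Square-integrable functions\<close>

definition sqint :: "'a measure \<Rightarrow> ('a \<Rightarrow> real) \<Rightarrow> bool" where
  "sqint M f \<longleftrightarrow> f \<in> borel_measurable M \<and> integrable M (\<lambda>x. (f x)\<^sup>2)"

lemma sqint_measurable: "sqint M f \<Longrightarrow> f \<in> borel_measurable M"
  by (simp add: sqint_def)

lemma sqint_mult:
  assumes "sqint M f" "sqint M g"
  shows "integrable M (\<lambda>x. f x * g x)"
proof (rule Bochner_Integration.integrable_bound)
  show "integrable M (\<lambda>x. (f x)\<^sup>2 + (g x)\<^sup>2)" using assms by (simp add: sqint_def)
  show "(\<lambda>x. f x * g x) \<in> borel_measurable M" using assms by (auto simp: sqint_def)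
  have "\<bar>a * b\<bar> \<le> a\<^sup>2 + b\<^sup>2" for a b :: real
  proof -
    have "2 * \<bar>a * b\<bar> \<le> a\<^sup>2 + b\<^sup>2"
      using sum_squares_bound[of "\<bar>a\<bar>" "\<bar>b\<bar>"] by (simp add: abs_mult mult.assoc)
    then show ?thesis using abs_ge_zero[of "a * b"] by linarith
  qed
  then show "AE x in M. norm (f x * g x) \<le> norm ((f x)\<^sup>2 + (g x)\<^sup>2)" by simp
qed

lemma sqint_add: "sqint M f \<Longrightarrow> sqint M g \<Longrightarrow> sqint M (\<lambda>x. f x + g x)"
  using sqint_mult[of M f g] borel_measurable_add[of f M g]
  by (simp add: sqint_def power2_sum mult.assoc)

lemma sqint_scale: "sqint M f \<Longrightarrow> sqint M (\<lambda>x. r * f x)"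
  using borel_measurable_times[of "\<lambda>_. r" M f] by (simp add: sqint_def power_mult_distrib)

lemma sqint_diff: "sqint M f \<Longrightarrow> sqint M g \<Longrightarrow> sqint M (\<lambda>x. f x - g x)"
  using sqint_add[of M f "\<lambda>x. - 1 * g x"] sqint_scale[of M g "- 1"] by simp

text \<open>The integral of (f + t g)^2 is a nonnegative quadratic in t, so its discriminant is not
  positive; it degenerates to an affine function when C = 0.\<close>

lemma Cauchy_Schwarz_integral:
  assumes f: "sqint M f" and g: "sqint M g"
  shows "\<bar>\<integral>x. f x * g x \<partial>M\<bar> \<le> sqrt (\<integral>x. (f x)\<^sup>2 \<partial>M) * sqrt (\<integral>x. (g x)\<^sup>2 \<partial>M)"
proof -
  define A B C where "A = (\<integral>x. (f x)\<^sup>2 \<partial>M)" "B = (\<integral>x. f x * g x \<partial>M)" "C = (\<integral>x. (g x)\<^sup>2 \<partial>M)"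
  note [simp] = sqint_mult[OF f g]
  have ff: "integrable M (\<lambda>x. (f x)\<^sup>2)" "integrable M (\<lambda>x. (g x)\<^sup>2)"
    using f g by (auto simp: sqint_def)
  have quad: "0 \<le> A + 2 * t * B + t\<^sup>2 * C" for t
  proof -
    have "(\<integral>x. (f x + t * g x)\<^sup>2 \<partial>M) = (\<integral>x. (f x)\<^sup>2 + (2 * t * (f x * g x) + t\<^sup>2 * (g x)\<^sup>2) \<partial>M)"
      by (intro Bochner_Integration.integral_cong) (auto simp: power2_eq_square algebra_simps)
    also have "\<dots> = A + (2 * t * B + t\<^sup>2 * C)"
      using ff by (simp add: A_B_C_def)
    finally show ?thesis
      using Bochner_Integration.integral_nonneg[of M "\<lambda>x. (f x + t * g x)\<^sup>2"] by simp
  qed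
  have nonneg: "A \<ge> 0" "C \<ge> 0" by (simp_all add: A_B_C_def)
  have "B\<^sup>2 \<le> A * C"
  proof (cases "C = 0")
    case True
    have "B = 0"
    proof (rule ccontr)
      assume "B \<noteq> 0"
      \<comment> \<open>At this t the affine function \<open>A + 2 * t * B\<close> equals
        -1.\<close>
      then have "2 * (- (A + 1) / (2 * B)) * B = - (A + 1)" by simp
      then show False using quad[of "- (A + 1) / (2 * B)"] True by simp
    qed
    then show ?thesis using True by simp
  next
    case False
    then have "C > 0" using nonneg by simp
    then show ?thesis using quad[of "- B / C"] by (simp add: field_simps power2_eq_square)
  qed
  then have "sqrt (B\<^sup>2) \<le> sqrt (A * C)" by (rule real_sqrt_le_mono)
  then show ?thesis by (simp add: real_sqrt_mult A_B_C_def)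
qed

lemma tendsto_integral_mult:
  assumes F: "\<And>n. sqint M (F n)" and f: "sqint M f" and g: "sqint M g"
    and lim: "(\<lambda>n. \<integral>x. (F n x - f x)\<^sup>2 \<partial>M) \<longlonglongrightarrow> 0"
  shows "(\<lambda>n. \<integral>x. F n x * g x \<partial>M) \<longlonglongrightarrow> (\<integral>x. f x * g x \<partial>M)"
proof (rule LIM_zero_cancel)
  have "(\<lambda>n. sqrt (\<integral>x. (F n x - f x)\<^sup>2 \<partial>M) * sqrt (\<integral>x. (g x)\<^sup>2 \<partial>M)) \<longlonglongrightarrow>
      sqrt 0 * sqrt (\<integral>x. (g x)\<^sup>2 \<partial>M)"
    by (intro tendsto_intros lim)
  then have *: "(\<lambda>n. sqrt (\<integral>x. (F n x - f x)\<^sup>2 \<partial>M) * sqrt (\<integral>x. (g x)\<^sup>2 \<partial>M)) \<longlonglongrightarrow> 0" by simp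
  show "(\<lambda>n. (\<integral>x. F n x * g x \<partial>M) - (\<integral>x. f x * g x \<partial>M)) \<longlonglongrightarrow> 0"
  proof (rule Lim_null_comparison[OF _ *], intro always_eventually allI)
    fix n
    have "(\<integral>x. F n x * g x \<partial>M) - (\<integral>x. f x * g x \<partial>M) = (\<integral>x. (F n x - f x) * g x \<partial>M)"
      using sqint_mult[OF F g] sqint_mult[OF f g] by (simp add: left_diff_distrib)
    then show "norm ((\<integral>x. F n x * g x \<partial>M) - (\<integral>x. f x * g x \<partial>M)) \<le>
        sqrt (\<integral>x. (F n x - f x)\<^sup>2 \<partial>M) * sqrt (\<integral>x. (g x)\<^sup>2 \<partial>M)"
      using Cauchy_Schwarz_integral[OF sqint_diff[OF F f] g] by simp
  qed
qed

section \<open>Riesz-Fischer completeness\<close>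

lemma (in prob_space) integral_abs_le_sqrt:
  assumes "sqint M f"
  shows "integrable M (\<lambda>x. \<bar>f x\<bar>)" "(\<integral>x. \<bar>f x\<bar> \<partial>M) \<le> sqrt (\<integral>x. (f x)\<^sup>2 \<partial>M)"
proof -
  have 1: "sqint M (\<lambda>_. 1 :: real)" by (simp add: sqint_def)
  have f: "sqint M (\<lambda>x. \<bar>f x\<bar>)"
    using assms borel_measurable_abs[of f M] by (simp add: sqint_def)
  show "integrable M (\<lambda>x. \<bar>f x\<bar>)" using sqint_mult[OF f 1] by simp
  show "(\<integral>x. \<bar>f x\<bar> \<partial>M) \<le> sqrt (\<integral>x. (f x)\<^sup>2 \<partial>M)"
    using Cauchy_Schwarz_integral[OF f 1] by (simp add: prob_space)
qed

text \<open>Sum and integral commute for nonnegative terms, and a function with finite integral is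
  finite almost everywhere.\<close>

lemma AE_summable_if_summable_integrals:
  fixes D :: "nat \<Rightarrow> 'a \<Rightarrow> real"
  assumes int: "\<And>k. integrable M (D k)" and nonneg: "\<And>k x. 0 \<le> D k x"
    and sum: "summable (\<lambda>k. \<integral>x. D k x \<partial>M)"
  shows "AE x in M. summable (\<lambda>k. D k x)"
proof -
  have meas [measurable]: "D k \<in> borel_measurable M" for k by (rule borel_measurable_integrable[OF int])
  have "(\<integral>\<^sup>+x. (\<Sum>k. ennreal (D k x)) \<partial>M) = (\<Sum>k. \<integral>\<^sup>+x. ennreal (D k x) \<partial>M)"
    by (rule nn_integral_suminf) simp
  also have "\<dots> = (\<Sum>k. ennreal (\<integral>x. D k x \<partial>M))"
    using int nonneg by (intro suminf_cong nn_integral_eq_integral) auto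
  also have "\<dots> \<noteq> \<infinity>"
    using sum nonneg by (subst suminf_ennreal2) auto
  finally have "AE x in M. (\<Sum>k. ennreal (D k x)) \<noteq> \<infinity>"
    by (intro nn_integral_noteq_infinite) auto
  then show ?thesis
    by eventually_elim (use nonneg in \<open>auto intro: summable_suminf_not_top\<close>)
qed

text \<open>A fast subsequence has absolutely summable increments, hence converges almost
  everywhere. Fatou's lemma along it then bounds the distance of every late member of the full
  sequence from the limit.\<close>

lemma (in prob_space) L2_complete:
  fixes F :: "nat \<Rightarrow> 'a \<Rightarrow> real"
  assumes F: "\<And>n. sqint M (F n)"
    and cauchy: "\<And>e. 0 < e \<Longrightarrow> \<exists>N. \<forall>m\<ge>N. \<forall>n\<ge>N. (\<integral>x. (F m x - F n x)\<^sup>2 \<partial>M) < e"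
  shows "\<exists>f. sqint M f \<and> (\<lambda>n. \<integral>x. (F n x - f x)\<^sup>2 \<partial>M) \<longlonglongrightarrow> 0"
proof -
  have [measurable]: "F n \<in> borel_measurable M" for n using F by (simp add: sqint_def)
  \<comment> \<open>The integral is a squared norm: the bound (1/4)^k makes the L1 norms of the
    increments at most (1/2)^k.\<close>
  have "\<forall>k. \<exists>N. \<forall>m\<ge>N. \<forall>n\<ge>N. (\<integral>x. (F m x - F n x)\<^sup>2 \<partial>M) < (1/4) ^ k"
    using cauchy by simp
  then obtain N where N: "\<And>k m n. m \<ge> N k \<Longrightarrow> n \<ge> N k \<Longrightarrow> (\<integral>x. (F m x - F n x)\<^sup>2 \<partial>M) < (1/4) ^ k"
    by metis
  \<comment> \<open>The partial sums put both \<open>r k\<close> and \<open>r (Suc k)\<close> beyond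
    \<open>N k\<close>; the summand \<open>k\<close> sends the indices to infinity.\<close>
  define r where "r k = (\<Sum>i\<le>k. N i) + k" for k
  have r_ge: "N k \<le> r k" "k \<le> r k" for k by (simp_all add: r_def member_le_sum trans_le_add1)
  have r_Suc: "N k \<le> r (Suc k)" for k using r_ge(1)[of k] by (simp add: r_def)
  define D where "D k x = \<bar>F (r (Suc k)) x - F (r k) x\<bar>" for k x
  have D: "sqint M (\<lambda>x. F (r (Suc k)) x - F (r k) x)" for k by (intro sqint_diff F)
  have "AE x in M. summable (\<lambda>k. D k x)"
  proof (rule AE_summable_if_summable_integrals)
    show "integrable M (D k)" for k
      unfolding D_def using integral_abs_le_sqrt(1)[OF D] .
    have bound: "norm (\<integral>x. D k x \<partial>M) \<le> (1/2) ^ k" for k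
    proof -
      have "(\<integral>x. D k x \<partial>M) \<le> sqrt (\<integral>x. (F (r (Suc k)) x - F (r k) x)\<^sup>2 \<partial>M)"
        unfolding D_def by (rule integral_abs_le_sqrt(2)[OF D])
      also have "\<dots> \<le> sqrt ((1/4) ^ k)"
        using N[OF r_Suc r_ge(1), of k] by simp
      also have "\<dots> = (1/2) ^ k" by (simp add: real_sqrt_power real_sqrt_divide)
      finally have "(\<integral>x. D k x \<partial>M) \<le> (1/2) ^ k" .
      moreover have "0 \<le> (\<integral>x. D k x \<partial>M)"
        by (rule Bochner_Integration.integral_nonneg) (simp add: D_def)
      ultimately show ?thesis by simp
    qed
    have "summable (\<lambda>k. (1/2) ^ k :: real)" by (simp add: summable_geometric)
    then show "summable (\<lambda>k. \<integral>x. D k x \<partial>M)"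
      by (rule summable_comparison_test'[where N = 0]) (rule bound)
  qed (simp add: D_def)
  then have conv: "AE x in M. convergent (\<lambda>k. F (r k) x)"
  proof eventually_elim
    case (elim x)
    then have "summable (\<lambda>k. F (r (Suc k)) x - F (r k) x)"
      unfolding D_def by (rule summable_rabs_cancel)
    then have "convergent (\<lambda>n. (\<Sum>k<n. F (r (Suc k)) x - F (r k) x))"
      by (simp add: summable_iff_convergent)
    then have "convergent (\<lambda>n. (F (r n) x - F (r 0) x) + F (r 0) x)"
      unfolding sum_lessThan_telescope[of "\<lambda>k. F (r k) x"]
      by (intro convergent_add convergent_const)
    then show ?case by simp
  qed
  define f where "f x = lim (\<lambda>k. F (r k) x)" for x
  have f_meas [measurable]: "f \<in> borel_measurable M" unfolding f_def by measurable
  have lim: "AE x in M. (\<lambda>k. F (r k) x) \<longlonglongrightarrow> f x"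
    using conv by eventually_elim (simp add: f_def convergent_LIMSEQ_iff)
  have fatou: "(\<integral>\<^sup>+x. ennreal ((F n x - f x)\<^sup>2) \<partial>M) \<le> ennreal e"
    if n: "\<And>m. m \<ge> K \<Longrightarrow> (\<integral>x. (F n x - F m x)\<^sup>2 \<partial>M) \<le> e" for n K e
  proof -
    have "(\<integral>\<^sup>+x. ennreal ((F n x - f x)\<^sup>2) \<partial>M) =
        (\<integral>\<^sup>+x. liminf (\<lambda>k. ennreal ((F n x - F (r k) x)\<^sup>2)) \<partial>M)"
    proof (rule nn_integral_cong_AE, use lim in eventually_elim)
      case (elim x)
      then have "(\<lambda>k. ennreal ((F n x - F (r k) x)\<^sup>2)) \<longlonglongrightarrow> ennreal ((F n x - f x)\<^sup>2)"
        by (intro tendsto_intros)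
      then show ?case
        by (intro lim_imp_Liminf[symmetric]) simp_all
    qed
    also have "\<dots> \<le> liminf (\<lambda>k. \<integral>\<^sup>+x. ennreal ((F n x - F (r k) x)\<^sup>2) \<partial>M)"
      by (rule nn_integral_liminf) simp
    also have "\<dots> \<le> ennreal e"
    proof (rule Liminf_le)
      show "\<forall>\<^sub>F k in sequentially. (\<integral>\<^sup>+x. ennreal ((F n x - F (r k) x)\<^sup>2) \<partial>M) \<le> ennreal e"
      proof (rule eventually_sequentiallyI[of K])
        fix k assume "k \<ge> K"
        then have "r k \<ge> K" using r_ge(2)[of k] by simp
        have "(\<integral>\<^sup>+x. ennreal ((F n x - F (r k) x)\<^sup>2) \<partial>M) = ennreal (\<integral>x. (F n x - F (r k) x)\<^sup>2 \<partial>M)"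
          using sqint_diff[OF F F] by (intro nn_integral_eq_integral) (auto simp: sqint_def)
        then show "(\<integral>\<^sup>+x. ennreal ((F n x - F (r k) x)\<^sup>2) \<partial>M) \<le> ennreal e"
          using n[OF \<open>r k \<ge> K\<close>] by (simp add: ennreal_leI)
      qed
    qed simp
    finally show ?thesis .
  qed
  have sqf: "sqint M (\<lambda>x. F n x - f x)" "(\<integral>x. (F n x - f x)\<^sup>2 \<partial>M) \<le> e"
    if n: "\<And>m. m \<ge> K \<Longrightarrow> (\<integral>x. (F n x - F m x)\<^sup>2 \<partial>M) \<le> e" and e: "0 \<le> e" for n K e
  proof -
    have fin: "(\<integral>\<^sup>+x. ennreal ((F n x - f x)\<^sup>2) \<partial>M) \<le> ennreal e" by (rule fatou[OF n])
    then have "integrable M (\<lambda>x. (F n x - f x)\<^sup>2)"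
      by (intro integrableI_nonneg) (auto simp: le_less_trans[OF _ ennreal_less_top])
    then show "sqint M (\<lambda>x. F n x - f x)" by (simp add: sqint_def)
    then have "ennreal (\<integral>x. (F n x - f x)\<^sup>2 \<partial>M) \<le> ennreal e"
      using fin by (subst (asm) nn_integral_eq_integral) (auto simp: sqint_def)
    then show "(\<integral>x. (F n x - f x)\<^sup>2 \<partial>M) \<le> e" using e by (simp add: ennreal_le_iff)
  qed
  have "(\<lambda>n. \<integral>x. (F n x - f x)\<^sup>2 \<partial>M) \<longlonglongrightarrow> 0"
  proof (rule LIMSEQ_I)
    fix e :: real assume e: "0 < e"
    then obtain K where K: "\<And>m n. m \<ge> K \<Longrightarrow> n \<ge> K \<Longrightarrow> (\<integral>x. (F m x - F n x)\<^sup>2 \<partial>M) < e / 2"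
      using cauchy[of "e / 2"] by auto
    have "(\<integral>x. (F n x - f x)\<^sup>2 \<partial>M) \<le> e / 2" if "n \<ge> K" for n
      by (rule sqf(2)[of K]) (use K[OF that] e in \<open>auto intro: less_imp_le\<close>)
    then have "norm ((\<integral>x. (F n x - f x)\<^sup>2 \<partial>M) - 0) < e" if "n \<ge> K" for n
      using that e by (force intro: le_less_trans[of _ "e / 2"])
    then show "\<exists>no. \<forall>n\<ge>no. norm ((\<integral>x. (F n x - f x)\<^sup>2 \<partial>M) - 0) < e" by blast
  qed
  moreover have "sqint M f"
  proof -
    \<comment> \<open>The tolerance 1 is (1/4)^0. Now \<open>f\<close> is the difference of
      \<open>F (N 0)\<close> and this function.\<close>
    have "sqint M (\<lambda>x. F (N 0) x - f x)"
      by (rule sqf(1)[of "N 0" _ 1]) (use N[of 0] in \<open>auto intro: less_imp_le\<close>)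
    from sqint_diff[OF F this, of "N 0"] show ?thesis by simp
  qed
  ultimately show ?thesis by blast
qed

section \<open>Isometries determined by Gram matrices\<close>

text \<open>
  The graph of the isometry \<open>e j \<mapsto> E j\<close> on finite linear combinations.  Working with the graph avoids
  having to show first that the map is well defined.
\<close>

inductive combination :: "'j set \<Rightarrow> ('j \<Rightarrow> 'v::real_vector) \<Rightarrow> ('j \<Rightarrow> 'a \<Rightarrow> real) \<Rightarrow> 'v \<Rightarrow> ('a \<Rightarrow> real) \<Rightarrow> bool"
  for J e E where
  zero: "combination J e E 0 (\<lambda>_. 0)"
| step: "combination J e E x F \<Longrightarrow> j \<in> J \<Longrightarrow> combination J e E (r *\<^sub>R e j + x) (\<lambda>\<omega>. r * E j \<omega> + F \<omega>)"

text \<open>Equal Gram matrices make e j \<mapsto> E j isometric on linear combinations;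
  completeness extends it to the closed span, and totality of the \<open>E j\<close> makes it onto.
  \<open>T\<close> picks one function per vector, so the conclusions are phrased by integrals. The
  third one characterizes \<open>T x\<close> up to null sets, and linearity can be derived from
  it.\<close>

lemma (in prob_space) gram_isometry:
  fixes e :: "'j \<Rightarrow> 'v::{real_inner, complete_space}" and E :: "'j \<Rightarrow> 'a \<Rightarrow> real"
  assumes E: "\<And>j. j \<in> J \<Longrightarrow> sqint M (E j)"
    and gram: "\<And>i j. i \<in> J \<Longrightarrow> j \<in> J \<Longrightarrow> (\<integral>x. E i x * E j x \<partial>M) = inner (e i) (e j)"
    and total: "\<And>g. sqint M g \<Longrightarrow> (\<And>j. j \<in> J \<Longrightarrow> (\<integral>x. g x * E j x \<partial>M) = 0) \<Longrightarrow> AE x in M. g x = 0"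
  obtains T :: "'v \<Rightarrow> 'a \<Rightarrow> real" where
    "\<And>x. x \<in> closure (span (e ` J)) \<Longrightarrow> sqint M (T x)"
    "\<And>x y. x \<in> closure (span (e ` J)) \<Longrightarrow> y \<in> closure (span (e ` J)) \<Longrightarrow>
      (\<integral>\<omega>. T x \<omega> * T y \<omega> \<partial>M) = inner x y"
    "\<And>x j. x \<in> closure (span (e ` J)) \<Longrightarrow> j \<in> J \<Longrightarrow> (\<integral>\<omega>. T x \<omega> * E j \<omega> \<partial>M) = inner x (e j)"
    "\<And>g. sqint M g \<Longrightarrow> \<exists>x\<in>closure (span (e ` J)). AE \<omega> in M. T x \<omega> = g \<omega>"
proof -
  define W where "W = closure (span (e ` J))"
  have W: "closed W" "subspace W" by (simp_all add: W_def subspace_closure)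
  have eW: "e j \<in> W" if "j \<in> J" for j
    using that closure_subset[of "span (e ` J)"] by (auto simp: W_def span_base)
  let ?S = "combination J e E"
  have S_sq: "sqint M F" if "?S x F" for x F
    using that
  proof induction
    case (step x F j r)
    show ?case by (intro sqint_add sqint_scale E step)
  qed (simp add: sqint_def)
  have S_E: "(\<integral>\<omega>. F \<omega> * E j \<omega> \<partial>M) = inner x (e j)" if "?S x F" "j \<in> J" for x F j
    using that
  proof induction
    case (step x F i r)
    then show ?case
      using sqint_mult[OF E E, of i j] sqint_mult[OF S_sq[OF step(1)] E, of j]
      by (simp add: distrib_right gram inner_add_left mult.assoc)
  qed simp
  have S_S: "(\<integral>\<omega>. F \<omega> * G \<omega> \<partial>M) = inner x y" if "?S y G" "?S x F" for x F y G
    using that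
  proof induction
    case (step y G j r)
    have "(\<integral>\<omega>. F \<omega> * (r * E j \<omega> + G \<omega>) \<partial>M) = (\<integral>\<omega>. r * (F \<omega> * E j \<omega>) + F \<omega> * G \<omega> \<partial>M)"
      by (intro Bochner_Integration.integral_cong) (auto simp: algebra_simps)
    also have "\<dots> = r * inner x (e j) + inner x y"
      using sqint_mult[OF S_sq[OF step(4)] E[OF step(2)]] sqint_mult[OF S_sq[OF step(4)] S_sq[OF step(1)]]
      by (simp add: S_E[OF step(4) step(2)] step.IH[OF step(4)])
    finally show ?case by (simp add: inner_add_right)
  qed simp
  have S_dist: "(\<integral>\<omega>. (F \<omega> - G \<omega>)\<^sup>2 \<partial>M) = (norm (x - y))\<^sup>2" if "?S x F" "?S y G" for x F y G
  proof -
    have "(\<integral>\<omega>. (F \<omega> - G \<omega>)\<^sup>2 \<partial>M) = (\<integral>\<omega>. F \<omega> * F \<omega> - 2 * (F \<omega> * G \<omega>) + G \<omega> * G \<omega> \<partial>M)"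
      by (intro Bochner_Integration.integral_cong) (auto simp: power2_eq_square algebra_simps)
    also have "\<dots> = inner x x - 2 * inner x y + inner y y"
      using sqint_mult[OF S_sq S_sq, OF that(1) that(1)] sqint_mult[OF S_sq S_sq, OF that]
        sqint_mult[OF S_sq S_sq, OF that(2) that(2)]
      by (simp add: S_S[OF that(1) that(1)] S_S[OF that(2) that(1)] S_S[OF that(2) that(2)])
    finally show ?thesis
      by (simp add: power2_norm_eq_inner inner_diff_left inner_diff_right inner_commute)
  qed
  have S_ex: "\<exists>F. ?S x F" if "x \<in> span (e ` J)" for x
    using that
  proof (induction x rule: span_induct_alt)
    case (step r z x)
    then show ?case by (auto intro: combination.step)
  qed (auto intro: combination.zero)
  \<comment> \<open>Closure of the graph: vectors and functions converge along a common sequence.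
    This is a relation, whose values are unique only up to null sets.\<close>
  define lim where "lim x f \<longleftrightarrow> sqint M f \<and> (\<exists>X F. (\<forall>n. ?S (X n) (F n)) \<and> X \<longlonglongrightarrow> x \<and>
    (\<lambda>n. \<integral>\<omega>. (F n \<omega> - f \<omega>)\<^sup>2 \<partial>M) \<longlonglongrightarrow> 0)" for x f
  have "\<exists>f. lim x f" if "x \<in> W" for x
  proof -
    obtain X where X: "\<And>n. X n \<in> span (e ` J)" "X \<longlonglongrightarrow> x"
      using \<open>x \<in> W\<close> by (auto simp: W_def closure_sequential)
    have "\<forall>n. \<exists>F. ?S (X n) F" using S_ex X(1) by blast
    then obtain F where F: "\<And>n. ?S (X n) (F n)" by metis
    have "Cauchy X" using X(2) by (rule LIMSEQ_imp_Cauchy)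
    have "\<exists>f. sqint M f \<and> (\<lambda>n. \<integral>\<omega>. (F n \<omega> - f \<omega>)\<^sup>2 \<partial>M) \<longlonglongrightarrow> 0"
    proof (rule L2_complete)
      fix \<epsilon> :: real assume "0 < \<epsilon>"
      then obtain K where K: "\<forall>m\<ge>K. \<forall>n\<ge>K. norm (X m - X n) < sqrt \<epsilon>"
        using CauchyD[OF \<open>Cauchy X\<close>, of "sqrt \<epsilon>"] by auto
      have "(norm (X m - X n))\<^sup>2 < \<epsilon>" if "m \<ge> K" "n \<ge> K" for m n
        using power_strict_mono[of "norm (X m - X n)" "sqrt \<epsilon>" 2] K that \<open>0 < \<epsilon>\<close> by simp
      then show "\<exists>N. \<forall>m\<ge>N. \<forall>n\<ge>N. (\<integral>\<omega>. (F m \<omega> - F n \<omega>)\<^sup>2 \<partial>M) < \<epsilon>"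
        unfolding S_dist[OF F F] by blast
    qed (rule S_sq[OF F])
    then show ?thesis unfolding lim_def using X F by blast
  qed
  then obtain T where T: "\<And>x. x \<in> W \<Longrightarrow> lim x (T x)" by metis
  have T_sq: "sqint M (T x)" if "x \<in> W" for x using T[OF that] by (simp add: lim_def)
  have lim_S: "(\<integral>\<omega>. f \<omega> * G \<omega> \<partial>M) = inner x y" if "lim x f" "?S y G" for x f y G
  proof -
    obtain X F where XF: "\<And>n. ?S (X n) (F n)" "X \<longlonglongrightarrow> x" "(\<lambda>n. \<integral>\<omega>. (F n \<omega> - f \<omega>)\<^sup>2 \<partial>M) \<longlonglongrightarrow> 0"
      and f: "sqint M f" using \<open>lim x f\<close> by (auto simp: lim_def)
    have "(\<lambda>n. \<integral>\<omega>. F n \<omega> * G \<omega> \<partial>M) \<longlonglongrightarrow> (\<integral>\<omega>. f \<omega> * G \<omega> \<partial>M)"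
      by (intro tendsto_integral_mult S_sq[OF XF(1)] f S_sq[OF that(2)] XF(3))
    moreover have "(\<lambda>n. inner (X n) y) \<longlonglongrightarrow> inner x y" by (intro tendsto_intros XF(2))
    ultimately show ?thesis
      using LIMSEQ_unique by (simp add: S_S[OF that(2) XF(1)])
  qed
  have lim_lim: "(\<integral>\<omega>. f \<omega> * g \<omega> \<partial>M) = inner x y" if "lim x f" "lim y g" for x f y g
  proof -
    obtain X F where XF: "\<And>n. ?S (X n) (F n)" "X \<longlonglongrightarrow> x" "(\<lambda>n. \<integral>\<omega>. (F n \<omega> - f \<omega>)\<^sup>2 \<partial>M) \<longlonglongrightarrow> 0"
      and f: "sqint M f" using \<open>lim x f\<close> by (auto simp: lim_def)
    have g: "sqint M g" using that(2) by (simp add: lim_def)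
    have "(\<lambda>n. \<integral>\<omega>. F n \<omega> * g \<omega> \<partial>M) \<longlonglongrightarrow> (\<integral>\<omega>. f \<omega> * g \<omega> \<partial>M)"
      by (intro tendsto_integral_mult S_sq[OF XF(1)] f g XF(3))
    moreover have "(\<integral>\<omega>. F n \<omega> * g \<omega> \<partial>M) = inner (X n) y" for n
      using lim_S[OF that(2) XF(1), of n] by (simp add: mult.commute inner_commute)
    moreover have "(\<lambda>n. inner (X n) y) \<longlonglongrightarrow> inner x y" by (intro tendsto_intros XF(2))
    ultimately show ?thesis using LIMSEQ_unique by simp
  qed
  have S_e: "?S (e j) (E j)" if "j \<in> J" for j
    using combination.step[OF combination.zero that, of e E 1] by simp
  have T_E: "(\<integral>\<omega>. T x \<omega> * E j \<omega> \<partial>M) = inner x (e j)" if "x \<in> W" "j \<in> J" for x j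
    by (rule lim_S[OF T[OF that(1)] S_e[OF that(2)]])
  have T_T: "(\<integral>\<omega>. T x \<omega> * T y \<omega> \<partial>M) = inner x y" if "x \<in> W" "y \<in> W" for x y
    by (rule lim_lim[OF T[OF that(1)] T[OF that(2)]])
  have surj: "\<exists>x\<in>W. AE \<omega> in M. T x \<omega> = g \<omega>" if g: "sqint M g" for g
  proof -
    \<comment> \<open>The preimage of \<open>g\<close> is the vector \<open>w\<close> that
      represents this functional: \<open>T w - g\<close> is then orthogonal to every
      \<open>E j\<close>.\<close>
    define \<phi> where "\<phi> x = (\<integral>\<omega>. T x \<omega> * g \<omega> \<partial>M)" for x
    note Tg = sqint_mult[OF T_sq g]
    \<comment> \<open>A function with the same integrals against the \<open>E j\<close> as
      \<open>T x\<close> may replace it. Applied to T x + T y and to r * T x, this yields linearity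
      of \<phi> although \<open>T\<close> is an arbitrary choice.\<close>
    have AE_eq: "(\<integral>\<omega>. h \<omega> * g \<omega> \<partial>M) = \<phi> x"
      if "x \<in> W" "sqint M h" "\<And>j. j \<in> J \<Longrightarrow> (\<integral>\<omega>. h \<omega> * E j \<omega> \<partial>M) = inner x (e j)" for x h
    proof -
      have "AE \<omega> in M. h \<omega> - T x \<omega> = 0"
      proof (rule total)
        show "sqint M (\<lambda>\<omega>. h \<omega> - T x \<omega>)" using that T_sq by (intro sqint_diff) auto
        show "(\<integral>\<omega>. (h \<omega> - T x \<omega>) * E j \<omega> \<partial>M) = 0" if "j \<in> J" for j
          using sqint_mult[OF \<open>sqint M h\<close> E[OF that]] sqint_mult[OF T_sq[OF \<open>x \<in> W\<close>] E[OF that]]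
          by (simp add: left_diff_distrib T_E[OF \<open>x \<in> W\<close> that]
              \<open>\<And>j. j \<in> J \<Longrightarrow> (\<integral>\<omega>. h \<omega> * E j \<omega> \<partial>M) = inner x (e j)\<close>[OF that])
      qed
      moreover have "(\<lambda>\<omega>. h \<omega> * g \<omega>) \<in> borel_measurable M" "(\<lambda>\<omega>. T x \<omega> * g \<omega>) \<in> borel_measurable M"
        using sqint_mult[OF \<open>sqint M h\<close> g] Tg[OF \<open>x \<in> W\<close>] by auto
      ultimately show ?thesis unfolding \<phi>_def by (intro integral_cong_AE) (auto elim: eventually_mono)
    qed
    have "\<exists>w\<in>W. \<forall>x\<in>W. \<phi> x = inner w x"
    proof (rule riesz_on_closed_subspace[OF W])
      fix x y assume xy: "x \<in> W" "y \<in> W"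
      have "(\<integral>\<omega>. (T x \<omega> + T y \<omega>) * g \<omega> \<partial>M) = \<phi> (x + y)"
      proof (rule AE_eq)
        show "x + y \<in> W" using xy W(2) by (simp add: subspace_add)
        show "sqint M (\<lambda>\<omega>. T x \<omega> + T y \<omega>)" using xy T_sq by (intro sqint_add) auto
        show "(\<integral>\<omega>. (T x \<omega> + T y \<omega>) * E j \<omega> \<partial>M) = inner (x + y) (e j)" if "j \<in> J" for j
          using that xy sqint_mult[OF T_sq E] by (simp add: distrib_right T_E inner_add_left)
      qed
      then show "\<phi> (x + y) = \<phi> x + \<phi> y" using xy Tg by (simp add: \<phi>_def distrib_right)
    next
      fix r x assume x: "x \<in> W"
      have "(\<integral>\<omega>. (r * T x \<omega>) * g \<omega> \<partial>M) = \<phi> (r *\<^sub>R x)"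
      proof (rule AE_eq)
        show "r *\<^sub>R x \<in> W" using x W(2) by (simp add: subspace_scale)
        show "sqint M (\<lambda>\<omega>. r * T x \<omega>)" using x T_sq by (intro sqint_scale) auto
        show "(\<integral>\<omega>. (r * T x \<omega>) * E j \<omega> \<partial>M) = inner (r *\<^sub>R x) (e j)" if "j \<in> J" for j
          using that x by (simp add: T_E mult.assoc)
      qed
      then show "\<phi> (r *\<^sub>R x) = r * \<phi> x" by (simp add: \<phi>_def mult.assoc)
    next
      fix x assume x: "x \<in> W"
      show "\<bar>\<phi> x\<bar> \<le> sqrt (\<integral>\<omega>. (g \<omega>)\<^sup>2 \<partial>M) * norm x"
        using Cauchy_Schwarz_integral[OF T_sq[OF x] g] T_T[OF x x]
        by (simp add: \<phi>_def power2_eq_square norm_eq_sqrt_inner mult.commute)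
    qed
    then obtain w where w: "w \<in> W" "\<And>x. x \<in> W \<Longrightarrow> \<phi> x = inner w x" by blast
    have "AE \<omega> in M. T w \<omega> - g \<omega> = 0"
    proof (rule total)
      show "sqint M (\<lambda>\<omega>. T w \<omega> - g \<omega>)" by (intro sqint_diff T_sq w g)
      fix j assume j: "j \<in> J"
      have "(\<integral>\<omega>. E j \<omega> * g \<omega> \<partial>M) = \<phi> (e j)"
        using j by (intro AE_eq eW E gram)
      then have "(\<integral>\<omega>. g \<omega> * E j \<omega> \<partial>M) = inner w (e j)"
        using w(2)[OF eW[OF j]] by (simp add: mult.commute)
      then show "(\<integral>\<omega>. (T w \<omega> - g \<omega>) * E j \<omega> \<partial>M) = 0"
        using sqint_mult[OF T_sq[OF w(1)] E[OF j]] sqint_mult[OF g E[OF j]] T_E[OF w(1) j]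
        by (simp add: left_diff_distrib)
    qed
    then show ?thesis using w(1) by (intro bexI[of _ w]) (auto elim: eventually_mono)
  qed
  show ?thesis
    by (rule that[of T]) (use T_sq T_T T_E surj in \<open>auto simp: W_def[symmetric]\<close>)
qed

section \<open>Uniqueness of Fourier transforms on a separable normed space\<close>

text \<open>The positive and negative parts of \<open>a\<close>, divided by their common mass, are
  densities under which \<open>X\<close> has the same characteristic function, so Levy's theorem
  identifies the two laws of \<open>X\<close>.\<close>

lemma integral_indicator_eq_0_if_fourier_eq_0:
  fixes a X :: "'a \<Rightarrow> real"
  assumes a: "integrable M a" and X [measurable]: "X \<in> borel_measurable M"
    and zero: "\<And>t. (\<integral>x. a x *\<^sub>R iexp (t * X x) \<partial>M) = 0"
    and S [measurable]: "S \<in> sets borel"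
  shows "(\<integral>x. a x * indicator S (X x) \<partial>M) = 0"
proof -
  define p q where "p = (\<lambda>x. max 0 (a x))" "q = (\<lambda>x. max 0 (- a x))"
  have a_pq: "a x = p x - q x" for x by (auto simp: p_q_def max_def)
  have [measurable]: "a \<in> borel_measurable M" using a by simp
  have p: "integrable M p" "\<And>x. 0 \<le> p x" and q: "integrable M q" "\<And>x. 0 \<le> q x"
    using a by (simp_all add: p_q_def)
  have [measurable]: "p \<in> borel_measurable M" "q \<in> borel_measurable M" using p q by simp_all
  define c where "c = (\<integral>x. p x \<partial>M)"
  \<comment> \<open>The case t = 0 shows that both parts have the same mass
    \<open>c\<close>.\<close>
  have "(\<integral>x. complex_of_real (a x) \<partial>M) = 0" using zero[of 0] by (simp add: scaleR_conv_of_real)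
  then have "(\<integral>x. a x \<partial>M) = 0" by (simp only: integral_complex_of_real of_real_eq_0_iff)
  then have c_q: "c = (\<integral>x. q x \<partial>M)" using p q by (simp add: a_pq c_def)
  show ?thesis
  proof (cases "c = 0")
    \<comment> \<open>Mass 0 cannot be normalized, but then \<open>a\<close> vanishes almost
      everywhere.\<close>
    case True
    have "AE x in M. p x = 0" "AE x in M. q x = 0"
      using True integral_nonneg_eq_0_iff_AE[of M p] integral_nonneg_eq_0_iff_AE[of M q] p q
      by (simp_all add: c_def c_q[unfolded True, symmetric])
    then have "AE x in M. a x * indicator S (X x) = 0" by eventually_elim (simp add: a_pq)
    then show ?thesis by (simp add: integral_eq_zero_AE)
  next
    case False
    then have c: "c > 0" using p by (simp add: c_def less_le integral_nonneg)
    define N where "N h = distr (density M (\<lambda>x. ennreal (h x / c))) borel X" for h :: "'a \<Rightarrow> real"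
    have N_real: "real_distribution (N h)"
      if h: "integrable M h" "\<And>x. 0 \<le> h x" "c = (\<integral>x. h x \<partial>M)" for h
    proof -
      have [measurable]: "h \<in> borel_measurable M" using h by simp
      have "(\<integral>\<^sup>+x. ennreal (h x / c) \<partial>M) = ennreal (\<integral>x. h x / c \<partial>M)"
        using h c by (intro nn_integral_eq_integral) auto
      also have "\<dots> = 1" using h(3) c by simp
      finally have "prob_space (density M (\<lambda>x. ennreal (h x / c)))"
        by (intro prob_spaceI) (simp add: emeasure_density cong: nn_integral_cong)
      then have "prob_space (N h)" unfolding N_def by (rule prob_space.prob_space_distr) simp
      then show ?thesis by (simp add: real_distribution_def real_distribution_axioms_def N_def)
    qed
    have int_N: "(\<integral>y. f y \<partial>N h) = (\<integral>x. (h x / c) *\<^sub>R f (X x) \<partial>M)"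
      if h: "integrable M h" "\<And>x. 0 \<le> h x" and f: "f \<in> borel_measurable borel"
      for h and f :: "real \<Rightarrow> 'z::{banach, second_countable_topology}"
    proof -
      have [measurable]: "h \<in> borel_measurable M" using h by simp
      have "(\<integral>y. f y \<partial>N h) = (\<integral>x. f (X x) \<partial>density M (\<lambda>x. ennreal (h x / c)))"
        unfolding N_def using f by (intro integral_distr) auto
      also have "\<dots> = (\<integral>x. (h x / c) *\<^sub>R f (X x) \<partial>M)"
        using h c measurable_compose[OF X f] by (intro integral_density) auto
      finally show ?thesis .
    qed
    have "char (N p) = char (N q)"
    proof
      fix t
      have int: "integrable M (\<lambda>x. h x *\<^sub>R iexp (t * X x))" if "integrable M h" for h :: "'a \<Rightarrow> real"
        by (rule Bochner_Integration.integrable_bound[OF that])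
          (use that borel_measurable_integrable[OF that] in \<open>auto simp: norm_mult\<close>)
      have "(\<integral>x. p x *\<^sub>R iexp (t * X x) \<partial>M) - (\<integral>x. q x *\<^sub>R iexp (t * X x) \<partial>M) = 0"
        using zero[of t] int[OF p(1)] int[OF q(1)] by (simp add: a_pq scaleR_diff_left)
      then have "(1 / c) *\<^sub>R (\<integral>x. p x *\<^sub>R iexp (t * X x) \<partial>M) = (1 / c) *\<^sub>R (\<integral>x. q x *\<^sub>R iexp (t * X x) \<partial>M)"
        by simp
      then have "(\<integral>x. (p x / c) *\<^sub>R iexp (t * X x) \<partial>M) = (\<integral>x. (q x / c) *\<^sub>R iexp (t * X x) \<partial>M)"
        unfolding integral_scaleR_right[symmetric] by simp
      then show "char (N p) t = char (N q) t"
        unfolding char_def by (subst (1 2) int_N) (use p q in auto)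
    qed
    then have eq: "N p = N q"
      using p q c_q by (intro Levy_uniqueness N_real) (auto simp: c_def)
    have "(\<integral>x. (p x / c) *\<^sub>R indicator S (X x) \<partial>M) = (\<integral>x. (q x / c) *\<^sub>R (indicator S (X x) :: real) \<partial>M)"
      using int_N[OF p, of "indicator S :: real \<Rightarrow> real"] int_N[OF q, of "indicator S :: real \<Rightarrow> real"] eq
      by simp
    then have "(\<integral>x. p x * indicator S (X x) \<partial>M) = (\<integral>x. q x * indicator S (X x) \<partial>M)"
      using c by (simp add: field_simps)
    moreover have "integrable M (\<lambda>x. h x * indicator S (X x))" if "integrable M h" for h :: "'a \<Rightarrow> real"
      by (rule Bochner_Integration.integrable_bound[OF that])
        (use that borel_measurable_integrable[OF that] in \<open>auto simp: indicator_def\<close>)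
    ultimately show ?thesis using p q by (simp add: a_pq left_diff_distrib)
  qed
qed

lemma AE_eq_0_if_set_integrals_eq_0:
  fixes g :: "'a \<Rightarrow> real"
  assumes g: "integrable M g" and zero: "\<And>A. A \<in> sets M \<Longrightarrow> (\<integral>x. indicator A x * g x \<partial>M) = 0"
  shows "AE x in M. g x = 0"
proof -
  have [measurable]: "g \<in> borel_measurable M" using g by simp
  define P Q where "P = {x \<in> space M. g x > 0}" "Q = {x \<in> space M. g x < 0}"
  have [measurable]: "P \<in> sets M" "Q \<in> sets M" by (simp_all add: P_Q_def)
  have int: "integrable M (\<lambda>x. indicator P x * g x)" "integrable M (\<lambda>x. - (indicator Q x * g x))"
    using g integrable_mult_indicator[of _ M g] by simp_all
  have "AE x in M. indicator P x * g x = 0"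
    using int zero[of P] by (subst integral_nonneg_eq_0_iff_AE[symmetric]) (auto simp: P_Q_def indicator_def)
  moreover have "AE x in M. - (indicator Q x * g x) = 0"
    using int zero[of Q] by (subst integral_nonneg_eq_0_iff_AE[symmetric]) (auto simp: P_Q_def indicator_def)
  ultimately show ?thesis
    using AE_space by eventually_elim (auto simp: P_Q_def indicator_def split: if_splits)
qed

text \<open>Constraints are added one at a time, so that an induction over cylinders meets a single
  new functional per step, as the one-dimensional theorem requires.\<close>

inductive_set cylinders :: "'b::real_normed_vector set set" where
  UNIV: "UNIV \<in> cylinders"
| Int: "A \<in> cylinders \<Longrightarrow> S \<in> sets borel \<Longrightarrow> A \<inter> blinfun_apply (f :: 'b \<Rightarrow>\<^sub>L real) -` S \<in> cylinders"

lemma Int_stable_cylinders: "Int_stable (cylinders :: 'b::real_normed_vector set set)"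
proof (rule Int_stableI)
  fix A B :: "'b set" assume "A \<in> cylinders" "B \<in> cylinders"
  from this(2) this(1) show "A \<inter> B \<in> cylinders"
  proof induction
    case (Int B S f)
    then show ?case using cylinders.Int[of "A \<inter> B" S f] by (simp add: Int_assoc)
  qed simp
qed

lemma sets_borel_eq_sigma_cylinders:
  "sets (borel :: 'b::{real_normed_vector, second_countable_topology} measure) = sigma_sets UNIV cylinders"
proof
  have "{blinfun_apply f -` S | (f :: 'b \<Rightarrow>\<^sub>L real) S. S \<in> sets borel} \<subseteq> cylinders"
    using cylinders.Int[OF cylinders.UNIV] by auto
  then show "sets (borel :: 'b measure) \<subseteq> sigma_sets UNIV cylinders"
    unfolding sets_borel_eq_sigma_functionals[where 'b = 'b] by (rule sigma_sets_mono')
next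
  have "A \<in> sets borel" if "A \<in> cylinders" for A :: "'b set"
    using that
  proof induction
    case (Int A S f)
    have "blinfun_apply f -` S \<in> sets borel"
      unfolding sets_borel_eq_sigma_functionals[where 'b = 'b] using Int(2) by (intro sigma_sets.Basic) blast
    with Int show ?case by blast
  qed simp
  then show "sigma_sets UNIV cylinders \<subseteq> sets (borel :: 'b measure)"
    using sets.sigma_sets_subset[of cylinders "borel :: 'b measure"] by auto
qed

text \<open>Multiplying \<open>iexp a\<close> by the cosine or sine of \<open>b\<close> only shifts
  its argument. With functionals for \<open>a\<close> and \<open>b\<close>, the shifted arguments
  are again functionals, to which an induction hypothesis about all functionals applies.\<close>

lemma iexp_cos_eq: "cos b *\<^sub>R iexp a = (1/2) * (iexp (a + b) + iexp (a - b))"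
  and iexp_sin_eq: "sin b *\<^sub>R iexp a = (1/(2*\<i>)) * (iexp (a + b) - iexp (a - b))"
  by (simp_all add: complex_eq_iff Re_exp Im_exp cos_add cos_diff sin_add sin_diff Re_divide Im_divide
      power2_eq_square mult.commute)

text \<open>
  The one-dimensional uniqueness theorem is applied to one functional at a time: vanishing of all
  Fourier integrals survives restriction to a cylinder.
\<close>

lemma AE_eq_0_if_fourier_eq_0:
  fixes M :: "'b::{real_normed_vector, second_countable_topology} measure" and g :: "'b \<Rightarrow> real"
  assumes M [measurable_cong]: "sets M = sets borel" and g: "integrable M g"
    and zero: "\<And>f :: 'b \<Rightarrow>\<^sub>L real. (\<integral>x. g x *\<^sub>R iexp (blinfun_apply f x) \<partial>M) = 0"
  shows "AE x in M. g x = 0"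
proof -
  have f_meas [measurable]: "blinfun_apply f \<in> borel_measurable M" for f :: "'b \<Rightarrow>\<^sub>L real"
    by (rule borel_measurable_blinfun_apply[OF M])
  have g_meas [measurable]: "g \<in> borel_measurable M" using g by simp
  have cyl_M [measurable]: "A \<in> sets M" if "A \<in> cylinders" for A
    unfolding M sets_borel_eq_sigma_cylinders using that by (rule sigma_sets.Basic)
  have cyl: "(\<integral>x. (indicator A x * g x) *\<^sub>R iexp (blinfun_apply f x) \<partial>M) = 0"
    if "A \<in> cylinders" for A and f :: "'b \<Rightarrow>\<^sub>L real"
    using that
  \<comment> \<open>All functionals at once, because the step applies the hypothesis to
    \<open>t *\<^sub>R f1 + f\<close> and \<open>t *\<^sub>R f1 - f\<close>.\<close>
  proof (induction arbitrary: f)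
    case UNIV
    then show ?case by (simp add: zero)
  next
    case (Int A S f1)
    note [measurable] = cyl_M[OF Int(1)] Int(2)
    have Ag: "integrable M (\<lambda>x. indicator A x * g x)"
      using integrable_mult_indicator[OF cyl_M[OF Int(1)] g] by simp
    have int: "integrable M (\<lambda>x. (indicator A x * g x) *\<^sub>R iexp (blinfun_apply h x))" for h :: "'b \<Rightarrow>\<^sub>L real"
      by (rule Bochner_Integration.integrable_bound[OF Ag]) (auto simp: norm_mult)
    \<comment> \<open>The one-dimensional lemma takes a real weight, so the complex factor is split
      into cosine and sine.\<close>
    define u v where "u = (\<lambda>x. indicator A x * g x * cos (blinfun_apply f x))"
      "v = (\<lambda>x. indicator A x * g x * sin (blinfun_apply f x))"
    have [measurable]: "u \<in> borel_measurable M" "v \<in> borel_measurable M"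
      unfolding u_v_def by measurable
    have uv: "integrable M u" "integrable M v"
      by (rule Bochner_Integration.integrable_bound[OF Ag]; auto simp: u_v_def abs_mult mult_left_le)+
    have fourier: "(\<integral>x. u x *\<^sub>R iexp (t * blinfun_apply f1 x) \<partial>M) = 0"
      "(\<integral>x. v x *\<^sub>R iexp (t * blinfun_apply f1 x) \<partial>M) = 0" for t
    proof -
      let ?p = "\<lambda>x. (indicator A x * g x) *\<^sub>R iexp (blinfun_apply (t *\<^sub>R f1 + f) x)"
      let ?m = "\<lambda>x. (indicator A x * g x) *\<^sub>R iexp (blinfun_apply (t *\<^sub>R f1 - f) x)"
      have "u x *\<^sub>R iexp (t * blinfun_apply f1 x) = (1/2) * (?p x + ?m x)"
        "v x *\<^sub>R iexp (t * blinfun_apply f1 x) = (1/(2*\<i>)) * (?p x - ?m x)" for x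
        unfolding u_v_def blinfun.add_left blinfun.diff_left blinfun.scaleR_left real_scaleR_def
          scaleR_scaleR[symmetric] iexp_cos_eq iexp_sin_eq
          scaleR_scaleR[of "indicator A x * g x" "cos (blinfun_apply f x)", symmetric]
        by (simp_all add: algebra_simps scaleR_conv_of_real)
      then have "(\<integral>x. u x *\<^sub>R iexp (t * blinfun_apply f1 x) \<partial>M) = (1/2) * ((\<integral>x. ?p x \<partial>M) + (\<integral>x. ?m x \<partial>M))"
        "(\<integral>x. v x *\<^sub>R iexp (t * blinfun_apply f1 x) \<partial>M) = (1/(2*\<i>)) * ((\<integral>x. ?p x \<partial>M) - (\<integral>x. ?m x \<partial>M))"
        using int by (simp_all only: integral_mult_right_zero Bochner_Integration.integral_add
            Bochner_Integration.integral_diff)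
      then show "(\<integral>x. u x *\<^sub>R iexp (t * blinfun_apply f1 x) \<partial>M) = 0"
        "(\<integral>x. v x *\<^sub>R iexp (t * blinfun_apply f1 x) \<partial>M) = 0"
        using Int.IH by simp_all
    qed
    have uv0: "(\<integral>x. u x * indicator S (blinfun_apply f1 x) \<partial>M) = 0"
      "(\<integral>x. v x * indicator S (blinfun_apply f1 x) \<partial>M) = 0"
      by (intro integral_indicator_eq_0_if_fourier_eq_0 uv f_meas fourier Int(2))+
    have uvS: "integrable M (\<lambda>x. complex_of_real (h x * indicator S (blinfun_apply f1 x)))"
      if "integrable M h" for h :: "'b \<Rightarrow> real"
      unfolding complex_of_real_integrable_eq
      by (rule Bochner_Integration.integrable_bound[OF that])
        (use that borel_measurable_integrable[OF that] in \<open>auto simp: indicator_def\<close>)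
    have "(indicator (A \<inter> blinfun_apply f1 -` S) x * g x) *\<^sub>R iexp (blinfun_apply f x) =
        complex_of_real (u x * indicator S (blinfun_apply f1 x)) +
        \<i> * complex_of_real (v x * indicator S (blinfun_apply f1 x))" for x
      by (auto simp: u_v_def complex_eq_iff Re_exp Im_exp indicator_def)
    then have "(\<integral>x. (indicator (A \<inter> blinfun_apply f1 -` S) x * g x) *\<^sub>R iexp (blinfun_apply f x) \<partial>M) =
        (\<integral>x. complex_of_real (u x * indicator S (blinfun_apply f1 x)) \<partial>M) +
        \<i> * (\<integral>x. complex_of_real (v x * indicator S (blinfun_apply f1 x)) \<partial>M)"
      using uvS[OF uv(1)] uvS[OF uv(2)] by simp
    then show ?case unfolding integral_complex_of_real uv0 by simp
  qed
  have int_A: "integrable M (\<lambda>x. indicator A x * g x)" if "A \<in> sets M" for A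
    using integrable_mult_indicator[OF that g] by simp
  have cyl_0: "(\<integral>x. indicator A x * g x \<partial>M) = 0" if "A \<in> cylinders" for A
  proof -
    have "(\<integral>x. complex_of_real (indicator A x * g x) \<partial>M) = 0"
      using cyl[OF that, of 0] by (simp add: scaleR_conv_of_real)
    then show ?thesis by (simp only: integral_complex_of_real of_real_eq_0_iff)
  qed
  \<comment> \<open>Dynkin's theorem: the sets over which \<open>g\<close> integrates to 0 are
    closed under complements, \<open>UNIV\<close> being a cylinder, and under disjoint countable
    unions.\<close>
  have "(\<integral>x. indicator A x * g x \<partial>M) = 0" if "A \<in> sigma_sets UNIV cylinders" for A
    using Int_stable_cylinders _ that
  proof (rule sigma_sets_induct_disjoint)
    fix A :: "'b set" assume "A \<in> cylinders"
    then show "(\<integral>x. indicator A x * g x \<partial>M) = 0" by (rule cyl_0)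
  next
    fix A :: "'b set" assume A: "A \<in> sigma_sets UNIV cylinders" "(\<integral>x. indicator A x * g x \<partial>M) = 0"
    then have "A \<in> sets M" by (simp add: M sets_borel_eq_sigma_cylinders)
    have "(\<integral>x. indicator (UNIV - A) x * g x \<partial>M) = (\<integral>x. g x - indicator A x * g x \<partial>M)"
      by (intro Bochner_Integration.integral_cong) (auto simp: indicator_def)
    also have "\<dots> = 0" using g int_A[OF \<open>A \<in> sets M\<close>] A(2) cyl_0[OF cylinders.UNIV] by simp
    finally show "(\<integral>x. indicator (UNIV - A) x * g x \<partial>M) = 0" .
  next
    fix A :: "nat \<Rightarrow> 'b set"
    assume A: "disjoint_family A" "range A \<subseteq> sigma_sets UNIV cylinders"
      "\<And>i. (\<integral>x. indicator (A i) x * g x \<partial>M) = 0"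
    then have AM: "A i \<in> sets M" for i by (auto simp: M sets_borel_eq_sigma_cylinders)
    have "(\<Union>i. A i) \<in> sets M" using AM by auto
    have "set_lebesgue_integral M (\<Union>i. A i) g = (\<Sum>i. set_lebesgue_integral M (A i) g)"
      by (rule lebesgue_integral_countable_add)
        (use A(1) AM int_A[OF \<open>(\<Union>i. A i) \<in> sets M\<close>] in \<open>auto simp: set_integrable_def disjoint_family_on_def\<close>)
    then show "(\<integral>x. indicator (\<Union>i. A i) x * g x \<partial>M) = 0"
      using A(3) by (simp add: set_lebesgue_integral_def)
  qed auto
  then show ?thesis
    by (intro AE_eq_0_if_set_integrals_eq_0 g) (simp add: M sets_borel_eq_sigma_cylinders)
qed

section \<open>Exponential vectors\<close>

instance completion :: (real_inner) banach ..

text \<open>Once the lower coefficients vanish, the series divided by t^n is 0 for t \<noteq> 0 and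
  tends to \<open>c n\<close> as t goes to 0.\<close>

lemma powser_coeffs_eq_0:
  fixes c :: "nat \<Rightarrow> real"
  assumes "\<And>t. (\<lambda>n. c n * t ^ n) sums 0"
  shows "c n = 0"
proof (induction n rule: less_induct)
  case (less n)
  have "(\<lambda>k. c (k + n) * t ^ k) sums 0" if t: "t \<noteq> 0" for t
  proof -
    have "(\<lambda>k. c (k + n) * t ^ (k + n)) sums (0 - (\<Sum>k<n. c k * t ^ k))"
      using assms[of t] by (rule sums_split_initial_segment)
    then have "(\<lambda>k. c (k + n) * t ^ (k + n) / t ^ n) sums (0 / t ^ n)"
      using less by (intro sums_divide) simp
    then show ?thesis using t by (simp add: power_add)
  qed
  then have "((\<lambda>_. 0) \<longlongrightarrow> c (0 + n)) (at (0 :: real))"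
    by (intro powser_limit_0_strong[of 1]) auto
  moreover have "((\<lambda>_. 0) \<longlongrightarrow> (0 :: real)) (at (0 :: real))" by (rule tendsto_const)
  ultimately have "c (0 + n) = 0" by (rule tendsto_unique[OF trivial_limit_at])
  then show ?case by simp
qed

definition fock_inj :: "nat \<Rightarrow> 'a::real_inner tensor \<Rightarrow> 'a fock" where
  "fock_inj n x = to_completion (fock_single n x)"

definition tensor_pow :: "'a::real_inner \<Rightarrow> nat \<Rightarrow> 'a tensor" where
  "tensor_pow v n = tensor (replicate n v)"

lemma inner_fock_inj:
  "inner (fock_inj n x) (fock_inj m y) = (if n = m then fact n * inner x y else 0)"
proof -
  have "inner (fock_single n x) (fock_single m y) =
      (\<Sum>k\<in>{n}. fact k * inner (fock_component (fock_single n x) k) (fock_component (fock_single m y) k))"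
    by (rule inner_fock_alg_eq) (auto simp: fock_single.rep_eq)
  then show ?thesis by (simp add: fock_inj_def fock_single.rep_eq)
qed

lemma bounded_linear_fock_inj: "bounded_linear (fock_inj n)"
proof (rule bounded_linear_intro)
  show "fock_inj n (x + y) = fock_inj n x + fock_inj n y" for x y :: "'a tensor"
    by (simp add: fock_inj_def fock_component_inject[symmetric] fock_single.rep_eq
        plus_fock_alg.rep_eq fun_eq_iff flip: to_completion_add)
      (rule arg_cong[of _ _ to_completion],
        simp add: fock_component_inject[symmetric] fock_single.rep_eq plus_fock_alg.rep_eq fun_eq_iff)
  show "fock_inj n (r *\<^sub>R x) = r *\<^sub>R fock_inj n x" for r and x :: "'a tensor"
    unfolding fock_inj_def to_completion_scaleR[symmetric]
    by (rule arg_cong[of _ _ to_completion])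
      (simp add: fock_component_inject[symmetric] fock_single.rep_eq scaleR_fock_alg.rep_eq fun_eq_iff)
  show "norm (fock_inj n x) \<le> norm x * sqrt (fact n)" for x :: "'a tensor"
    by (simp add: norm_eq_sqrt_inner[of "fock_inj n x"] inner_fock_inj norm_eq_sqrt_inner[of x]
        real_sqrt_mult)
qed

lemma inner_tensor_pow: "inner (tensor_pow v n) (tensor_pow w n) = inner v w ^ n"
  by (simp add: tensor_pow_def inner_tensor)

lemma norm_tensor_pow: "norm (tensor_pow v n) = norm v ^ n"
  by (simp only: norm_eq_sqrt_inner inner_tensor_pow real_sqrt_power)

text \<open>With a = norm v these are the norms of the terms of \<open>exp_vector v\<close>: the
  factor 1/n! meets the norm sqrt(n!) of the n-th inclusion.\<close>

lemma summable_power_over_sqrt_fact: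
  fixes a :: real
  assumes "0 \<le> a"
  shows "summable (\<lambda>n. a ^ n / sqrt (fact n))"
\<comment> \<open>From n \<ge> 4 a^2 on, the ratio a / sqrt(n + 1) is at most 1/2.\<close>
proof (rule summable_ratio_test[where c = "1/2" and N = "nat \<lceil>4 * a\<^sup>2\<rceil>"])
  fix n assume "nat \<lceil>4 * a\<^sup>2\<rceil> \<le> n"
  then have "4 * a\<^sup>2 \<le> real (Suc n)" by linarith
  then have "sqrt (4 * a\<^sup>2) \<le> sqrt (real (Suc n))" by (rule real_sqrt_le_mono)
  then have le: "2 * a \<le> sqrt (real (Suc n))" using assms by (simp add: real_sqrt_mult)
  have "a ^ Suc n / sqrt (fact (Suc n)) = (a / sqrt (real (Suc n))) * (a ^ n / sqrt (fact n))"
    by (simp add: real_sqrt_mult)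
  also have "\<dots> \<le> 1/2 * (a ^ n / sqrt (fact n))"
    using le assms by (intro mult_right_mono) (auto simp: field_simps)
  finally show "norm (a ^ Suc n / sqrt (fact (Suc n))) \<le> 1/2 * norm (a ^ n / sqrt (fact n))"
    using assms by simp
qed simp

lemma exp_vector_sums:
  "(\<lambda>n. (1 / fact n) *\<^sub>R fock_inj n (tensor_pow v n)) sums exp_vector v"
proof -
  have "norm ((1 / fact n) *\<^sub>R fock_inj n (tensor_pow v n)) = norm v ^ n / sqrt (fact n)" for n
  proof -
    have "norm (fock_inj n (tensor_pow v n)) = sqrt (fact n) * norm v ^ n"
      by (simp add: norm_eq_sqrt_inner[of "fock_inj n _"] inner_fock_inj real_sqrt_mult
          norm_tensor_pow flip: norm_eq_sqrt_inner)
    then show ?thesis by (simp add: field_simps)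
  qed
  then have "summable (\<lambda>n. norm ((1 / fact n) *\<^sub>R fock_inj n (tensor_pow v n)))"
    using summable_power_over_sqrt_fact[of "norm v"] by simp
  from summable_sums[OF summable_norm_cancel[OF this]]
  show ?thesis by (simp add: exp_vector_def fock_inj_def tensor_pow_def)
qed

lemma inner_exp_vector_sums:
  "(\<lambda>n. inner y (fock_inj n (tensor_pow v n)) / fact n) sums inner y (exp_vector v)"
proof -
  have "(\<lambda>n. inner y ((1 / fact n) *\<^sub>R fock_inj n (tensor_pow v n))) sums inner y (exp_vector v)"
    by (rule bounded_linear.sums[OF bounded_linear_inner_right exp_vector_sums])
  then show ?thesis by (simp only: inner_scaleR_right times_divide_eq_left mult_1_left)
qed

text \<open>Degrees are orthogonal, and the weight n! cancels the coefficient 1/n!.\<close>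

lemma inner_fock_inj_exp_vector: "inner (fock_inj n x) (exp_vector v) = inner x (tensor_pow v n)"
proof -
  have "(\<lambda>m. inner (fock_inj n x) (fock_inj m (tensor_pow v m)) / fact m) =
      (\<lambda>m. if m = n then inner x (tensor_pow v n) else 0)"
    by (auto simp: inner_fock_inj fun_eq_iff)
  then show ?thesis
    using inner_exp_vector_sums[of "fock_inj n x" v] sums_single[of n "\<lambda>_. inner x (tensor_pow v n)"]
    by (auto intro: sums_unique2)
qed

lemma inner_exp_vector: "inner (exp_vector v) (exp_vector w) = exp (inner v w)"
proof -
  have "(\<lambda>n. inner (exp_vector w) (fock_inj n (tensor_pow v n)) / fact n) =
      (\<lambda>n. inner v w ^ n /\<^sub>R fact n)"
    by (simp add: fun_eq_iff inner_commute[of "exp_vector w"] inner_fock_inj_exp_vector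
        inner_tensor_pow divide_inverse mult.commute)
  then have "inner (exp_vector w) (exp_vector v) = exp (inner v w)"
    using inner_exp_vector_sums[of "exp_vector w" v] exp_converges[of "inner v w"]
    by (auto intro: sums_unique2)
  then show ?thesis by (simp add: inner_commute)
qed

section \<open>Symmetric tensor powers and polarization\<close>

lemma bounded_linear_tensor_perm:
  assumes "\<pi> permutes {..<n}"
  shows "bounded_linear (tensor_perm n \<pi> :: 'a::real_inner tensor \<Rightarrow> 'a tensor)"
    and tensor_perm_tensor: "(tensor_perm n \<pi> :: 'a tensor \<Rightarrow> 'a tensor) (tensor vs) = tensor (list_perm n \<pi> vs)"
proof -
  have "bounded_linear (tensor_perm n \<pi> :: 'a tensor \<Rightarrow> 'a tensor) \<and>
      (\<forall>vs. (tensor_perm n \<pi> :: 'a tensor \<Rightarrow> 'a tensor) (tensor vs) = tensor (list_perm n \<pi> vs))"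
    unfolding tensor_perm_def by (rule theI'[OF tensor_perm_ex1[OF assms]])
  then show "bounded_linear (tensor_perm n \<pi> :: 'a tensor \<Rightarrow> 'a tensor)"
    and "(tensor_perm n \<pi> :: 'a tensor \<Rightarrow> 'a tensor) (tensor vs) = tensor (list_perm n \<pi> vs)" by blast+
qed

lemma subspace_sym_tensor_power: "subspace (sym_tensor_power K n)"
proof -
  have T: "subspace (tensor_power K n)"
    unfolding tensor_power_def by (intro subspace_closure subspace_span)
  show ?thesis
    unfolding sym_tensor_power_def
  proof (rule subspaceI)
    show "0 \<in> {x \<in> tensor_power K n. \<forall>\<pi>. \<pi> permutes {..<n} \<longrightarrow> tensor_perm n \<pi> x = x}"
      using T by (auto simp: subspace_0 linear_simps(3)[OF bounded_linear_tensor_perm(1)])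
  qed (use T in \<open>auto simp: subspace_add subspace_scale
      linear_simps(1,5)[OF bounded_linear_tensor_perm(1)]\<close>)
qed

lemma tensor_pow_in_sym_tensor_power:
  assumes "v \<in> K"
  shows "tensor_pow v n \<in> sym_tensor_power K n"
proof -
  have "tensor_pow v n \<in> {tensor vs | vs. set vs \<subseteq> K \<and> length vs = n}"
    using assms by (auto simp: tensor_pow_def intro!: exI[of _ "replicate n v"])
  then have "tensor_pow v n \<in> tensor_power K n"
    unfolding tensor_power_def by (intro subsetD[OF closure_subset] span_base)
  moreover have "tensor_perm n \<pi> (tensor_pow v n) = tensor_pow v n" if \<pi>: "\<pi> permutes {..<n}" for \<pi>
  proof -
    have "permute_list \<pi> (replicate n v) = replicate n v"
      by (rule nth_equalityI)
        (use \<pi> permutes_in_image[OF \<pi>] in \<open>auto simp: permute_list_nth\<close>)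
    then show ?thesis by (simp add: tensor_pow_def tensor_perm_tensor[OF \<pi>] list_perm_def)
  qed
  ultimately show ?thesis by (simp add: sym_tensor_power_def)
qed

text \<open>Elementary tensors are total. Multilinear identities can therefore be checked by pairing
  with them, where they become identities between products of real numbers.\<close>

lemma tensor_eqI:
  fixes x y :: "'a::real_inner tensor"
  assumes "\<And>ws. inner x (tensor ws) = inner y (tensor ws)"
  shows "x = y"
proof -
  have "span (range tensor) \<subseteq> {z. inner (x - y) z = 0}"
  proof (rule span_minimal)
    show "range tensor \<subseteq> {z. inner (x - y) z = 0}" using assms by (auto simp: inner_diff_left)
    show "subspace {z. inner (x - y) z = 0}"
      by (auto simp: subspace_def inner_add_right)
  qed
  moreover have "closed {z. inner (x - y) z = 0}"
    by (intro closed_Collect_eq continuous_intros)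
  ultimately have "closure (span (range tensor)) \<subseteq> {z. inner (x - y) z = 0}"
    by (rule closure_minimal)
  moreover have "x - y \<in> closure (span (range tensor))" by (simp add: tensor_total)
  ultimately have "inner (x - y) (x - y) = 0" by blast
  then show ?thesis by simp
qed

text \<open>The multinomial expansion, with one term for each choice \<phi> of a summand in every
  factor; after pairing with an elementary tensor it is the distributive law for a product of
  sums.\<close>

lemma tensor_pow_sum:
  fixes f :: "nat \<Rightarrow> 'a::real_inner"
  assumes "finite S"
  shows "tensor_pow (\<Sum>i\<in>S. f i) n =
    (\<Sum>\<phi>\<in>{..<n} \<rightarrow>\<^sub>E S. tensor (map (\<lambda>j. f (\<phi> j)) [0..<n]))"
proof (rule tensor_eqI)
  fix ws
  show "inner (tensor_pow (\<Sum>i\<in>S. f i) n) (tensor ws) =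
    inner (\<Sum>\<phi>\<in>{..<n} \<rightarrow>\<^sub>E S. tensor (map (\<lambda>j. f (\<phi> j)) [0..<n])) (tensor ws)"
  proof (cases "length ws = n")
    case True
    have "inner (tensor_pow (\<Sum>i\<in>S. f i) n) (tensor ws) = (\<Prod>j<n. \<Sum>i\<in>S. inner (f i) (ws ! j))"
      using True by (simp add: tensor_pow_def inner_tensor inner_sum_left)
    also have "\<dots> = (\<Sum>\<phi>\<in>{..<n} \<rightarrow>\<^sub>E S. \<Prod>j<n. inner (f (\<phi> j)) (ws ! j))"
      by (rule prod_sum_PiE) (use assms in auto)
    finally show ?thesis using True by (simp add: inner_sum_left inner_tensor)
  next
    case False
    then show ?thesis by (simp add: tensor_pow_def inner_sum_left inner_tensor)
  qed
qed

text \<open>Inserting or removing a fixed element of A - C is a sign-reversing involution on the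
  sets between \<open>C\<close> and \<open>A\<close>.\<close>

lemma sum_alternating_supersets:
  fixes A C :: "'i set"
  assumes "finite A" "C \<subseteq> A" "C \<noteq> A"
  shows "(\<Sum>S | C \<subseteq> S \<and> S \<subseteq> A. (- 1) ^ card S) = (0 :: real)"
proof -
  obtain a where a: "a \<in> A" "a \<notin> C" using assms by blast
  define flip where "flip S = (if a \<in> S then S - {a} else insert a S)" for S
  have "(\<Sum>S | C \<subseteq> S \<and> S \<subseteq> A. (- 1) ^ card S) = (\<Sum>S | C \<subseteq> S \<and> S \<subseteq> A. - ((- 1) ^ card S) :: real)"
  proof (rule sum.reindex_bij_witness[of _ flip flip])
    fix S assume S: "S \<in> {S. C \<subseteq> S \<and> S \<subseteq> A}"
    then have "finite S" using assms(1) finite_subset by auto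
    show "flip (flip S) = S" by (auto simp: flip_def)
    then show "flip (flip S) = S" .
    show flip: "flip S \<in> {S. C \<subseteq> S \<and> S \<subseteq> A}" using S a by (auto simp: flip_def)
    then show "flip S \<in> {S. C \<subseteq> S \<and> S \<subseteq> A}" .
    show "- ((- 1) ^ card (flip S)) = ((- 1) ^ card S :: real)"
    proof (cases "a \<in> S")
      case True
      then have "card S = Suc (card (flip S))"
        using \<open>finite S\<close> card_Suc_Diff1[of S a] by (simp add: flip_def)
      then show ?thesis by simp
    next
      case False
      then show ?thesis using \<open>finite S\<close> by (simp add: flip_def)
    qed
  qed
  then show ?thesis by (simp add: sum_negf)
qed

text \<open>
  Polarization by inclusion-exclusion: the alternating sum over \<open>S\<close> of the powers of
  \<open>\<Sum>i\<in>S. v\<^sub>i\<close> retains only the surjective choices of factors, i.e. the permutations.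
\<close>

lemma polarization:
  fixes \<psi> :: "'a::real_inner tensor \<Rightarrow> real"
  assumes \<psi>: "linear \<psi>" and K: "subspace K" and zero: "\<And>v. v \<in> K \<Longrightarrow> \<psi> (tensor_pow v n) = 0"
    and vs: "set vs \<subseteq> K" "length vs = n"
  shows "(\<Sum>\<pi> | \<pi> permutes {..<n}. \<psi> (tensor (permute_list \<pi> vs))) = 0"
proof -
  define A where "A = {..<n}"
  have A: "finite A" by (simp add: A_def)
  define g where "g \<phi> = \<psi> (tensor (map (\<lambda>j. vs ! (\<phi> j)) [0..<n]))" for \<phi> :: "nat \<Rightarrow> nat"
  have sum_S: "(\<Sum>\<phi>\<in>A \<rightarrow>\<^sub>E S. g \<phi>) = 0" if S: "S \<subseteq> A" for S
  proof -
    have "(\<Sum>i\<in>S. vs ! i) \<in> K"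
      using S vs(2) by (intro subspace_sum[OF K] subsetD[OF vs(1) nth_mem]) (auto simp: A_def)
    then have "\<psi> (tensor_pow (\<Sum>i\<in>S. vs ! i) n) = 0" by (rule zero)
    then show ?thesis
      using finite_subset[OF S A] by (simp add: tensor_pow_sum linear_sum[OF \<psi>] g_def A_def)
  qed
  have fin: "finite (A \<rightarrow>\<^sub>E A)" using A by (intro finite_PiE) auto
  have "0 = (\<Sum>S\<in>Pow A. (- 1) ^ card S * (\<Sum>\<phi>\<in>A \<rightarrow>\<^sub>E S. g \<phi>))"
    by (simp add: sum_S)
  \<comment> \<open>Maps into \<open>S\<close> are the maps into \<open>A\<close> whose image lies
    in \<open>S\<close>; the index set no longer depends on \<open>S\<close> and the sums can be
    exchanged.\<close>
  also have "\<dots> = (\<Sum>S\<in>Pow A. \<Sum>\<phi>\<in>A \<rightarrow>\<^sub>E A. if \<phi> ` A \<subseteq> S then (- 1) ^ card S * g \<phi> else 0)"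
  proof (rule sum.cong)
    fix S assume "S \<in> Pow A"
    then have "A \<rightarrow>\<^sub>E S = {\<phi> \<in> A \<rightarrow>\<^sub>E A. \<phi> ` A \<subseteq> S}"
      by (auto simp: PiE_iff extensional_def)
    then show "(- 1) ^ card S * (\<Sum>\<phi>\<in>A \<rightarrow>\<^sub>E S. g \<phi>) =
        (\<Sum>\<phi>\<in>A \<rightarrow>\<^sub>E A. if \<phi> ` A \<subseteq> S then (- 1) ^ card S * g \<phi> else 0)"
      using fin by (simp add: sum_distrib_left sum.inter_filter) (auto intro!: sum.cong)
  qed simp
  also have "\<dots> = (\<Sum>\<phi>\<in>A \<rightarrow>\<^sub>E A. \<Sum>S\<in>Pow A. if \<phi> ` A \<subseteq> S then (- 1) ^ card S * g \<phi> else 0)"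
    by (rule sum.swap)
  \<comment> \<open>For fixed \<phi> the signs run over the supersets of its image and cancel unless
    \<open>A\<close> is the only one.\<close>
  also have "\<dots> = (\<Sum>\<phi>\<in>A \<rightarrow>\<^sub>E A. if \<phi> ` A = A then (- 1) ^ n * g \<phi> else 0)"
  proof (rule sum.cong)
    fix \<phi> assume "\<phi> \<in> A \<rightarrow>\<^sub>E A"
    then have sub: "\<phi> ` A \<subseteq> A" by (auto simp: PiE_iff)
    have "(\<Sum>S\<in>Pow A. if \<phi> ` A \<subseteq> S then (- 1) ^ card S * g \<phi> else 0) =
        (\<Sum>S | \<phi> ` A \<subseteq> S \<and> S \<subseteq> A. (- 1) ^ card S) * g \<phi>"
      using A by (simp add: sum_distrib_right sum.inter_filter[symmetric])
        (rule sum.cong; auto)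
    also have "\<dots> = (if \<phi> ` A = A then (- 1) ^ n * g \<phi> else 0)"
    proof (cases "\<phi> ` A = A")
      case True
      then have "{S. \<phi> ` A \<subseteq> S \<and> S \<subseteq> A} = {A}" by auto
      then show ?thesis using True by (simp add: A_def)
    qed (simp add: sum_alternating_supersets[OF A sub])
    finally show "(\<Sum>S\<in>Pow A. if \<phi> ` A \<subseteq> S then (- 1) ^ card S * g \<phi> else 0) =
      (if \<phi> ` A = A then (- 1) ^ n * g \<phi> else 0)" .
  qed simp
  also have "\<dots> = (- 1) ^ n * (\<Sum>\<phi> | \<phi> \<in> A \<rightarrow>\<^sub>E A \<and> \<phi> ` A = A. g \<phi>)"
    using fin by (simp add: sum_distrib_left sum.inter_filter) (auto intro!: sum.cong)
  finally have "(\<Sum>\<phi> | \<phi> \<in> A \<rightarrow>\<^sub>E A \<and> \<phi> ` A = A. g \<phi>) = 0" by simp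
  moreover have "(\<Sum>\<phi> | \<phi> \<in> A \<rightarrow>\<^sub>E A \<and> \<phi> ` A = A. g \<phi>) =
      (\<Sum>\<pi> | \<pi> permutes A. \<psi> (tensor (permute_list \<pi> vs)))"
  \<comment> \<open>Outside \<open>A\<close> the extensional maps are \<open>undefined\<close> and
    permutations are the identity; the witnesses translate between the two conventions.\<close>
  proof (rule sum.reindex_bij_witness[of _ "\<lambda>\<pi>. restrict \<pi> A" "\<lambda>\<phi> i. if i \<in> A then \<phi> i else i"])
    fix \<phi> assume \<phi>: "\<phi> \<in> {\<phi>. \<phi> \<in> A \<rightarrow>\<^sub>E A \<and> \<phi> ` A = A}"
    then show "restrict (\<lambda>i. if i \<in> A then \<phi> i else i) A = \<phi>"
      by (auto simp: fun_eq_iff PiE_iff extensional_def restrict_def)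
    have "bij_betw \<phi> A A"
      using \<phi> A eq_card_imp_inj_on[of A \<phi>] by (auto simp: bij_betw_def)
    then have "bij_betw (\<lambda>i. if i \<in> A then \<phi> i else i) A A"
      by (rule bij_betw_cong[THEN iffD1, rotated]) simp
    then show "(\<lambda>i. if i \<in> A then \<phi> i else i) \<in> {\<pi>. \<pi> permutes A}"
      using bij_imp_permutes by fastforce
    show "\<psi> (tensor (permute_list (\<lambda>i. if i \<in> A then \<phi> i else i) vs)) = g \<phi>"
      using vs(2) by (auto simp: g_def permute_list_def A_def intro!: arg_cong[of _ _ "\<lambda>l. \<psi> (tensor l)"])
  next
    fix \<pi> assume \<pi>: "\<pi> \<in> {\<pi>. \<pi> permutes A}"
    then show "(\<lambda>i. if i \<in> A then restrict \<pi> A i else i) = \<pi>"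
      by (auto simp: fun_eq_iff permutes_not_in)
    show "restrict \<pi> A \<in> {\<phi>. \<phi> \<in> A \<rightarrow>\<^sub>E A \<and> \<phi> ` A = A}"
      using \<pi> permutes_image[of \<pi> A] permutes_in_image[of \<pi> A] by auto
  qed
  ultimately show ?thesis by (simp add: A_def)
qed

text \<open>Sum \<psi> over all permutations of the factors. The result vanishes on elementary
  tensors by polarization, hence on the whole tensor power by continuity, and on an invariant tensor
  it is n! times \<psi>.\<close>

lemma eq_0_on_sym_tensor_power:
  fixes \<psi> :: "'a::real_inner tensor \<Rightarrow> real"
  assumes \<psi>: "bounded_linear \<psi>" and K: "subspace K"
    and zero: "\<And>v. v \<in> K \<Longrightarrow> \<psi> (tensor_pow v n) = 0" and x: "x \<in> sym_tensor_power K n"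
  shows "\<psi> x = 0"
proof -
  define P where "P = {\<pi>. \<pi> permutes {..<n}}"
  have P: "finite P" "card P = fact n"
    by (simp_all add: P_def finite_permutations card_permutations)
  define \<Psi> where "\<Psi> z = (\<Sum>\<pi>\<in>P. \<psi> (tensor_perm n \<pi> z))" for z
  have bl: "bounded_linear \<Psi>"
    unfolding \<Psi>_def
    by (intro bounded_linear_sum bounded_linear_compose[OF \<psi>] bounded_linear_tensor_perm(1))
      (simp add: P_def)
  have "span {tensor vs | vs. set vs \<subseteq> K \<and> length vs = n} \<subseteq> {z. \<Psi> z = 0}"
  proof (rule span_minimal)
    show "{tensor vs | vs. set vs \<subseteq> K \<and> length vs = n} \<subseteq> {z. \<Psi> z = 0}"
    proof clarify
      fix vs assume vs: "set vs \<subseteq> K" "n = length vs"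
      have "\<Psi> (tensor vs) = (\<Sum>\<pi>\<in>P. \<psi> (tensor (permute_list \<pi> vs)))"
        unfolding \<Psi>_def using vs by (intro sum.cong) (auto simp: P_def tensor_perm_tensor list_perm_def)
      also have "\<dots> = 0"
        unfolding P_def using vs by (intro polarization[OF bounded_linear.linear[OF \<psi>] K zero]) auto
      finally show "\<Psi> (tensor vs) = 0" .
    qed
    show "subspace {z. \<Psi> z = 0}"
      by (auto simp: subspace_def linear_simps[OF bl])
  qed
  moreover have "closed {z. \<Psi> z = 0}"
    using bl by (intro closed_Collect_eq continuous_intros linear_continuous_on)
  ultimately have "tensor_power K n \<subseteq> {z. \<Psi> z = 0}"
    unfolding tensor_power_def by (rule closure_minimal)
  then have "\<Psi> x = 0" using x by (auto simp: sym_tensor_power_def)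
  moreover have "\<Psi> x = (\<Sum>\<pi>\<in>P. \<psi> x)"
    unfolding \<Psi>_def using x by (intro sum.cong) (auto simp: sym_tensor_power_def P_def)
  ultimately show ?thesis using P by simp
qed

section \<open>Totality of the exponential vectors\<close>

lemma to_completion_eq_sum_fock_inj:
  "to_completion x = (\<Sum>n | fock_component x n \<noteq> 0. fock_inj n (fock_component x n))"
proof -
  let ?N = "{n. fock_component x n \<noteq> 0}"
  have fin: "finite ?N" using fock_component[of x] by simp
  have comp: "fock_component (\<Sum>n\<in>N. fock_single n (fock_component x n)) m =
      (if m \<in> N then fock_component x m else 0)" if "finite N" for N m
    using that by induction (auto simp: zero_fock_alg.rep_eq plus_fock_alg.rep_eq fock_single.rep_eq)
  have "x = (\<Sum>n\<in>?N. fock_single n (fock_component x n))"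
    by (simp add: fock_component_inject[symmetric] fun_eq_iff comp[OF fin])
  then have "to_completion x = to_completion (\<Sum>n\<in>?N. fock_single n (fock_component x n))" by simp
  also have "\<dots> = (\<Sum>n\<in>?N. fock_inj n (fock_component x n))"
    unfolding fock_inj_def by (rule linear_sum[OF bounded_linear.linear[OF bounded_linear_to_completion]])
  finally show ?thesis .
qed

lemma fock_space_eq_closure_span_exp_vector:
  fixes K :: "'a::real_inner set"
  assumes K: "subspace K"
  shows "fock_space K = closure (span (exp_vector ` K))"
proof
  define W where "W = closure (span (exp_vector ` K))"
  have W: "closed W" "subspace W" by (simp_all add: W_def subspace_closure)
  have expW: "exp_vector v \<in> W" if "v \<in> K" for v
    using that closure_subset[of "span (exp_vector ` K)"] by (auto simp: W_def span_base)
  have inj_W: "fock_inj n x \<in> W" if x: "x \<in> sym_tensor_power K n" for n x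
  proof (rule mem_closed_subspace_if_orthogonal[OF W])
    fix y assume y: "\<And>w. w \<in> W \<Longrightarrow> inner y w = 0"
    have "inner y (fock_inj n (tensor_pow v n)) = 0" if "v \<in> K" for v
    proof -
      \<comment> \<open>The pairing of \<open>y\<close> with
        \<open>exp_vector (t *\<^sub>R v)\<close>, written as a power series in t by homogeneity of
        degree \<open>k\<close>.\<close>
      have "(\<lambda>k. inner y (fock_inj k (tensor_pow v k)) / fact k * t ^ k) sums 0" for t :: real
      proof -
        have "tensor_pow (t *\<^sub>R v) k = t ^ k *\<^sub>R tensor_pow v k" for k
          by (rule tensor_eqI) (simp add: tensor_pow_def inner_tensor prod.distrib)
        then have "inner y (fock_inj k (tensor_pow (t *\<^sub>R v) k)) / fact k =
            inner y (fock_inj k (tensor_pow v k)) / fact k * t ^ k" for k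
          by (simp add: linear_simps(5)[OF bounded_linear_fock_inj])
        then show ?thesis
          using inner_exp_vector_sums[of y "t *\<^sub>R v"] y[OF expW] subspace_scale[OF K that, of t]
          by simp
      qed
      then have "inner y (fock_inj n (tensor_pow v n)) / fact n = 0" by (rule powser_coeffs_eq_0)
      then show ?thesis by simp
    qed
    moreover have "bounded_linear (\<lambda>x. inner y (fock_inj n x))"
      by (rule bounded_linear_compose[OF bounded_linear_inner_right bounded_linear_fock_inj])
    ultimately show "inner y (fock_inj n x) = 0"
      using eq_0_on_sym_tensor_power[OF _ K _ x, of "\<lambda>x. inner y (fock_inj n x)"] by blast
  qed
  have "{to_completion x | x. \<forall>n. fock_component x n \<in> sym_tensor_power K n} \<subseteq> W"
  proof clarify
    fix x :: "'a tensor fock_alg" assume "\<forall>n. fock_component x n \<in> sym_tensor_power K n"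
    then show "to_completion x \<in> W"
      unfolding to_completion_eq_sum_fock_inj by (intro subspace_sum[OF W(2)] inj_W) auto
  qed
  then show "fock_space K \<subseteq> closure (span (exp_vector ` K))"
    unfolding fock_space_def W_def[symmetric] using W(1) by (rule closure_minimal)
next
  define G where "G = {to_completion x | x :: 'a tensor fock_alg. \<forall>n. fock_component x n \<in> sym_tensor_power K n}"
  have F: "fock_space K = closure G" by (simp add: fock_space_def G_def)
  have "subspace G"
  proof (rule subspaceI)
    show "0 \<in> G"
      using subspace_0[OF subspace_sym_tensor_power[of K]] linear_simps(3)[OF bounded_linear_to_completion]
      by (auto simp: G_def zero_fock_alg.rep_eq intro!: exI[of _ 0])
  next
    fix a b assume "a \<in> G" "b \<in> G"
    then show "a + b \<in> G"
      using subspace_add[OF subspace_sym_tensor_power[of K]]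
      by (auto simp: G_def plus_fock_alg.rep_eq to_completion_add[symmetric])
  next
    fix r a assume "a \<in> G"
    then show "r *\<^sub>R a \<in> G"
      using subspace_scale[OF subspace_sym_tensor_power[of K]]
      by (auto simp: G_def scaleR_fock_alg.rep_eq to_completion_scaleR[symmetric])
  qed
  have "exp_vector v \<in> closure G" if v: "v \<in> K" for v
  proof -
    have "fock_inj n (tensor_pow v n) \<in> G" for n
      using tensor_pow_in_sym_tensor_power[OF v] subspace_0[OF subspace_sym_tensor_power[of K]]
      by (auto simp: G_def fock_inj_def fock_single.rep_eq)
    then have "(\<Sum>n<m. (1 / fact n) *\<^sub>R fock_inj n (tensor_pow v n)) \<in> G" for m
      using \<open>subspace G\<close> by (intro subspace_sum subspace_scale)
    moreover have "(\<lambda>m. \<Sum>n<m. (1 / fact n) *\<^sub>R fock_inj n (tensor_pow v n)) \<longlonglongrightarrow> exp_vector v"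
      using exp_vector_sums[of v] by (simp only: sums_def)
    ultimately show ?thesis
      unfolding closure_sequential
      by (intro exI[of _ "\<lambda>m. \<Sum>n<m. (1 / fact n) *\<^sub>R fock_inj n (tensor_pow v n)"]) auto
  qed
  then have "span (exp_vector ` K) \<subseteq> closure G"
    using subspace_closure[OF \<open>subspace G\<close>] by (intro span_minimal) auto
  then show "closure (span (exp_vector ` K)) \<subseteq> fock_space K"
    unfolding F by (rule closure_minimal) simp
qed

section \<open>Almost-everywhere classes\<close>

lemma ae_class_cong: "AE x in M. f x = g x \<Longrightarrow> ae_class M f = ae_class M g"
  by (auto simp: ae_class_def elim: AE_mp)

lemma ae_class_eqD:
  assumes "ae_class M f = ae_class M g" "f \<in> borel_measurable M"
  shows "AE x in M. f x = g x"
proof -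
  have "f \<in> ae_class M g" using assms by (auto simp: ae_class_def)
  then show ?thesis by (simp add: ae_class_def)
qed

lemma L2_rep_ae_class:
  assumes "f \<in> borel_measurable M"
  shows "L2_rep (ae_class M f) \<in> borel_measurable M"
    and "AE x in M. L2_rep (ae_class M f) x = f x"
proof -
  have "f \<in> ae_class M f" using assms by (simp add: ae_class_def)
  then have "L2_rep (ae_class M f) \<in> ae_class M f" unfolding L2_rep_def
    using someI[of "\<lambda>h. h \<in> ae_class M f" f] by blast
  then show "L2_rep (ae_class M f) \<in> borel_measurable M"
    and "AE x in M. L2_rep (ae_class M f) x = f x" by (simp_all add: ae_class_def)
qed

lemma L2_rep_L2:
  fixes A :: "('b \<Rightarrow> 'k::{real_normed_field, second_countable_topology}) set"
  assumes "A \<in> L2 M"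
  shows L2_rep_measurable: "L2_rep A \<in> borel_measurable M"
    and L2_rep_integrable: "integrable M (\<lambda>x. (norm (L2_rep A x))\<^sup>2)"
    and ae_class_L2_rep: "ae_class M (L2_rep A) = A"
proof -
  obtain f where f: "f \<in> borel_measurable M" "integrable M (\<lambda>x. (norm (f x))\<^sup>2)" "A = ae_class M f"
    using assms by (auto simp: L2_def)
  note rep = L2_rep_ae_class[OF f(1), folded f(3)]
  show "L2_rep A \<in> borel_measurable M" by (rule rep)
  show "ae_class M (L2_rep A) = A" using ae_class_cong[OF rep(2)] f(3) by simp
  have "AE x in M. (norm (f x))\<^sup>2 = (norm (L2_rep A x))\<^sup>2"
    using rep(2) by eventually_elim simp
  then show "integrable M (\<lambda>x. (norm (L2_rep A x))\<^sup>2)"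
    using f(2) by (rule integrable_cong_AE_imp[rotated 2]) (use rep(1) in measurable)
qed

lemma L2_add_ae_class:
  fixes f g :: "'b \<Rightarrow> 'k::real_normed_field"
  assumes "f \<in> borel_measurable M" "g \<in> borel_measurable M"
  shows "L2_add M (ae_class M f) (ae_class M g) = ae_class M (\<lambda>x. f x + g x)"
  unfolding L2_add_def
  by (rule ae_class_cong, use L2_rep_ae_class(2)[OF assms(1)] L2_rep_ae_class(2)[OF assms(2)]
      in eventually_elim) simp

lemma L2_scale_ae_class:
  fixes f :: "'b \<Rightarrow> 'k::real_normed_field"
  assumes "f \<in> borel_measurable M"
  shows "L2_scale M c (ae_class M f) = ae_class M (\<lambda>x. c * f x)"
  unfolding L2_scale_def
  by (rule ae_class_cong, use L2_rep_ae_class(2)[OF assms] in eventually_elim) simp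

lemma sqint_L2_rep:
  fixes A :: "('b \<Rightarrow> real) set"
  shows "A \<in> L2 M \<Longrightarrow> sqint M (L2_rep A)"
  using L2_rep_measurable[of A M] L2_rep_integrable[of A M] by (simp add: sqint_def)

section \<open>Exponentials of a Gaussian process\<close>

text \<open>Dominated convergence: the partial sums of the exponential series are bounded by exp(|z|
  |X|), which real exponents of both signs control. Integrability for real t thus gives the
  expansion at every complex z.\<close>

lemma integral_exp_series_sums:
  fixes g X :: "'a \<Rightarrow> real" and z :: complex
  assumes [measurable]: "g \<in> borel_measurable M" "X \<in> borel_measurable M"
    and int: "\<And>t :: real. integrable M (\<lambda>x. g x * exp (t * X x))"
  shows "(\<lambda>n. z ^ n / fact n * complex_of_real (\<integral>x. g x * X x ^ n \<partial>M)) sums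
    (\<integral>x. complex_of_real (g x) * exp (z * complex_of_real (X x)) \<partial>M)"
proof -
  define w where "w x = \<bar>g x * exp (norm z * X x)\<bar> + \<bar>g x * exp (- norm z * X x)\<bar>" for x
  have w: "integrable M w"
    unfolding w_def by (intro Bochner_Integration.integrable_add integrable_abs int)
  define T where "T n x = complex_of_real (g x) * ((z * complex_of_real (X x)) ^ n /\<^sub>R fact n)" for n x
  have [measurable]: "T n \<in> borel_measurable M" for n unfolding T_def by measurable
  have bound: "(\<Sum>n\<in>N. norm (T n x)) \<le> w x" if "finite N" for N x
  proof -
    let ?a = "norm z * \<bar>X x\<bar>"
    have "(\<Sum>n\<in>N. norm (T n x)) = \<bar>g x\<bar> * (\<Sum>n\<in>N. ?a ^ n /\<^sub>R fact n)"
      by (simp add: T_def norm_mult norm_power power_mult_distrib sum_distrib_left field_simps)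
    also have "(\<Sum>n\<in>N. ?a ^ n /\<^sub>R fact n) \<le> exp ?a"
      using sum_le_suminf[OF summable_exp_generic \<open>finite N\<close>, of ?a] by (simp add: exp_def)
    also have "exp ?a \<le> exp (norm z * X x) + exp (- norm z * X x)"
      by (cases "X x \<ge> 0") (auto simp: add_increasing add_increasing2)
    finally show ?thesis by (simp add: w_def abs_mult mult_left_mono distrib_left)
  qed
  have T_int: "integrable M (T n)" for n
    by (rule Bochner_Integration.integrable_bound[OF w])
      (use bound[of "{n}"] in \<open>auto intro!: always_eventually order_trans[OF _ abs_ge_self]\<close>)
  have "(\<lambda>N. \<integral>x. (\<Sum>n<N. T n x) \<partial>M) \<longlonglongrightarrow>
      (\<integral>x. complex_of_real (g x) * exp (z * complex_of_real (X x)) \<partial>M)"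
  proof (rule integral_dominated_convergence[OF _ _ w])
    show "AE x in M. (\<lambda>N. \<Sum>n<N. T n x) \<longlonglongrightarrow> complex_of_real (g x) * exp (z * complex_of_real (X x))"
      using sums_mult[OF exp_converges] unfolding T_def sums_def by blast
    show "AE x in M. norm (\<Sum>n<N. T n x) \<le> w x" for N
      using norm_sum[of "\<lambda>n. T n x" "{..<N}" for x] bound[of "{..<N}"]
      by (intro always_eventually allI order_trans[OF norm_sum bound]) simp
  qed measurable
  then have "(\<lambda>n. \<integral>x. T n x \<partial>M) sums (\<integral>x. complex_of_real (g x) * exp (z * complex_of_real (X x)) \<partial>M)"
    unfolding sums_def using T_int by simp
  moreover have "(\<integral>x. T n x \<partial>M) = z ^ n / fact n * complex_of_real (\<integral>x. g x * X x ^ n \<partial>M)" for n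
  proof -
    have "(\<integral>x. T n x \<partial>M) = (\<integral>x. z ^ n / fact n * complex_of_real (g x * X x ^ n) \<partial>M)"
      by (intro Bochner_Integration.integral_cong)
        (auto simp: T_def power_mult_distrib scaleR_conv_of_real field_simps)
    also have "\<dots> = z ^ n / fact n * (\<integral>x. complex_of_real (g x * X x ^ n) \<partial>M)"
      by (rule integral_mult_right_zero)
    finally show ?thesis by (simp only: integral_complex_of_real)
  qed
  ultimately show ?thesis by simp
qed

text \<open>
  Vanishing on the real axis kills every Taylor coefficient of the entire function
  \<open>z \<mapsto> \<integral> g e\<^sup>z\<^sup>X\<close>, which therefore vanishes at \<open>z = \<i>\<close> as well.
\<close>

lemma fourier_eq_0_if_laplace_eq_0:
  fixes g X :: "'a \<Rightarrow> real"
  assumes meas: "g \<in> borel_measurable M" "X \<in> borel_measurable M"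
    and int: "\<And>t :: real. integrable M (\<lambda>x. g x * exp (t * X x))"
    and zero: "\<And>t :: real. (\<integral>x. g x * exp (t * X x) \<partial>M) = 0"
  shows "(\<integral>x. g x *\<^sub>R iexp (X x) \<partial>M) = 0"
proof -
  define c where "c n = (\<integral>x. g x * X x ^ n \<partial>M)" for n
  note series = integral_exp_series_sums[OF meas int, folded c_def]
  have "c n / fact n = 0" for n
  proof (rule powser_coeffs_eq_0)
    fix t :: real
    have "(\<integral>x. complex_of_real (g x) * exp (complex_of_real t * complex_of_real (X x)) \<partial>M) =
        (\<integral>x. complex_of_real (g x * exp (t * X x)) \<partial>M)"
      by (simp add: exp_of_real flip: of_real_mult)
    also have "\<dots> = complex_of_real 0" unfolding integral_complex_of_real by (simp only: zero)
    finally have "(\<lambda>n. complex_of_real (c n / fact n * t ^ n)) sums complex_of_real 0"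
      using series[of "complex_of_real t"] by (simp add: mult.commute)
    then show "(\<lambda>n. c n / fact n * t ^ n) sums 0" by (simp only: sums_of_real_iff)
  qed
  then have "c n = 0" for n by simp
  then have "(\<lambda>n. 0) sums (\<integral>x. complex_of_real (g x) * exp (\<i> * complex_of_real (X x)) \<partial>M)"
    using series[of "\<i>"] by simp
  then have "(\<integral>x. complex_of_real (g x) * exp (\<i> * complex_of_real (X x)) \<partial>M) = 0"
    using sums_unique2 sums_zero by blast
  then show ?thesis by (simp add: scaleR_conv_of_real)
qed

text \<open>Completing the square turns the integrand into a multiple of the normal density centered
  at \<open>s\<close>.\<close>

lemma nn_integral_exp_std_normal:
  "(\<integral>\<^sup>+x. ennreal (exp (s * x)) \<partial>std_normal_distribution) = ennreal (exp (s\<^sup>2 / 2))"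
proof -
  have "std_normal_density x * exp (s * x) = exp (s\<^sup>2 / 2) * normal_density s 1 x" for x
    by (simp add: normal_density_def exp_add[symmetric] power2_eq_square field_simps)
  then have "(\<integral>\<^sup>+x. ennreal (exp (s * x)) \<partial>std_normal_distribution) =
      (\<integral>\<^sup>+x. ennreal (exp (s\<^sup>2 / 2) * normal_density s 1 x) \<partial>lborel)"
    by (simp add: nn_integral_density ennreal_mult'[symmetric])
  also have "\<dots> = ennreal (\<integral>x. exp (s\<^sup>2 / 2) * normal_density s 1 x \<partial>lborel)"
    by (intro nn_integral_eq_integral) auto
  finally show ?thesis by simp
qed

text \<open>
  \<open>J_char\<close> says that \<open>J\<close> is the Gaussian process with mean \<open>\<langle>m, h\<rangle>\<close> and covariance \<open>\<langle>P\<^sub>V g, P\<^sub>V h\<rangle>\<close>: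
  the argument is written as \<open>h = v + k\<close> with \<open>v = P\<^sub>V h\<close>.
\<close>

locale affine_gaussian = prob_space M
  for M :: "'b::{real_normed_vector, second_countable_topology} measure" +
  fixes J :: "'h::{real_inner, complete_space} \<Rightarrow> 'b \<Rightarrow> real" and V :: "'h set" and m :: 'h
  assumes sets_M: "sets M = sets borel"
    and V: "closed V" "subspace V"
    and J_measurable [measurable]: "\<And>h. J h \<in> borel_measurable M"
    and J_add: "\<And>g h. AE x in M. J (g + h) x = J g x + J h x"
    and J_scale: "\<And>r h. AE x in M. J (r *\<^sub>R h) x = r * J h x"
    and J_functional: "\<And>f :: 'b \<Rightarrow>\<^sub>L real. \<exists>h. AE x in M. J h x = blinfun_apply f x"
    and J_char: "\<And>v k. v \<in> V \<Longrightarrow> (\<And>z. z \<in> V \<Longrightarrow> inner k z = 0) \<Longrightarrow>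
      (\<integral>x. iexp (J (v + k) x) \<partial>M) = exp (\<i> * complex_of_real (inner m k) - complex_of_real ((norm v)\<^sup>2 / 2))"
begin

lemma char_distr_J: "char (distr M borel (J h)) t = (\<integral>x. iexp (J (t *\<^sub>R h) x) \<partial>M)"
proof -
  have "char (distr M borel (J h)) t = (\<integral>x. iexp (t * J h x) \<partial>M)"
    unfolding char_def by (subst integral_distr) auto
  also have "\<dots> = (\<integral>x. iexp (J (t *\<^sub>R h) x) \<partial>M)"
    by (intro integral_cong_AE) (use J_scale[of t h] in \<open>auto elim: eventually_mono\<close>)
  finally show ?thesis .
qed

lemma real_distribution_J: "real_distribution (distr M borel (J h))"
  using prob_space_distr[OF J_measurable] by (simp add: real_distribution_def real_distribution_axioms_def)

text \<open>Restricting to unit vectors gives one law of variance 1; other nonzero \<open>v\<close>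
  are reduced to it by scaling.\<close>

lemma distr_J_unit:
  assumes "v \<in> V" "norm v = 1"
  shows "distr M borel (J v) = std_normal_distribution"
proof (rule Levy_uniqueness[OF real_distribution_J real_dist_normal_dist])
  show "char (distr M borel (J v)) = char std_normal_distribution"
    unfolding char_std_normal_distribution
  proof
    fix t
    have "(\<integral>x. iexp (J (t *\<^sub>R v + 0) x) \<partial>M) = exp (\<i> * complex_of_real (inner m 0) - complex_of_real ((norm (t *\<^sub>R v))\<^sup>2 / 2))"
      using assms V by (intro J_char) (auto intro: subspace_scale)
    then show "char (distr M borel (J v)) t = complex_of_real (exp (- t\<^sup>2 / 2))"
      using assms(2) unfolding char_distr_J by (simp add: exp_of_real[symmetric] power_mult_distrib)
  qed
qed

lemma J_0: "AE x in M. J 0 x = 0"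
  using J_scale[of 0 0] by simp

text \<open>For v = 0 the characteristic function has modulus 1 and is that of a point mass.\<close>

lemma J_orth:
  assumes "\<And>z. z \<in> V \<Longrightarrow> inner k z = 0"
  shows "AE x in M. J k x = inner m k"
proof -
  have "distr M borel (J k) = return borel (inner m k)"
  proof (rule Levy_uniqueness[OF real_distribution_J])
    show "real_distribution (return borel (inner m k))"
      by (simp add: real_distribution_def real_distribution_axioms_def prob_space_return)
    show "char (distr M borel (J k)) = char (return borel (inner m k))"
    proof
      fix t
      have "(\<integral>x. iexp (J (0 + t *\<^sub>R k) x) \<partial>M) =
          exp (\<i> * complex_of_real (inner m (t *\<^sub>R k)) - complex_of_real ((norm (0 :: 'h))\<^sup>2 / 2))"
        using assms V by (intro J_char) (auto intro: subspace_0)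
      moreover have "char (return borel (inner m k)) t = iexp (t * inner m k)"
        unfolding char_def by (subst integral_return) auto
      ultimately show "char (distr M borel (J k)) t = char (return borel (inner m k)) t"
        unfolding char_distr_J by simp
    qed
  qed
  moreover have "AE y in return borel (inner m k). y = inner m k" by (subst AE_return) auto
  ultimately have "AE y in distr M borel (J k). y = inner m k" by (simp only:)
  then show ?thesis by (subst (asm) AE_distr_iff) auto
qed

text \<open>\<open>J_char\<close> controls imaginary exponents only. Real exponents are reached by
  identifying the law of \<open>J\<close> and integrating against it; v = 0 has no unit vector and
  is separate.\<close>

lemma nn_integral_exp_J:
  assumes "v \<in> V"
  shows "(\<integral>\<^sup>+x. ennreal (exp (J v x)) \<partial>M) = ennreal (exp ((norm v)\<^sup>2 / 2))"
proof (cases "v = 0")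
  case True
  have "(\<integral>\<^sup>+x. ennreal (exp (J 0 x)) \<partial>M) = (\<integral>\<^sup>+x. 1 \<partial>M)"
    by (intro nn_integral_cong_AE) (use J_0 in \<open>auto elim: eventually_mono\<close>)
  then show ?thesis using True by (simp add: emeasure_space_1)
next
  case False
  define u where "u = v /\<^sub>R norm v"
  have u: "u \<in> V" "norm u = 1" "v = norm v *\<^sub>R u"
    using False assms V(2) by (auto simp: u_def subspace_scale)
  have "(\<integral>\<^sup>+x. ennreal (exp (J v x)) \<partial>M) = (\<integral>\<^sup>+x. ennreal (exp (norm v * J u x)) \<partial>M)"
    by (intro nn_integral_cong_AE)
      (use J_scale[of "norm v" u] u(3) in \<open>auto elim: eventually_mono\<close>)
  also have "\<dots> = (\<integral>\<^sup>+y. ennreal (exp (norm v * y)) \<partial>distr M borel (J u))"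
    by (subst nn_integral_distr) auto
  also have "\<dots> = ennreal (exp ((norm v)\<^sup>2 / 2))"
    unfolding distr_J_unit[OF u(1,2)] by (rule nn_integral_exp_std_normal)
  finally show ?thesis .
qed

lemma exp_J:
  assumes "v \<in> V"
  shows integrable_exp_J: "integrable M (\<lambda>x. exp (J v x))"
    and integral_exp_J: "(\<integral>x. exp (J v x) \<partial>M) = exp ((norm v)\<^sup>2 / 2)"
proof -
  show "integrable M (\<lambda>x. exp (J v x))"
    by (intro integrableI_nonneg) (auto simp: nn_integral_exp_J[OF assms])
  then show "(\<integral>x. exp (J v x) \<partial>M) = exp ((norm v)\<^sup>2 / 2)"
    using nn_integral_exp_J[OF assms] by (subst (asm) nn_integral_eq_integral) auto
qed

text \<open>The Wick exponential: for \<open>v \<in> V\<close> the constant gives it mean 1.\<close>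

definition E :: "'h \<Rightarrow> 'b \<Rightarrow> real" where
  "E v x = exp (J v x - (norm v)\<^sup>2 / 2)"

lemma E_measurable [measurable]: "E v \<in> borel_measurable M"
  unfolding E_def by measurable

lemma E_mult: "AE x in M. E v x * E w x = exp (J (v + w) x) * exp (- ((norm v)\<^sup>2 + (norm w)\<^sup>2) / 2)"
  using J_add[of v w] by eventually_elim (simp add: E_def exp_add[symmetric] field_simps)

lemma integrable_E_mult:
  assumes "v \<in> V" "w \<in> V"
  shows "integrable M (\<lambda>x. E v x * E w x)"
proof -
  have "integrable M (\<lambda>x. exp (J (v + w) x) * exp (- ((norm v)\<^sup>2 + (norm w)\<^sup>2) / 2))"
    using integrable_exp_J[OF subspace_add[OF V(2) assms]] by simp
  then show ?thesis
    by (rule integrable_cong_AE_imp) (use E_mult[of v w] in \<open>auto elim: eventually_mono\<close>)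
qed

lemma sqint_E: "v \<in> V \<Longrightarrow> sqint M (E v)"
  using integrable_E_mult[of v v] by (simp add: sqint_def power2_eq_square)

lemma integral_E_mult:
  assumes "v \<in> V" "w \<in> V"
  shows "(\<integral>x. E v x * E w x \<partial>M) = exp (inner v w)"
proof -
  have "(\<integral>x. E v x * E w x \<partial>M) =
      (\<integral>x. exp (J (v + w) x) * exp (- ((norm v)\<^sup>2 + (norm w)\<^sup>2) / 2) \<partial>M)"
    by (intro integral_cong_AE E_mult) measurable
  also have "\<dots> = exp ((norm (v + w))\<^sup>2 / 2) * exp (- ((norm v)\<^sup>2 + (norm w)\<^sup>2) / 2)"
    using integral_exp_J[OF subspace_add[OF V(2) assms]] by simp
  also have "\<dots> = exp (inner v w)"
    unfolding exp_add[symmetric]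
    by (simp add: power2_norm_eq_inner inner_add_left inner_add_right inner_commute field_simps)
  finally show ?thesis .
qed

lemma E_total:
  assumes g: "sqint M g" and zero: "\<And>v. v \<in> V \<Longrightarrow> (\<integral>x. g x * E v x \<partial>M) = 0"
  shows "AE x in M. g x = 0"
proof (rule AE_eq_0_if_fourier_eq_0[OF sets_M])
  have g_meas [measurable]: "g \<in> borel_measurable M" using g by (simp add: sqint_def)
  show "integrable M g"
    using integral_abs_le_sqrt(1)[OF g] integrable_abs_iff[OF g_meas] by simp
  fix f :: "'b \<Rightarrow>\<^sub>L real"
  obtain h where h: "AE x in M. J h x = blinfun_apply f x" using J_functional by blast
  obtain v where v: "v \<in> V" "\<And>z. z \<in> V \<Longrightarrow> inner (h - v) z = 0"
    using orthogonal_projection_exists[OF V, of h] by auto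
  have tv: "t *\<^sub>R v \<in> V" for t using v(1) V(2) by (simp add: subspace_scale)
  have "AE x in M. J (h - v) x = inner m (h - v)" using v(2) by (rule J_orth)
  with h J_add[of v "h - v"] have f_eq: "AE x in M. blinfun_apply f x = J v x + inner m (h - v)"
    by eventually_elim simp
  \<comment> \<open>Since t v stays in \<open>V\<close>, the hypothesis at t v covers the exponent
    t, up to a positive constant factor.\<close>
  have E_t: "AE x in M. g x * exp (t * J v x) = exp ((norm (t *\<^sub>R v))\<^sup>2 / 2) * (g x * E (t *\<^sub>R v) x)" for t
    using J_scale[of t v]
    by eventually_elim (simp add: E_def exp_diff)
  have "integrable M (\<lambda>x. g x * exp (t * J v x))" for t
  proof -
    have "integrable M (\<lambda>x. exp ((norm (t *\<^sub>R v))\<^sup>2 / 2) * (g x * E (t *\<^sub>R v) x))"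
      using sqint_mult[OF g sqint_E[OF tv]] by simp
    then show ?thesis
      by (rule integrable_cong_AE_imp) (use E_t[of t] in \<open>auto elim: eventually_mono\<close>)
  qed
  moreover have "(\<integral>x. g x * exp (t * J v x) \<partial>M) = 0" for t
  proof -
    have "(\<integral>x. g x * exp (t * J v x) \<partial>M) =
        (\<integral>x. exp ((norm (t *\<^sub>R v))\<^sup>2 / 2) * (g x * E (t *\<^sub>R v) x) \<partial>M)"
      by (intro integral_cong_AE E_t) measurable
    also have "\<dots> = 0" using zero[OF tv] by simp
    finally show ?thesis .
  qed
  ultimately have J0: "(\<integral>x. g x *\<^sub>R iexp (J v x) \<partial>M) = 0"
    by (rule fourier_eq_0_if_laplace_eq_0[OF g_meas J_measurable])
  have "blinfun_apply f \<in> borel_measurable M"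
    by (rule borel_measurable_blinfun_apply[OF sets_M])
  \<comment> \<open>The component of \<open>h\<close> orthogonal to \<open>V\<close> contributes
    only a constant phase.\<close>
  then have "(\<integral>x. g x *\<^sub>R iexp (blinfun_apply f x) \<partial>M) =
      (\<integral>x. iexp (inner m (h - v)) * (g x *\<^sub>R iexp (J v x)) \<partial>M)"
    by (intro integral_cong_AE)
      (use f_eq in \<open>auto elim!: eventually_mono simp: distrib_left exp_add mult_ac\<close>)
  also have "\<dots> = iexp (inner m (h - v)) * (\<integral>x. g x *\<^sub>R iexp (J v x) \<partial>M)"
    by (rule integral_mult_right_zero)
  finally show "(\<integral>x. g x *\<^sub>R iexp (blinfun_apply f x) \<partial>M) = 0" by (simp only: J0 mult_zero_right)
qed

end

section \<open>Complexification of a real isometry\<close>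

lemma integral_complex_split:
  assumes "integrable M a" "integrable M b"
  shows "(\<integral>x. complex_of_real (a x) + \<i> * complex_of_real (b x) \<partial>M) = Complex (\<integral>x. a x \<partial>M) (\<integral>x. b x \<partial>M)"
proof -
  have "(\<integral>x. complex_of_real (a x) + \<i> * complex_of_real (b x) \<partial>M) =
      complex_of_real (\<integral>x. a x \<partial>M) + \<i> * complex_of_real (\<integral>x. b x \<partial>M)"
    using assms by (simp add: complex_of_real_integrable_eq)
  then show ?thesis by (simp add: Complex_eq)
qed

lemma sqint_Re_Im_L2_rep:
  assumes "A \<in> (L2 M :: ('b \<Rightarrow> complex) set set)"
  shows "sqint M (\<lambda>x. Re (L2_rep A x))" "sqint M (\<lambda>x. Im (L2_rep A x))"
proof -
  note [measurable] = L2_rep_measurable[OF assms]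
  have le: "(Re z)\<^sup>2 \<le> (norm z)\<^sup>2" "(Im z)\<^sup>2 \<le> (norm z)\<^sup>2" for z
    by (simp_all add: cmod_power2)
  have "integrable M (\<lambda>x. (Re (L2_rep A x))\<^sup>2)" "integrable M (\<lambda>x. (Im (L2_rep A x))\<^sup>2)"
    by (rule Bochner_Integration.integrable_bound[OF L2_rep_integrable[OF assms]]; simp add: le)+
  then show "sqint M (\<lambda>x. Re (L2_rep A x))" "sqint M (\<lambda>x. Im (L2_rep A x))"
    by (simp_all add: sqint_def)
qed

lemma L2_cinner_ae_class:
  assumes [measurable]: "f \<in> borel_measurable M" "g \<in> borel_measurable M"
  shows "L2_cinner M (ae_class M f) (ae_class M g) = (\<integral>x. f x * cnj (g x) \<partial>M)"
proof -
  note [measurable] = L2_rep_ae_class(1)[OF assms(1)] L2_rep_ae_class(1)[OF assms(2)]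
  have "AE x in M. L2_rep (ae_class M f) x * cnj (L2_rep (ae_class M g) x) = f x * cnj (g x)"
    using L2_rep_ae_class(2)[OF assms(1)] L2_rep_ae_class(2)[OF assms(2)] by eventually_elim simp
  moreover have "(\<lambda>x. f x * cnj (g x)) \<in> borel_measurable M"
    "(\<lambda>x. L2_rep (ae_class M f) x * cnj (L2_rep (ae_class M g) x)) \<in> borel_measurable M"
    by (intro borel_measurable_times borel_measurable_continuous_on[OF continuous_on_cnj[OF continuous_on_id]];
        measurable)+
  ultimately show ?thesis unfolding L2_cinner_def by (intro integral_cong_AE)
qed

lemma L2_cinner_of_real:
  assumes A: "A \<in> (L2 M :: ('b \<Rightarrow> complex) set set)" and g: "sqint M g"
  shows "L2_cinner M A (ae_class M (\<lambda>x. complex_of_real (g x))) =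
    Complex (\<integral>x. Re (L2_rep A x) * g x \<partial>M) (\<integral>x. Im (L2_rep A x) * g x \<partial>M)"
proof -
  have [measurable]: "g \<in> borel_measurable M" using g by (rule sqint_measurable)
  have "L2_cinner M A (ae_class M (\<lambda>x. complex_of_real (g x))) =
      L2_cinner M (ae_class M (L2_rep A)) (ae_class M (\<lambda>x. complex_of_real (g x)))"
    by (simp only: ae_class_L2_rep[OF A])
  also have "\<dots> = (\<integral>x. L2_rep A x * cnj (complex_of_real (g x)) \<partial>M)"
    by (rule L2_cinner_ae_class[OF L2_rep_measurable[OF A]]) measurable
  also have "\<dots> = (\<integral>x. complex_of_real (Re (L2_rep A x) * g x) + \<i> * complex_of_real (Im (L2_rep A x) * g x) \<partial>M)"
    by (intro Bochner_Integration.integral_cong) (auto simp: complex_eq_iff)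
  also have "\<dots> = Complex (\<integral>x. Re (L2_rep A x) * g x \<partial>M) (\<integral>x. Im (L2_rep A x) * g x \<partial>M)"
    by (intro integral_complex_split sqint_mult sqint_Re_Im_L2_rep[OF A] g)
  finally show ?thesis .
qed

text \<open>\<open>T\<close> acts separately on real and imaginary parts. Linearity almost
  everywhere is enough because \<open>U\<close> takes values in classes; \<open>U\<close> is
  restricted so that it has a fixed value off its domain and can be unique as a function.\<close>

lemma unitary_complexification:
  fixes F :: "'v::real_inner set" and T :: "'v \<Rightarrow> 'b \<Rightarrow> real"
  assumes F: "subspace F"
    and T_sq: "\<And>x. x \<in> F \<Longrightarrow> sqint M (T x)"
    and T_T: "\<And>x y. x \<in> F \<Longrightarrow> y \<in> F \<Longrightarrow> (\<integral>\<omega>. T x \<omega> * T y \<omega> \<partial>M) = inner x y"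
    and T_add: "\<And>x y. x \<in> F \<Longrightarrow> y \<in> F \<Longrightarrow> AE \<omega> in M. T (x + y) \<omega> = T x \<omega> + T y \<omega>"
    and T_scale: "\<And>r x. x \<in> F \<Longrightarrow> AE \<omega> in M. T (r *\<^sub>R x) \<omega> = r * T x \<omega>"
    and surj: "\<And>g. sqint M g \<Longrightarrow> \<exists>x\<in>F. AE \<omega> in M. T x \<omega> = g \<omega>"
  defines "U \<equiv> \<lambda>z\<in>complexification F.
    ae_class M (\<lambda>\<omega>. complex_of_real (T (fst z) \<omega>) + \<i> * complex_of_real (T (snd z) \<omega>))"
  shows "unitary_to_L2 F M U" "U \<in> complexification F \<rightarrow>\<^sub>E L2 M"
proof -
  define c where "c z \<omega> = complex_of_real (T (fst z) \<omega>) + \<i> * complex_of_real (T (snd z) \<omega>)" for z \<omega>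
  have U: "U z = ae_class M (c z)" if "z \<in> complexification F" for z
    using that by (simp add: U_def c_def[abs_def])
  have mem: "fst z \<in> F" "snd z \<in> F" if "z \<in> complexification F" for z
    using that by (auto simp: complexification_def)
  have c_meas: "c z \<in> borel_measurable M" if "z \<in> complexification F" for z
  proof -
    note [measurable] = sqint_measurable[OF T_sq[OF mem(1)[OF that]]] sqint_measurable[OF T_sq[OF mem(2)[OF that]]]
    show ?thesis unfolding c_def by measurable
  qed
  have c_L2: "ae_class M (c z) \<in> L2 M" if z: "z \<in> complexification F" for z
  proof -
    have "(norm (c z \<omega>))\<^sup>2 = (T (fst z) \<omega>)\<^sup>2 + (T (snd z) \<omega>)\<^sup>2" for \<omega>
      by (simp add: c_def cmod_power2)
    then have "integrable M (\<lambda>\<omega>. (norm (c z \<omega>))\<^sup>2)"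
      using T_sq[OF mem(1)[OF z]] T_sq[OF mem(2)[OF z]] by (simp add: sqint_def)
    then show ?thesis using c_meas[OF z] by (auto simp: L2_def)
  qed
  then show "U \<in> complexification F \<rightarrow>\<^sub>E L2 M"
    by (intro PiE_I) (simp add: U, simp add: U_def)
  have cinner_c: "L2_cinner M (ae_class M (c z)) (ae_class M (c w)) = cinner z w"
    if z: "z \<in> complexification F" and w: "w \<in> complexification F" for z w
  proof -
    note T_mult = sqint_mult[OF T_sq T_sq]
    have "L2_cinner M (ae_class M (c z)) (ae_class M (c w)) = (\<integral>\<omega>. c z \<omega> * cnj (c w \<omega>) \<partial>M)"
      by (rule L2_cinner_ae_class[OF c_meas[OF z] c_meas[OF w]])
    also have "\<dots> = (\<integral>\<omega>. complex_of_real (T (fst z) \<omega> * T (fst w) \<omega> + T (snd z) \<omega> * T (snd w) \<omega>) +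
        \<i> * complex_of_real (T (snd z) \<omega> * T (fst w) \<omega> - T (fst z) \<omega> * T (snd w) \<omega>) \<partial>M)"
      by (intro Bochner_Integration.integral_cong) (auto simp: c_def complex_eq_iff algebra_simps)
    also have "\<dots> = Complex (\<integral>\<omega>. T (fst z) \<omega> * T (fst w) \<omega> + T (snd z) \<omega> * T (snd w) \<omega> \<partial>M)
        (\<integral>\<omega>. T (snd z) \<omega> * T (fst w) \<omega> - T (fst z) \<omega> * T (snd w) \<omega> \<partial>M)"
      using mem[OF z] mem[OF w]
      by (intro integral_complex_split Bochner_Integration.integrable_add
          Bochner_Integration.integrable_diff T_mult)
    also have "\<dots> = cinner z w"
      using mem[OF z] mem[OF w] by (simp add: cinner_def T_mult T_T)
    finally show ?thesis .
  qed
  \<comment> \<open>Equality almost everywhere makes <x, x>, <x, y> and <y, y> equal, so norm (x -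
    y) is 0.\<close>
  have T_inj: "x = y" if "x \<in> F" "y \<in> F" and eq: "AE \<omega> in M. T x \<omega> = T y \<omega>" for x y
  proof -
    note [measurable] = sqint_measurable[OF T_sq[OF that(1)]] sqint_measurable[OF T_sq[OF that(2)]]
    have "AE \<omega> in M. T x \<omega> * T x \<omega> = T x \<omega> * T y \<omega>" "AE \<omega> in M. T y \<omega> * T y \<omega> = T x \<omega> * T y \<omega>"
      using eq by (eventually_elim, simp)+
    then have "(\<integral>\<omega>. T x \<omega> * T x \<omega> \<partial>M) = (\<integral>\<omega>. T x \<omega> * T y \<omega> \<partial>M)"
      "(\<integral>\<omega>. T y \<omega> * T y \<omega> \<partial>M) = (\<integral>\<omega>. T x \<omega> * T y \<omega> \<partial>M)"
      by (auto intro!: integral_cong_AE)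
    then have "inner (x - y) (x - y) = 0"
      using that by (simp add: T_T inner_diff_left inner_diff_right inner_commute)
    then show ?thesis by simp
  qed
  have "bij_betw U (complexification F) (L2 M)"
    unfolding bij_betw_def
  proof
    show "inj_on U (complexification F)"
    proof (rule inj_onI)
      fix z w assume z: "z \<in> complexification F" and w: "w \<in> complexification F" and "U z = U w"
      then have eq: "AE \<omega> in M. c z \<omega> = c w \<omega>"
        using c_meas[OF z] by (intro ae_class_eqD) (simp_all add: U)
      have "AE \<omega> in M. T (fst z) \<omega> = T (fst w) \<omega>" "AE \<omega> in M. T (snd z) \<omega> = T (snd w) \<omega>"
        using eq by (eventually_elim, simp add: c_def complex_eq_iff)+
      then show "z = w" using mem[OF z] mem[OF w] by (auto intro!: prod_eqI T_inj)
    qed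
    show "U ` complexification F = L2 M"
    proof
      show "U ` complexification F \<subseteq> L2 M" using c_L2 by (auto simp: U)
      show "L2 M \<subseteq> U ` complexification F"
      proof
        fix A :: "('b \<Rightarrow> complex) set" assume A: "A \<in> L2 M"
        obtain x where x: "x \<in> F" "AE \<omega> in M. T x \<omega> = Re (L2_rep A \<omega>)"
          using surj[OF sqint_Re_Im_L2_rep(1)[OF A]] by blast
        obtain y where y: "y \<in> F" "AE \<omega> in M. T y \<omega> = Im (L2_rep A \<omega>)"
          using surj[OF sqint_Re_Im_L2_rep(2)[OF A]] by blast
        have xy: "(x, y) \<in> complexification F" using x y by (simp add: complexification_def)
        have "AE \<omega> in M. c (x, y) \<omega> = L2_rep A \<omega>"
          using x(2) y(2) by eventually_elim (simp add: c_def complex_eq_iff)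
        then have "ae_class M (c (x, y)) = ae_class M (L2_rep A)" by (rule ae_class_cong)
        then have "U (x, y) = A" by (simp only: U[OF xy] ae_class_L2_rep[OF A])
        then show "A \<in> U ` complexification F" using xy by blast
      qed
    qed
  qed
  moreover have "U (z + w) = L2_add M (U z) (U w)"
    if z: "z \<in> complexification F" and w: "w \<in> complexification F" for z w
  proof -
    have zw: "z + w \<in> complexification F"
      using mem[OF z] mem[OF w] F by (cases z; cases w) (auto simp: complexification_def subspace_add)
    have "AE \<omega> in M. c (z + w) \<omega> = c z \<omega> + c w \<omega>"
      using T_add[OF mem(1)[OF z] mem(1)[OF w]] T_add[OF mem(2)[OF z] mem(2)[OF w]]
      by eventually_elim (simp add: c_def algebra_simps)
    then show ?thesis
      by (simp add: U z w zw L2_add_ae_class[OF c_meas[OF z] c_meas[OF w]] ae_class_cong)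
  qed
  moreover have "U (cscale r z) = L2_scale M r (U z)" if z: "z \<in> complexification F" for r z
  proof -
    note mz = mem[OF z]
    have rz: "cscale r z \<in> complexification F"
      using mz F by (auto simp: cscale_def complexification_def subspace_add subspace_diff subspace_scale)
    have lin: "AE \<omega> in M. T (a *\<^sub>R x + b *\<^sub>R y) \<omega> = a * T x \<omega> + b * T y \<omega>"
      if "x \<in> F" "y \<in> F" for a b x y
      using T_add[OF subspace_scale[OF F that(1), of a] subspace_scale[OF F that(2), of b]]
        T_scale[OF that(1), of a] T_scale[OF that(2), of b]
      by eventually_elim simp
    have "AE \<omega> in M. c (cscale r z) \<omega> = r * c z \<omega>"
      using lin[OF mz, of "Re r" "- Im r"] lin[OF mz(2,1), of "Re r" "Im r"]
      by eventually_elim (simp add: c_def cscale_def complex_eq_iff algebra_simps)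
    then show ?thesis
      by (simp add: U z rz L2_scale_ae_class[OF c_meas[OF z]] ae_class_cong)
  qed
  ultimately show "unitary_to_L2 F M U"
    by (simp add: unitary_to_L2_def U cinner_c)
qed

text \<open>Unitarity gives \<open>U1 z\<close> and \<open>U2 z\<close> the same inner product with
  each \<open>E j\<close>. As the \<open>E j\<close> are real, real and imaginary parts can be
  compared separately by totality.\<close>

lemma unitary_to_L2_unique:
  fixes F :: "'v::real_inner set" and e :: "'j \<Rightarrow> 'v" and E :: "'j \<Rightarrow> 'b \<Rightarrow> real"
  assumes U1: "unitary_to_L2 F M U1" "U1 \<in> complexification F \<rightarrow>\<^sub>E L2 M"
    and U2: "unitary_to_L2 F M U2" "U2 \<in> complexification F \<rightarrow>\<^sub>E L2 M"
    and e: "\<And>j. j \<in> J \<Longrightarrow> e j \<in> F" and F0: "0 \<in> F"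
    and E: "\<And>j. j \<in> J \<Longrightarrow> sqint M (E j)"
    and eq1: "\<And>j. j \<in> J \<Longrightarrow> U1 (e j, 0) = ae_class M (\<lambda>x. complex_of_real (E j x))"
    and eq2: "\<And>j. j \<in> J \<Longrightarrow> U2 (e j, 0) = ae_class M (\<lambda>x. complex_of_real (E j x))"
    and total: "\<And>g. sqint M g \<Longrightarrow> (\<And>j. j \<in> J \<Longrightarrow> (\<integral>x. g x * E j x \<partial>M) = 0) \<Longrightarrow> AE x in M. g x = 0"
  shows "U1 = U2"
proof (rule PiE_ext[OF U1(2) U2(2)])
  fix z assume z: "z \<in> complexification F"
  have A: "U1 z \<in> L2 M" and B: "U2 z \<in> L2 M" using z U1(2) U2(2) by auto
  have eq: "(\<integral>x. Re (L2_rep (U1 z) x) * E j x \<partial>M) = (\<integral>x. Re (L2_rep (U2 z) x) * E j x \<partial>M) \<and>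
      (\<integral>x. Im (L2_rep (U1 z) x) * E j x \<partial>M) = (\<integral>x. Im (L2_rep (U2 z) x) * E j x \<partial>M)" if j: "j \<in> J" for j
  proof -
    have ej: "(e j, 0) \<in> complexification F" using e[OF j] F0 by (simp add: complexification_def)
    have "L2_cinner M (U1 z) (U1 (e j, 0)) = L2_cinner M (U2 z) (U2 (e j, 0))"
      using U1(1) U2(1) z ej by (simp add: unitary_to_L2_def)
    then show ?thesis
      by (simp add: eq1[OF j] eq2[OF j] L2_cinner_of_real[OF A E[OF j]] L2_cinner_of_real[OF B E[OF j]])
  qed
  have "AE x in M. Re (L2_rep (U1 z) x) - Re (L2_rep (U2 z) x) = 0"
  proof (rule total)
    show "sqint M (\<lambda>x. Re (L2_rep (U1 z) x) - Re (L2_rep (U2 z) x))"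
      by (intro sqint_diff sqint_Re_Im_L2_rep A B)
    show "(\<integral>x. (Re (L2_rep (U1 z) x) - Re (L2_rep (U2 z) x)) * E j x \<partial>M) = 0" if "j \<in> J" for j
      using eq[OF that] sqint_mult[OF sqint_Re_Im_L2_rep(1)[OF A] E[OF that]]
        sqint_mult[OF sqint_Re_Im_L2_rep(1)[OF B] E[OF that]]
      by (simp add: left_diff_distrib)
  qed
  moreover have "AE x in M. Im (L2_rep (U1 z) x) - Im (L2_rep (U2 z) x) = 0"
  proof (rule total)
    show "sqint M (\<lambda>x. Im (L2_rep (U1 z) x) - Im (L2_rep (U2 z) x))"
      by (intro sqint_diff sqint_Re_Im_L2_rep A B)
    show "(\<integral>x. (Im (L2_rep (U1 z) x) - Im (L2_rep (U2 z) x)) * E j x \<partial>M) = 0" if "j \<in> J" for j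
      using eq[OF that] sqint_mult[OF sqint_Re_Im_L2_rep(2)[OF A] E[OF that]]
        sqint_mult[OF sqint_Re_Im_L2_rep(2)[OF B] E[OF that]]
      by (simp add: left_diff_distrib)
  qed
  ultimately have "AE x in M. L2_rep (U1 z) x = L2_rep (U2 z) x"
    by eventually_elim (simp add: complex_eq_iff)
  then have "ae_class M (L2_rep (U1 z)) = ae_class M (L2_rep (U2 z))" by (rule ae_class_cong)
  then show "U1 z = U2 z" by (simp only: ae_class_L2_rep[OF A] ae_class_L2_rep[OF B])
qed

section \<open>Cameron-Martin spaces and affine subspaces\<close>

lemma orth_proj_eq:
  assumes V: "subspace V" and y: "y \<in> V" "\<And>z. z \<in> V \<Longrightarrow> inner (h - y) z = 0"
  shows "orth_proj V h = y"
  unfolding orth_proj_def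
proof (rule the_equality)
  show "y \<in> V \<and> (\<forall>z\<in>V. inner (h - y) z = 0)" using y by blast
  fix y' assume y': "y' \<in> V \<and> (\<forall>z\<in>V. inner (h - y') z = 0)"
  have d: "y' - y \<in> V" using V y(1) y' by (auto intro: subspace_diff)
  have "inner (y' - y) (y' - y) = inner (h - y) (y' - y) - inner (h - y') (y' - y)"
    by (simp add: inner_diff_left)
  also have "\<dots> = 0" using y(2)[OF d] y' d by simp
  finally show "y' = y" by simp
qed

text \<open>Both residuals are orthogonal to the difference of the projections, and Cauchy-Schwarz
  finishes. This makes the right side of the characteristic-function identity continuous in
  \<open>h\<close>.\<close>

lemma norm_orth_proj_diff_le:
  fixes V :: "'h::{real_inner, complete_space} set"
  assumes V: "closed V" "subspace V"
  shows "norm (orth_proj V a - orth_proj V b) \<le> norm (a - b)"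
proof -
  obtain x where x: "x \<in> V" "\<And>z. z \<in> V \<Longrightarrow> inner (a - x) z = 0"
    using orthogonal_projection_exists[OF V, of a] by auto
  obtain y where y: "y \<in> V" "\<And>z. z \<in> V \<Longrightarrow> inner (b - y) z = 0"
    using orthogonal_projection_exists[OF V, of b] by auto
  have d: "x - y \<in> V" using V(2) x(1) y(1) by (rule subspace_diff)
  have "(norm (x - y))\<^sup>2 = inner (a - b) (x - y) - inner (a - x) (x - y) + inner (b - y) (x - y)"
    by (simp add: power2_norm_eq_inner inner_diff_left)
  also have "\<dots> = inner (a - b) (x - y)" by (simp add: x(2)[OF d] y(2)[OF d])
  also have "\<dots> \<le> norm (a - b) * norm (x - y)" by (rule norm_cauchy_schwarz)
  finally have "norm (x - y) \<le> norm (a - b)"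
    by (cases "x = y") (simp_all add: power2_eq_square)
  then show ?thesis by (simp add: orth_proj_eq[OF V(2) x] orth_proj_eq[OF V(2) y])
qed

text \<open>Translating \<open>L\<close> by any of its points gives its direction space. Minimality
  of |h + t v| at t = 0 forces the linear term of a quadratic in t to vanish.\<close>

lemma closest_point_affine:
  fixes L :: "'h::real_inner set"
  assumes L: "closed_affine_subspace L" and h: "h \<in> L" "\<And>x. x \<in> L \<Longrightarrow> norm h \<le> norm x"
  defines "V \<equiv> (\<lambda>x. x - h) ` L"
  shows "closed V" "subspace V" "\<And>v. v \<in> V \<Longrightarrow> inner h v = 0"
proof -
  obtain p W where W: "closed W" "subspace W" "L = (+) p ` W"
    using L by (auto simp: closed_affine_subspace_def)
  obtain w where w: "w \<in> W" "h = p + w" using h(1) W(3) by auto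
  have "V = W"
  proof
    show "V \<subseteq> W" using W w by (auto simp: V_def subspace_diff)
    show "W \<subseteq> V"
    proof
      fix x assume "x \<in> W"
      then have "x + w \<in> W" using W(2) w(1) by (simp add: subspace_add)
      then show "x \<in> V" using W(3) w(2) by (auto simp: V_def image_image intro!: image_eqI[of _ _ "x + w"])
    qed
  qed
  then show "closed V" "subspace V" using W by simp_all
  fix v assume "v \<in> V"
  then have "v \<in> W" using \<open>V = W\<close> by simp
  have quad: "0 \<le> 2 * t * inner h v + t\<^sup>2 * inner v v" for t
  proof -
    have "w + t *\<^sub>R v \<in> W" using W(2) w(1) \<open>v \<in> W\<close> by (simp add: subspace_add subspace_scale)
    then have "h + t *\<^sub>R v \<in> L" using W(3) w(2) by (auto simp: add.assoc)
    from power_mono[OF h(2)[OF this], of 2] have "inner h h \<le> inner (h + t *\<^sub>R v) (h + t *\<^sub>R v)"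
      by (simp add: power2_norm_eq_inner)
    then show ?thesis
      by (simp add: inner_add_left inner_add_right inner_commute power2_eq_square algebra_simps)
  qed
  show "inner h v = 0"
  proof (cases "v = 0")
    case False
    then have vv: "inner v v > 0" by simp
    have "0 \<le> - ((inner h v)\<^sup>2 / inner v v)"
      using quad[of "- inner h v / inner v v"] vv by (simp add: power2_eq_square field_simps)
    moreover have "(inner h v)\<^sup>2 / inner v v \<ge> 0" using vv by simp
    ultimately show ?thesis using vv by simp
  qed simp
qed

section \<open>The dual space inside the Cameron-Martin space\<close>

lemma functional_of_eq:
  fixes \<mu> :: "'b::{banach, second_countable_topology} measure" and f :: "'b \<Rightarrow>\<^sub>L real"
  assumes \<mu>: "centered_gaussian \<mu>" and I: "I h \<in> L2 \<mu>" and f: "blinfun_apply f \<in> I h"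
  shows "functional_of I h = f"
  unfolding functional_of_def
proof (rule the_equality)
  fix g :: "'b \<Rightarrow>\<^sub>L real" assume g: "blinfun_apply g \<in> I h"
  interpret prob_space \<mu> using \<mu> by (simp add: centered_gaussian_def)
  obtain F where "I h = ae_class \<mu> F" using I by (auto simp: L2_def)
  then have "AE x in \<mu>. blinfun_apply f x = F x" "AE x in \<mu>. blinfun_apply g x = F x"
    using f g by (simp_all add: ae_class_def)
  then have eq: "AE x in \<mu>. blinfun_apply (g - f) x = 0"
    by eventually_elim (simp add: blinfun.diff_left)
  show "g = f"
  proof (rule ccontr)
    assume "g \<noteq> f"
    then have "g - f \<noteq> 0" by simp
    then obtain \<sigma> where \<sigma>: "\<sigma> > 0"
      "distributed \<mu> lborel (blinfun_apply (g - f)) (\<lambda>t. ennreal (normal_density 0 \<sigma> t))"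
      using \<mu> unfolding centered_gaussian_def by blast
    \<comment> \<open>A nonzero functional has a density, so it takes the value 0 with probability
      0, against \<open>eq\<close>.\<close>
    have "emeasure \<mu> (blinfun_apply (g - f) -` {0} \<inter> space \<mu>) =
        (\<integral>\<^sup>+t. ennreal (normal_density 0 \<sigma> t) * indicator {0} t \<partial>lborel)"
      by (rule distributed_emeasure[OF \<sigma>(2)]) simp
    also have "\<dots> = (\<integral>\<^sup>+(t::real). 0 \<partial>lborel)"
    proof (rule nn_integral_cong_AE)
      show "AE t in lborel. ennreal (normal_density 0 \<sigma> t) * indicator {0} t = 0"
        using AE_lborel_singleton[of "0 :: real"] by eventually_elim simp
    qed
    finally have "AE x in \<mu>. \<not> (blinfun_apply (g - f) x = 0)"
      using measurable_sets[OF distributed_measurable[OF \<sigma>(2)], of "{0}"]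
      by (intro AE_I[of _ _ "blinfun_apply (g - f) -` {0} \<inter> space \<mu>"]) auto
    with eq have "AE x in \<mu>. False" by eventually_elim simp
    then show False by simp
  qed
qed (rule f)

lemma dual_functional_in_range:
  fixes \<mu> :: "'b::{banach, second_countable_topology} measure" and f :: "'b \<Rightarrow>\<^sub>L real"
    and I :: "'h::{real_inner, complete_space} \<Rightarrow> ('b \<Rightarrow> real) set"
  assumes \<mu>: "centered_gaussian \<mu>" and I: "cameron_martin \<mu> I"
  obtains h where "h \<in> H_dual I" "I h = ae_class \<mu> (blinfun_apply f)" "functional_of I h = f"
proof -
  have L2: "I h \<in> L2 \<mu>" for h using I by (simp add: cameron_martin_def linear_L2_def)
  have "ae_class \<mu> (blinfun_apply f) \<in> range I" using I by (simp add: cameron_martin_def)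
  then obtain h where h: "I h = ae_class \<mu> (blinfun_apply f)" by auto
  have "sets \<mu> = sets borel" using \<mu> by (simp add: centered_gaussian_def)
  then have "blinfun_apply f \<in> borel_measurable \<mu>"
    by (rule borel_measurable_blinfun_apply)
  then have f: "blinfun_apply f \<in> I h" by (simp add: h ae_class_def)
  then have "h \<in> H_dual I" by (auto simp: H_dual_def)
  then show ?thesis using h functional_of_eq[where I = I and h = h, OF \<mu> L2 f] by (rule that)
qed

text \<open>The isometry turns approximation of \<open>I h\<close> by functionals into approximation
  of \<open>h\<close> in \<open>H\<close>.\<close>

lemma H_dual_approachable:
  fixes \<mu> :: "'b::{banach, second_countable_topology} measure"
    and I :: "'h::{real_inner, complete_space} \<Rightarrow> ('b \<Rightarrow> real) set"
  assumes \<mu>: "centered_gaussian \<mu>" and I: "cameron_martin \<mu> I" and e: "0 < e"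
  shows "\<exists>g\<in>H_dual I. norm (g - h) < e"
proof -
  have lin: "linear_L2 \<mu> I" and iso: "\<And>h. L2_norm \<mu> (I h) = norm h"
    using I by (simp_all add: cameron_martin_def)
  obtain f :: "'b \<Rightarrow>\<^sub>L real" where f: "L2_dist \<mu> (I h) (ae_class \<mu> (blinfun_apply f)) < e"
    using I e unfolding cameron_martin_def by blast
  obtain g where g: "g \<in> H_dual I" "I g = ae_class \<mu> (blinfun_apply f)"
    using dual_functional_in_range[OF \<mu> I, of f] by blast
  have "I (h - g) = L2_add \<mu> (I h) (L2_scale \<mu> (- 1) (I g))"
    using lin unfolding linear_L2_def
    by (metis scaleR_minus1_left uminus_add_conv_diff add.commute)
  then have "norm (h - g) < e" using f iso[of "h - g"] by (simp add: L2_dist_def g(2))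
  then show ?thesis using g(1) by (auto simp: norm_minus_commute)
qed

lemma norm_iexp_diff_le: "norm (iexp a - iexp b) \<le> \<bar>a - b\<bar>"
proof -
  have "iexp a - iexp b = iexp b * (iexp (a - b) - 1)"
    by (simp add: right_diff_distrib exp_add[symmetric] distrib_left[symmetric])
  then have "norm (iexp a - iexp b) = norm (iexp (a - b) - 1)" by (simp add: norm_mult)
  also have "\<dots> \<le> \<bar>a - b\<bar>" using iexp_approx1[of "a - b" 0] by simp
  finally show ?thesis .
qed

text \<open>
  Both sides of the characteristic-function identity are continuous in \<open>h\<close>, and \<open>H_dual I\<close> is dense.
\<close>

lemma affine_gaussian_if_cameron_martin:
  fixes \<mu> M :: "'b::{banach, second_countable_topology} measure"
    and I I\<^sub>L :: "'h::{real_inner, complete_space} \<Rightarrow> ('b \<Rightarrow> real) set"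
  assumes \<mu>: "centered_gaussian \<mu>" and I: "cameron_martin \<mu> I"
    and V: "closed V" "subspace V" and orth: "\<And>v. v \<in> V \<Longrightarrow> inner m v = 0"
    and M: "prob_space M" "sets M = sets borel"
    and char: "\<And>h. h \<in> H_dual I \<Longrightarrow>
      (\<integral>x. iexp (blinfun_apply (functional_of I h) x) \<partial>M) =
      exp (\<i> * complex_of_real (inner m h) - complex_of_real ((norm (orth_proj V h))\<^sup>2 / 2))"
    and lin: "linear_L2 M I\<^sub>L" and bound: "\<And>h. L2_norm M (I\<^sub>L h) \<le> C * norm h"
    and ext: "\<And>h. h \<in> H_dual I \<Longrightarrow> I\<^sub>L h = ae_class M (blinfun_apply (functional_of I h))"
  shows "affine_gaussian M (\<lambda>h. L2_rep (I\<^sub>L h)) V m"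
proof -
  interpret prob_space M by fact
  define J where "J h = L2_rep (I\<^sub>L h)" for h
  have L2: "I\<^sub>L h \<in> L2 M" for h using lin by (simp add: linear_L2_def)
  have J_sq: "sqint M (J h)" for h unfolding J_def by (rule sqint_L2_rep[OF L2])
  have J_meas [measurable]: "J h \<in> borel_measurable M" for h using J_sq by (rule sqint_measurable)
  have J_class: "I\<^sub>L h = ae_class M (J h)" for h by (simp add: J_def ae_class_L2_rep[OF L2])
  have J_add: "AE x in M. J (g + h) x = J g x + J h x" for g h
    by (rule ae_class_eqD) (use lin in \<open>auto simp: linear_L2_def L2_add_def J_class[symmetric] J_def[symmetric]\<close>)
  have J_scale: "AE x in M. J (r *\<^sub>R h) x = r * J h x" for r h
    by (rule ae_class_eqD) (use lin in \<open>auto simp: linear_L2_def L2_scale_def J_class[symmetric] J_def[symmetric]\<close>)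
  have f_meas [measurable]: "blinfun_apply f \<in> borel_measurable M" for f :: "'b \<Rightarrow>\<^sub>L real"
    by (rule borel_measurable_blinfun_apply[OF M(2)])
  have J_dual: "AE x in M. J h x = blinfun_apply (functional_of I h) x" if "h \<in> H_dual I" for h
    using ext[OF that] J_class[of h] by (intro ae_class_eqD) auto
  define \<psi> where "\<psi> h = (\<integral>x. iexp (J h x) \<partial>M)" for h
  define \<xi> where "\<xi> h = exp (\<i> * complex_of_real (inner m h) - complex_of_real ((norm (orth_proj V h))\<^sup>2 / 2))" for h
  have \<psi>_dual: "\<psi> h = \<xi> h" if "h \<in> H_dual I" for h
  proof -
    have "\<psi> h = (\<integral>x. iexp (blinfun_apply (functional_of I h) x) \<partial>M)"
      unfolding \<psi>_def
      by (intro integral_cong_AE) (use J_dual[OF that] in \<open>auto elim: eventually_mono\<close>)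
    then show ?thesis using char[OF that] by (simp add: \<xi>_def)
  qed
  \<comment> \<open>Lipschitz bound from |e^(ia) - e^(ib)| \<le> |a - b|, from L1 norms being at
    most L2 norms on a probability space, and from boundedness of \<open>I\<^sub>L\<close>.\<close>
  have \<psi>_diff: "norm (\<psi> g - \<psi> h) \<le> C * norm (g - h)" for g h
  proof -
    have int: "integrable M (\<lambda>x. iexp (J h x))" for h
      by (rule integrable_const_bound[of _ 1]) auto
    have "norm (\<psi> g - \<psi> h) = norm (\<integral>x. iexp (J g x) - iexp (J h x) \<partial>M)"
      using int by (simp add: \<psi>_def)
    also have "\<dots> \<le> (\<integral>x. norm (iexp (J g x) - iexp (J h x)) \<partial>M)"
      by (rule integral_norm_bound)
    also have "\<dots> \<le> (\<integral>x. \<bar>J (g - h) x\<bar> \<partial>M)"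
    proof (rule integral_mono_AE)
      show "integrable M (\<lambda>x. norm (iexp (J g x) - iexp (J h x)))"
        by (intro integrable_norm Bochner_Integration.integrable_diff int)
      show "integrable M (\<lambda>x. \<bar>J (g - h) x\<bar>)" by (rule integral_abs_le_sqrt(1)[OF J_sq])
      show "AE x in M. norm (iexp (J g x) - iexp (J h x)) \<le> \<bar>J (g - h) x\<bar>"
        using J_add[of "g - h" h]
      proof eventually_elim
        case (elim x)
        then show ?case using norm_iexp_diff_le[of "J g x" "J h x"] by simp
      qed
    qed
    also have "\<dots> \<le> sqrt (\<integral>x. (J (g - h) x)\<^sup>2 \<partial>M)" by (rule integral_abs_le_sqrt(2)[OF J_sq])
    also have "\<dots> \<le> C * norm (g - h)" using bound[of "g - h"] by (simp add: L2_norm_def J_def)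
    finally show ?thesis .
  qed
  have \<psi>_eq: "\<psi> h = \<xi> h" for h
  proof -
    have "\<exists>g\<in>H_dual I. norm (g - h) < 1 / real (Suc n)" for n
      by (rule H_dual_approachable[OF \<mu> I]) simp
    then obtain g where g: "\<And>n. g n \<in> H_dual I" "\<And>n. norm (g n - h) < 1 / real (Suc n)" by metis
    have g0: "(\<lambda>n. norm (g n - h)) \<longlonglongrightarrow> 0"
      by (rule tendsto_sandwich[OF _ _ tendsto_const LIMSEQ_Suc[OF lim_1_over_n]])
        (use g(2) in \<open>auto intro!: always_eventually less_imp_le\<close>)
    have "(\<lambda>n. \<psi> (g n)) \<longlonglongrightarrow> \<psi> h"
    proof (rule Lim_null[THEN iffD2], rule Lim_null_comparison)
      show "\<forall>\<^sub>F n in sequentially. norm (\<psi> (g n) - \<psi> h) \<le> C * norm (g n - h)"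
        by (intro always_eventually allI \<psi>_diff)
      show "(\<lambda>n. C * norm (g n - h)) \<longlonglongrightarrow> 0" by (rule tendsto_mult_right_zero[OF g0])
    qed
    moreover have "(\<lambda>n. \<xi> (g n)) \<longlonglongrightarrow> \<xi> h"
    proof -
      have "g \<longlonglongrightarrow> h" using g0 by (simp add: Lim_null[of g] tendsto_norm_zero_iff)
      moreover have "(\<lambda>n. orth_proj V (g n)) \<longlonglongrightarrow> orth_proj V h"
      proof (rule Lim_null[THEN iffD2], rule Lim_null_comparison)
        show "\<forall>\<^sub>F n in sequentially. norm (orth_proj V (g n) - orth_proj V h) \<le> norm (g n - h)"
          by (intro always_eventually allI norm_orth_proj_diff_le V)
      qed (rule g0)
      ultimately show ?thesis unfolding \<xi>_def by (intro tendsto_intros) auto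
    qed
    ultimately show ?thesis using LIMSEQ_unique \<psi>_dual[OF g(1)] by simp
  qed
  show ?thesis
    unfolding J_def[symmetric]
  proof
    show "\<exists>h. AE x in M. J h x = blinfun_apply f x" for f :: "'b \<Rightarrow>\<^sub>L real"
    proof -
      obtain h where "h \<in> H_dual I" "functional_of I h = f"
        using dual_functional_in_range[OF \<mu> I, of f] by blast
      then show ?thesis using J_dual[of h] by auto
    qed
    fix v k assume v: "v \<in> V" and k: "\<And>z. z \<in> V \<Longrightarrow> inner k z = 0"
    have "orth_proj V (v + k) = v" using k by (intro orth_proj_eq V v) simp
    \<comment> \<open>As \<open>m\<close> is orthogonal to \<open>V\<close>, the mean <m, v + k>
      reduces to <m, k>.\<close>
    then show "(\<integral>x. iexp (J (v + k) x) \<partial>M) =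
        exp (\<i> * complex_of_real (inner m k) - complex_of_real ((norm v)\<^sup>2 / 2))"
      using \<psi>_eq[of "v + k"] orth[OF v] by (simp add: \<psi>_def \<xi>_def inner_add_right)
  qed (use M V J_add J_scale in auto)
qed

theorem theorem3p1:
  fixes \<mu> \<mu>\<^sub>L :: "'b::{banach, second_countable_topology} measure"
    and I I\<^sub>L :: "'h::{real_inner, complete_space} \<Rightarrow> ('b \<Rightarrow> real) set"
    and L L\<^sub>0 :: "'h set"
    and h\<^sub>L :: 'h
  assumes "centered_gaussian \<mu>"
    and "cameron_martin \<mu> I"
    and "closed_affine_subspace L"
    and "h\<^sub>L \<in> L" and "\<forall>x\<in>L. norm h\<^sub>L \<le> norm x"
    and "L\<^sub>0 = (\<lambda>x. x - h\<^sub>L) ` L"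
    and "prob_space \<mu>\<^sub>L" and "sets \<mu>\<^sub>L = sets borel"
    and "\<forall>h\<in>H_dual I.
      (\<integral>x. exp (\<i> * complex_of_real (functional_of I h x)) \<partial>\<mu>\<^sub>L) =
      exp (\<i> * complex_of_real (inner h\<^sub>L h) - complex_of_real ((norm (orth_proj L\<^sub>0 h))\<^sup>2 / 2))"
    and "linear_L2 \<mu>\<^sub>L I\<^sub>L" and "\<exists>C. \<forall>h. L2_norm \<mu>\<^sub>L (I\<^sub>L h) \<le> C * norm h"
    and "\<forall>h\<in>H_dual I. I\<^sub>L h = ae_class \<mu>\<^sub>L (blinfun_apply (functional_of I h))"
  shows "\<exists>!U. U \<in> complexification (fock_space L\<^sub>0) \<rightarrow>\<^sub>E (L2 \<mu>\<^sub>L :: ('b \<Rightarrow> complex) set set) \<and>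
    unitary_to_L2 (fock_space L\<^sub>0) \<mu>\<^sub>L U \<and>
    (\<forall>v\<in>L\<^sub>0. U (exp_vector v, 0) =
      ae_class \<mu>\<^sub>L (\<lambda>x. complex_of_real (exp (L2_rep (I\<^sub>L v) x - (norm v)\<^sup>2 / 2))))"
proof -
  have L0: "closed L\<^sub>0" "subspace L\<^sub>0" "\<And>v. v \<in> L\<^sub>0 \<Longrightarrow> inner h\<^sub>L v = 0"
    using closest_point_affine[OF assms(3,4)] assms(5) by (simp_all add: assms(6))
  obtain C where C: "\<And>h. L2_norm \<mu>\<^sub>L (I\<^sub>L h) \<le> C * norm h" using assms(11) by blast
  interpret affine_gaussian \<mu>\<^sub>L "\<lambda>h. L2_rep (I\<^sub>L h)" L\<^sub>0 h\<^sub>L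
    by (rule affine_gaussian_if_cameron_martin[OF assms(1,2) L0 assms(7,8) _ assms(10) C])
      (use assms(9,12) in auto)
  have F: "fock_space L\<^sub>0 = closure (span (exp_vector ` L\<^sub>0))"
    by (rule fock_space_eq_closure_span_exp_vector[OF L0(2)])
  have sub_F: "subspace (fock_space L\<^sub>0)" unfolding F by (rule subspace_closure) simp
  have exp_F: "exp_vector v \<in> fock_space L\<^sub>0" if "v \<in> L\<^sub>0" for v
    unfolding F using that by (intro subsetD[OF closure_subset] span_base) simp
  obtain T where T_sq: "\<And>x. x \<in> fock_space L\<^sub>0 \<Longrightarrow> sqint \<mu>\<^sub>L (T x)"
    and T_T: "\<And>x y. x \<in> fock_space L\<^sub>0 \<Longrightarrow> y \<in> fock_space L\<^sub>0 \<Longrightarrow>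
      (\<integral>\<omega>. T x \<omega> * T y \<omega> \<partial>\<mu>\<^sub>L) = inner x y"
    and T_E: "\<And>x v. x \<in> fock_space L\<^sub>0 \<Longrightarrow> v \<in> L\<^sub>0 \<Longrightarrow>
      (\<integral>\<omega>. T x \<omega> * E v \<omega> \<partial>\<mu>\<^sub>L) = inner x (exp_vector v)"
    and T_surj: "\<And>g. sqint \<mu>\<^sub>L g \<Longrightarrow> \<exists>x\<in>fock_space L\<^sub>0. AE \<omega> in \<mu>\<^sub>L. T x \<omega> = g \<omega>"
    unfolding F
    by (rule gram_isometry[of L\<^sub>0 E exp_vector])
      (auto simp: sqint_E integral_E_mult inner_exp_vector intro: E_total)
  \<comment> \<open>Recognizes \<open>T x\<close> up to null sets by its integrals against the
    \<open>E v\<close>; linearity of \<open>T\<close> and its values on exponential vectors are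
    three instances.\<close>
  have AE_T: "AE \<omega> in \<mu>\<^sub>L. T x \<omega> = f \<omega>"
    if x: "x \<in> fock_space L\<^sub>0" and f: "sqint \<mu>\<^sub>L f"
      and eq: "\<And>v. v \<in> L\<^sub>0 \<Longrightarrow> (\<integral>\<omega>. f \<omega> * E v \<omega> \<partial>\<mu>\<^sub>L) = inner x (exp_vector v)" for x f
  proof -
    have "AE \<omega> in \<mu>\<^sub>L. T x \<omega> - f \<omega> = 0"
    proof (rule E_total)
      show "sqint \<mu>\<^sub>L (\<lambda>\<omega>. T x \<omega> - f \<omega>)" by (intro sqint_diff T_sq x f)
      show "(\<integral>\<omega>. (T x \<omega> - f \<omega>) * E v \<omega> \<partial>\<mu>\<^sub>L) = 0" if "v \<in> L\<^sub>0" for v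
        using sqint_mult[OF T_sq[OF x] sqint_E[OF that]] sqint_mult[OF f sqint_E[OF that]]
        by (simp add: left_diff_distrib T_E[OF x that] eq[OF that])
    qed
    then show ?thesis by eventually_elim simp
  qed
  have T_add: "AE \<omega> in \<mu>\<^sub>L. T (x + y) \<omega> = T x \<omega> + T y \<omega>"
    if "x \<in> fock_space L\<^sub>0" "y \<in> fock_space L\<^sub>0" for x y
  proof (rule AE_T)
    show "(\<integral>\<omega>. (T x \<omega> + T y \<omega>) * E v \<omega> \<partial>\<mu>\<^sub>L) = inner (x + y) (exp_vector v)" if "v \<in> L\<^sub>0" for v
      using sqint_mult[OF T_sq sqint_E[OF that]] that \<open>x \<in> fock_space L\<^sub>0\<close> \<open>y \<in> fock_space L\<^sub>0\<close>
      by (simp add: distrib_right T_E inner_add_left)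
  qed (use that in \<open>auto intro: sqint_add T_sq subspace_add[OF sub_F]\<close>)
  have T_scale: "AE \<omega> in \<mu>\<^sub>L. T (r *\<^sub>R x) \<omega> = r * T x \<omega>" if "x \<in> fock_space L\<^sub>0" for r x
  proof (rule AE_T)
    show "(\<integral>\<omega>. (r * T x \<omega>) * E v \<omega> \<partial>\<mu>\<^sub>L) = inner (r *\<^sub>R x) (exp_vector v)" if "v \<in> L\<^sub>0" for v
      using that \<open>x \<in> fock_space L\<^sub>0\<close> by (simp add: mult.assoc T_E)
  qed (use that in \<open>auto intro: sqint_scale T_sq subspace_scale[OF sub_F]\<close>)
  have T_exp: "AE \<omega> in \<mu>\<^sub>L. T (exp_vector v) \<omega> = E v \<omega>" if "v \<in> L\<^sub>0" for v
    by (rule AE_T) (use that in \<open>auto simp: exp_F sqint_E integral_E_mult inner_exp_vector\<close>)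
  define U where "U = (\<lambda>z\<in>complexification (fock_space L\<^sub>0).
    ae_class \<mu>\<^sub>L (\<lambda>\<omega>. complex_of_real (T (fst z) \<omega>) + \<i> * complex_of_real (T (snd z) \<omega>)))"
  note U = unitary_complexification[OF sub_F T_sq T_T T_add T_scale T_surj, folded U_def]
  have U_exp: "U (exp_vector v, 0) = ae_class \<mu>\<^sub>L (\<lambda>x. complex_of_real (E v x))" if v: "v \<in> L\<^sub>0" for v
  proof -
    \<comment> \<open>\<open>T 0\<close> is a chosen representative and vanishes only almost
      everywhere.\<close>
    have "AE \<omega> in \<mu>\<^sub>L. T 0 \<omega> = 0"
      using T_scale[OF subspace_0[OF sub_F], of 0] by simp
    then have "AE \<omega> in \<mu>\<^sub>L. complex_of_real (T (exp_vector v) \<omega>) + \<i> * complex_of_real (T 0 \<omega>) =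
        complex_of_real (E v \<omega>)"
      using T_exp[OF v] by eventually_elim simp
    then show ?thesis
      using exp_F[OF v] subspace_0[OF sub_F] by (simp add: U_def complexification_def ae_class_cong)
  qed
  show ?thesis
  proof (rule ex1I)
    show "U \<in> complexification (fock_space L\<^sub>0) \<rightarrow>\<^sub>E L2 \<mu>\<^sub>L \<and> unitary_to_L2 (fock_space L\<^sub>0) \<mu>\<^sub>L U \<and>
      (\<forall>v\<in>L\<^sub>0. U (exp_vector v, 0) =
        ae_class \<mu>\<^sub>L (\<lambda>x. complex_of_real (exp (L2_rep (I\<^sub>L v) x - (norm v)\<^sup>2 / 2))))"
      using U U_exp unfolding E_def by blast
    fix U' :: "'h fock \<times> 'h fock \<Rightarrow> ('b \<Rightarrow> complex) set"
    assume U': "U' \<in> complexification (fock_space L\<^sub>0) \<rightarrow>\<^sub>E L2 \<mu>\<^sub>L \<and> unitary_to_L2 (fock_space L\<^sub>0) \<mu>\<^sub>L U' \<and>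
      (\<forall>v\<in>L\<^sub>0. U' (exp_vector v, 0) =
        ae_class \<mu>\<^sub>L (\<lambda>x. complex_of_real (exp (L2_rep (I\<^sub>L v) x - (norm v)\<^sup>2 / 2))))"
    then have U'_exp: "U' (exp_vector v, 0) = ae_class \<mu>\<^sub>L (\<lambda>x. complex_of_real (E v x))" if "v \<in> L\<^sub>0" for v
      using that by (simp add: E_def)
    show "U' = U"
      by (rule unitary_to_L2_unique[where J = L\<^sub>0 and e = exp_vector and E = E, OF _ _ U exp_F
            subspace_0[OF sub_F] sqint_E U'_exp U_exp E_total])
        (use U' in blast)+
  qed
qed

end
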